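(* Let $\mathbb{B}=(\mathbb{B}_\alpha,\|\cdot\|_\alpha)_{\alpha\in[\alpha_*,\alpha^*]}$ be a scale of Banach spaces, $T>0$, $x\in\mathbb{B}_{\alpha_*}$, and suppose that conditions A1, A2, A3, B1, B2, B3 (listed in the context) are satisfied, where either ($\beta=0$ and $r\in(0,\infty]$) or ($\beta\in(0,\tfrac12)$ and $r=\infty$). Fix $\alpha_0\in(\alpha_*,\alpha^* )$ and $\gamma\in(\beta,1-\beta)$. Then for each $\lambda>\lambda_0(x,\alpha_0,\gamma,r,T)$ there exists a solution $u_{\alpha_0,\lambda,\gamma}$ to $$u(t)=U(t,0)x+\int_0^tU(t,s)B(u(s),s)\,\mathrm{d}s$$ on the interval $[0,\frac{\alpha^*-\alpha_0}{\lambda})$ in the scale $(\mathbb{B}_\alpha)_{\alpha\in[\alpha_0,\alpha^*]}$ satisfying $$\sup_{\alpha\in(\alpha_0,\alpha^*]}\ \sup_{0\le t<\frac{\alpha-\alpha_0}{\lambda}}(\alpha-\alpha_0-\lambda t)^\gamma\|u_{\alpha_0,\lambda,\gamma}(t)\|_\alpha<\infty .$$ Moreover, this solution also satisfies the a-priori estimate $$(\alpha-\alpha_0-\lambda t)^\gamma\|B(u_{\alpha_0,\lambda,\gamma}(t),\tau)\|_\alpha\le\Big(\frac{C_3}{\alpha_0-\alpha_*}+C(x,\alpha_0)\Big)(\alpha^*-\alpha_0)^\gamma(1+\|x\|_{\alpha_*})$$ for all $0\le\tau\le\frac{\alpha^*-\alpha_0}{\lambda}$, $\alpha\in(\alpha_0,\alpha^*]$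 and $0\le t<\frac{\alpha-\alpha_0}{\lambda}$.
   Context: Scale: $\mathbb{B}=(\mathbb{B}_\alpha,\|\cdot\|_\alpha)_{\alpha_*\le\alpha\le\alpha^*}$ are Banach spaces with $\mathbb{B}_{\alpha'}\subset\mathbb{B}_\alpha$ and $\|\cdot\|_\alpha\le\|\cdot\|_{\alpha'}$ for $\alpha'<\alpha$; $i_{\alpha'\alpha}$ is the embedding. $B_r^\alpha(x)=\{y\in\mathbb{B}_\alpha:\|y-x\|_\alpha\le r\}$ for $r\in(0,\infty)$, $B_\infty^\alpha(x)=\mathbb{B}_\alpha$. A nonlinear operator $L$ in the scale (relative to $r\in(0,\infty]$ and $x\in\mathbb{B}_{\alpha_*}$) is a collection of maps $L_{\alpha'\alpha}:B_r^{\alpha'}(x)\to\mathbb{B}_\alpha$, $\alpha_*\le\alpha'<\alpha\le\alpha^*$, with $L_{\alpha'\alpha''}y=i_{\alpha\alpha''}L_{\alpha'\alpha}y=L_{\alpha\alpha''}i_{\alpha'\alpha}y$ for $\alpha'<\alpha<\alpha''$ and $y\in B_r^{\alpha'}(x)$. It is a bounded linear operator in the scale if $r=\infty$ and every $L_{\alpha'\alpha}$ is a bounded linear operator $\mathbb{B}_{\alpha'}\to\mathbb{B}_\alpha$. Compositions are $(LK)_{\alpha'\alpha}=L_{\delta\alpha}K_{\alpha'\delta}$ for any $\delta\in(\alpha',\alpha)$ (independent of $\delta$). Subscripts are omitted; $\|\cdot\|_{\alpha'\alpha}$ is the operator norm in $L(\mathbb{B}_{\alpha'},\mathbb{B}_\alpha)$.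 Conditions ($x\in\mathbb{B}_{\alpha_*}$, $T>0$ fixed): A1. $(U(t,s))_{0\le s\le t<T}$ are bounded linear operators in the scale with $U(t,t)=1$ (the embedding), $U(t,q)U(q,s)=U(t,s)$ for $s\le q\le t$, and $(t,s)\mapsto U(t,s)\in L(\mathbb{B}_{\alpha'},\mathbb{B}_\alpha)$ strongly continuous for all $\alpha'<\alpha$. A2. There are $C_1>0$, $\beta\in[0,\frac12)$ with $\|U(t,s)\|_{\alpha'\alpha}\le\frac{C_1}{(\alpha-\alpha')^\beta}$ for all $\alpha'<\alpha$, $0\le s\le t<T$. A3. For each $\alpha\in(\alpha_*,\alpha^*]$ there is $C(x,\alpha)>0$ with $\|U(t,0)x-U(s,0)x\|_\alpha\le C(x,\alpha)|t-s|$ for $0\le s,t\le\frac{\alpha-\alpha_*}{\alpha^*-\alpha_*}T$. B1. For some $r\in(0,\infty]$, $(B(\cdot,t))_{t\in[0,T)}$ is a family of nonlinear operators in the scale (relative to $r$, $x$) such that $B_r^{\alpha'}(x)\times[0,T)\ni(u,t)\mapsto B(u,t)\in\mathbb{B}_\alpha$ is jointly continuous for all $\alpha'<\alpha$. B2. There is $C_2>0$ with $\|B(u,t)-B(v,t)\|_\alpha\le\frac{C_2}{(\alpha-\alpha')^{1-\beta}}\|u-v\|_{\alpha'}$ for all $\alpha'<\alpha$, $t\in[0,T)$, $u,v\in B_r^{\alpha'}(x)$ (same $\beta$ as in A2). B3. There is $C_3>0$ with $\|B(x,t)\|_\alpha\le\frac{C_3}{\alpha-\alpha_*}$ for all $t\in[0,T)$,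 $\alpha\in(\alpha_*,\alpha^*]$. Constant $\lambda_0$: for $\alpha_0\in(\alpha_*,\alpha^* )$, $\gamma\in(\beta,1-\beta)$, $r'\in(0,r]$ and with $C(x)=C(x,\alpha_0)$ and $1/\infty:=0$, $\lambda_0(x,\alpha_0,\gamma,r',T)$ is the maximum of the four numbers $$\frac{\alpha^*-\alpha_*}{T},\quad \frac{2^{2\gamma+1-\beta}C_1C_2}{\gamma-\beta},\quad \frac{4^{1-\beta}C_2(\alpha^*-\alpha_0)^\beta}{\gamma(1+\|x\|_{\alpha_*})}+\frac{2^{2+\gamma}C_1C_2}{\gamma},$$ $$\frac{C(x)(\alpha^*-\alpha_0)}{r'}+\frac{C_1\big(\frac{C_3}{\alpha_0-\alpha_*}+C(x)\big)(\alpha^*-\alpha_0)(1+\|x\|_{\alpha_*})}{(1-\gamma)r'} .$$ Solution: for $\alpha_0\in[\alpha_*,\alpha^* )$ and $\lambda>0$ with $\frac{\alpha^*-\alpha_0}{\lambda}\le T$, put $T(\alpha)=\frac{\alpha-\alpha_0}{\lambda}$. A solution to the integral equation on $[0,\frac{\alpha^*-\alpha_0}{\lambda})$ in the scale $(\mathbb{B}_\alpha)_{\alpha\in[\alpha_0,\alpha^*]}$ is a function $u:[0,T(\alpha^* ))\to\mathbb{B}_{\alpha^*}$ such that for all $\alpha\in(\alpha_0,\alpha^*]$: (i) $u|_{[0,T(\alpha))}\in C([0,T(\alpha));\mathbb{B}_\alpha)$ and $u(t)\in B_r^\alpha(x)$ for $t\in[0,T(\alpha))$; (ii) for each $t\in[0,T(\alpha))$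 there are $\alpha'<\alpha''$ in $[\alpha_0,\alpha)$ with $t<T(\alpha')$ such that $u(t)=U_{\alpha_*\alpha}(t,0)x+\int_0^tU_{\alpha''\alpha}(t,s)B_{\alpha'\alpha''}(u(s),s)\,\mathrm{d}s$ in $\mathbb{B}_\alpha$ (independent of the choice of $\alpha',\alpha''$). For $t<T(\alpha)$ one has $u(t)\in\mathbb{B}_{\alpha'}$ for some $\alpha'<\alpha$ with $t<T(\alpha')$, so $B(u(t),\tau)\in\mathbb{B}_\alpha$ makes sense.
   Formalization: Added assumption: the constants of A3 satisfy C(x,α) ≤ C(x,α_0) for all α in [α_0,α^*]. Without it the claim fails: λ_0 and the estimate use only C(x,α_0), which controls U(t,0)x only for t ≤ (α_0−α_* )T/(α^*−α_* ). *)

theory Defs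
  imports "HOL-Analysis.Analysis"
begin

text \<open>
  A scale of Banach spaces is a family of subspaces \<open>V \<alpha>\<close> of one real vector space (the type
  \<open>'a\<close>), each carrying its own norm \<open>N \<alpha>\<close>; the spaces grow with \<open>\<alpha>\<close> and the embeddings are
  set inclusions. The values of \<open>N \<alpha>\<close> outside \<open>V \<alpha>\<close> are irrelevant.
\<close>

definition normed_on :: "'a::real_vector set \<Rightarrow> ('a \<Rightarrow> real) \<Rightarrow> bool" where
  "normed_on W n \<longleftrightarrow> subspace W \<and>
     (\<forall>u\<in>W. 0 \<le> n u \<and> (n u = 0 \<longleftrightarrow> u = 0)) \<and>
     (\<forall>c. \<forall>u\<in>W. n (c *\<^sub>R u) = \<bar>c\<bar> * n u) \<and>
     (\<forall>u\<in>W. \<forall>v\<in>W. n (u + v) \<le> n u + n v)"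

text \<open>
  The value 0 off the carrier is there because the library's \<open>Metric_space\<close> asks for
  nonnegativity and symmetry on the whole type.
\<close>

definition norm_dist :: "'a::real_vector set \<Rightarrow> ('a \<Rightarrow> real) \<Rightarrow> 'a \<Rightarrow> 'a \<Rightarrow> real" where
  "norm_dist W n u v = (if u \<in> W \<and> v \<in> W then n (u - v) else 0)"

definition norm_topology :: "'a::real_vector set \<Rightarrow> ('a \<Rightarrow> real) \<Rightarrow> 'a topology" where
  "norm_topology W n = Metric_space.mtopology W (norm_dist W n)"

definition banach_on :: "'a::real_vector set \<Rightarrow> ('a \<Rightarrow> real) \<Rightarrow> bool" where
  "banach_on W n \<longleftrightarrow> normed_on W n \<and> Metric_space.mcomplete W (norm_dist W n)"

definition banach_scale ::
    "real \<Rightarrow> real \<Rightarrow> (real \<Rightarrow> 'a::real_vector set) \<Rightarrow> (real \<Rightarrow> 'a \<Rightarrow> real) \<Rightarrow> bool" where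
  "banach_scale lo hi V N \<longleftrightarrow> lo < hi \<and>
     (\<forall>\<alpha>\<in>{lo..hi}. banach_on (V \<alpha>) (N \<alpha>)) \<and>
     (\<forall>\<alpha>' \<alpha>. lo \<le> \<alpha>' \<and> \<alpha>' < \<alpha> \<and> \<alpha> \<le> hi \<longrightarrow>
        V \<alpha>' \<subseteq> V \<alpha> \<and> (\<forall>u\<in>V \<alpha>'. N \<alpha> u \<le> N \<alpha>' u))"

definition scale_ball ::
    "(real \<Rightarrow> 'a::real_vector set) \<Rightarrow> (real \<Rightarrow> 'a \<Rightarrow> real) \<Rightarrow> ereal \<Rightarrow> real \<Rightarrow> 'a \<Rightarrow> 'a set" where
  "scale_ball V N r \<alpha> x = {y \<in> V \<alpha>. ereal (N \<alpha> (y - x)) \<le> r}"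

text \<open>An operator in the scale: \<open>L \<alpha>' \<alpha>\<close> is the map from level \<open>\<alpha>'\<close> to level \<open>\<alpha>\<close>, for \<open>\<alpha>' < \<alpha>\<close>.\<close>

type_synonym 'a scale_op = "real \<Rightarrow> real \<Rightarrow> 'a \<Rightarrow> 'a"

definition nonlinear_scale_op ::
    "real \<Rightarrow> real \<Rightarrow> (real \<Rightarrow> 'a::real_vector set) \<Rightarrow> (real \<Rightarrow> 'a \<Rightarrow> real) \<Rightarrow> ereal \<Rightarrow> 'a
      \<Rightarrow> 'a scale_op \<Rightarrow> bool" where
  "nonlinear_scale_op lo hi V N r x L \<longleftrightarrow>
     (\<forall>\<alpha>' \<alpha>. lo \<le> \<alpha>' \<and> \<alpha>' < \<alpha> \<and> \<alpha> \<le> hi \<longrightarrow> L \<alpha>' \<alpha> \<in> scale_ball V N r \<alpha>' x \<rightarrow> V \<alpha>) \<and>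
     (\<forall>\<alpha>' \<alpha> \<alpha>''. lo \<le> \<alpha>' \<and> \<alpha>' < \<alpha> \<and> \<alpha> < \<alpha>'' \<and> \<alpha>'' \<le> hi \<longrightarrow>
        (\<forall>y\<in>scale_ball V N r \<alpha>' x. L \<alpha>' \<alpha>'' y = L \<alpha>' \<alpha> y \<and> L \<alpha>' \<alpha>'' y = L \<alpha> \<alpha>'' y))"

definition bounded_linear_on ::
    "'a::real_vector set \<Rightarrow> ('a \<Rightarrow> real) \<Rightarrow> 'a set \<Rightarrow> ('a \<Rightarrow> real) \<Rightarrow> ('a \<Rightarrow> 'a) \<Rightarrow> bool" where
  "bounded_linear_on W n W' n' f \<longleftrightarrow> f \<in> W \<rightarrow> W' \<and>
     (\<forall>u\<in>W. \<forall>v\<in>W. f (u + v) = f u + f v) \<and>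
     (\<forall>c. \<forall>u\<in>W. f (c *\<^sub>R u) = c *\<^sub>R f u) \<and>
     (\<exists>K. \<forall>u\<in>W. n' (f u) \<le> K * n u)"

text \<open>
  Operator norm, in the form of the library's \<open>onorm\<close>; the quotient at \<open>u = 0\<close> is 0.
\<close>

definition onorm_on :: "'a::real_vector set \<Rightarrow> ('a \<Rightarrow> real) \<Rightarrow> ('a \<Rightarrow> real) \<Rightarrow> ('a \<Rightarrow> 'a) \<Rightarrow> real" where
  "onorm_on W n n' f = (SUP u\<in>W. n' (f u) / n u)"

text \<open>For infinite radius the ball is all of \<open>V \<alpha>'\<close>, so the centre 0 is immaterial.\<close>

definition bounded_linear_scale_op ::
    "real \<Rightarrow> real \<Rightarrow> (real \<Rightarrow> 'a::real_vector set) \<Rightarrow> (real \<Rightarrow> 'a \<Rightarrow> real) \<Rightarrow> 'a scale_op \<Rightarrow> bool" where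
  "bounded_linear_scale_op lo hi V N L \<longleftrightarrow> nonlinear_scale_op lo hi V N \<infinity> 0 L \<and>
     (\<forall>\<alpha>' \<alpha>. lo \<le> \<alpha>' \<and> \<alpha>' < \<alpha> \<and> \<alpha> \<le> hi \<longrightarrow>
        bounded_linear_on (V \<alpha>') (N \<alpha>') (V \<alpha>) (N \<alpha>) (L \<alpha>' \<alpha>))"

text \<open>
  In all conditions \<open>U t s\<close> is meaningful for \<open>0 \<le> s \<le> t < T\<close> only, and \<open>B t \<alpha>' \<alpha> u\<close> is
  \<open>B(u,t)\<close> as a map from level \<open>\<alpha>'\<close> to level \<open>\<alpha>\<close>.
\<close>

definition cond_A1 ::
    "real \<Rightarrow> real \<Rightarrow> (real \<Rightarrow> 'a::real_vector set) \<Rightarrow> (real \<Rightarrow> 'a \<Rightarrow> real) \<Rightarrow> real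
      \<Rightarrow> (real \<Rightarrow> real \<Rightarrow> 'a scale_op) \<Rightarrow> bool" where
  "cond_A1 lo hi V N T U \<longleftrightarrow>
     (\<forall>s t. 0 \<le> s \<and> s \<le> t \<and> t < T \<longrightarrow> bounded_linear_scale_op lo hi V N (U t s)) \<and>
     (\<forall>t\<in>{0..<T}. \<forall>\<alpha>' \<alpha>. lo \<le> \<alpha>' \<and> \<alpha>' < \<alpha> \<and> \<alpha> \<le> hi \<longrightarrow>
        (\<forall>y\<in>V \<alpha>'. U t t \<alpha>' \<alpha> y = y)) \<and>
     (\<forall>s q t. 0 \<le> s \<and> s \<le> q \<and> q \<le> t \<and> t < T \<longrightarrow>
        (\<forall>\<alpha>' \<delta> \<alpha>. lo \<le> \<alpha>' \<and> \<alpha>' < \<delta> \<and> \<delta> < \<alpha> \<and> \<alpha> \<le> hi \<longrightarrow>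
           (\<forall>y\<in>V \<alpha>'. U t q \<delta> \<alpha> (U q s \<alpha>' \<delta> y) = U t s \<alpha>' \<alpha> y))) \<and>
     (\<forall>\<alpha>' \<alpha>. lo \<le> \<alpha>' \<and> \<alpha>' < \<alpha> \<and> \<alpha> \<le> hi \<longrightarrow>
        (\<forall>y\<in>V \<alpha>'. continuous_map (top_of_set {(t, s). 0 \<le> s \<and> s \<le> t \<and> t < T})
           (norm_topology (V \<alpha>) (N \<alpha>)) (\<lambda>(t, s). U t s \<alpha>' \<alpha> y)))"

definition cond_A2 ::
    "real \<Rightarrow> real \<Rightarrow> (real \<Rightarrow> 'a::real_vector set) \<Rightarrow> (real \<Rightarrow> 'a \<Rightarrow> real) \<Rightarrow> real
      \<Rightarrow> (real \<Rightarrow> real \<Rightarrow> 'a scale_op) \<Rightarrow> real \<Rightarrow> real \<Rightarrow> bool" where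
  "cond_A2 lo hi V N T U \<beta> C1 \<longleftrightarrow> 0 < C1 \<and> 0 \<le> \<beta> \<and> \<beta> < 1/2 \<and>
     (\<forall>\<alpha>' \<alpha> s t. lo \<le> \<alpha>' \<and> \<alpha>' < \<alpha> \<and> \<alpha> \<le> hi \<and> 0 \<le> s \<and> s \<le> t \<and> t < T \<longrightarrow>
        onorm_on (V \<alpha>') (N \<alpha>') (N \<alpha>) (U t s \<alpha>' \<alpha>) \<le> C1 / (\<alpha> - \<alpha>') powr \<beta>)"

definition cond_A3 ::
    "real \<Rightarrow> real \<Rightarrow> (real \<Rightarrow> 'a::real_vector set) \<Rightarrow> (real \<Rightarrow> 'a \<Rightarrow> real) \<Rightarrow> real
      \<Rightarrow> (real \<Rightarrow> real \<Rightarrow> 'a scale_op) \<Rightarrow> 'a \<Rightarrow> (real \<Rightarrow> real) \<Rightarrow> bool" where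
  "cond_A3 lo hi V N T U x C \<longleftrightarrow>
     (\<forall>\<alpha>\<in>{lo<..hi}. 0 < C \<alpha> \<and>
        (\<forall>s t. 0 \<le> s \<and> s \<le> (\<alpha> - lo) / (hi - lo) * T \<and> s < T \<and>
               0 \<le> t \<and> t \<le> (\<alpha> - lo) / (hi - lo) * T \<and> t < T \<longrightarrow>
           N \<alpha> (U t 0 lo \<alpha> x - U s 0 lo \<alpha> x) \<le> C \<alpha> * \<bar>t - s\<bar>))"

definition cond_B1 ::
    "real \<Rightarrow> real \<Rightarrow> (real \<Rightarrow> 'a::real_vector set) \<Rightarrow> (real \<Rightarrow> 'a \<Rightarrow> real) \<Rightarrow> real
      \<Rightarrow> (real \<Rightarrow> 'a scale_op) \<Rightarrow> ereal \<Rightarrow> 'a \<Rightarrow> bool" where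
  "cond_B1 lo hi V N T B r x \<longleftrightarrow> 0 < r \<and>
     (\<forall>t\<in>{0..<T}. nonlinear_scale_op lo hi V N r x (B t)) \<and>
     (\<forall>\<alpha>' \<alpha>. lo \<le> \<alpha>' \<and> \<alpha>' < \<alpha> \<and> \<alpha> \<le> hi \<longrightarrow>
        continuous_map
          (prod_topology
             (subtopology (norm_topology (V \<alpha>') (N \<alpha>')) (scale_ball V N r \<alpha>' x))
             (top_of_set {0..<T}))
          (norm_topology (V \<alpha>) (N \<alpha>)) (\<lambda>(u, t). B t \<alpha>' \<alpha> u))"

definition cond_B2 ::
    "real \<Rightarrow> real \<Rightarrow> (real \<Rightarrow> 'a::real_vector set) \<Rightarrow> (real \<Rightarrow> 'a \<Rightarrow> real) \<Rightarrow> real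
      \<Rightarrow> (real \<Rightarrow> 'a scale_op) \<Rightarrow> ereal \<Rightarrow> 'a \<Rightarrow> real \<Rightarrow> real \<Rightarrow> bool" where
  "cond_B2 lo hi V N T B r x \<beta> C2 \<longleftrightarrow> 0 < C2 \<and>
     (\<forall>\<alpha>' \<alpha>. lo \<le> \<alpha>' \<and> \<alpha>' < \<alpha> \<and> \<alpha> \<le> hi \<longrightarrow>
        (\<forall>t\<in>{0..<T}. \<forall>u\<in>scale_ball V N r \<alpha>' x. \<forall>v\<in>scale_ball V N r \<alpha>' x.
           N \<alpha> (B t \<alpha>' \<alpha> u - B t \<alpha>' \<alpha> v)
             \<le> C2 / (\<alpha> - \<alpha>') powr (1 - \<beta>) * N \<alpha>' (u - v)))"

definition cond_B3 ::
    "real \<Rightarrow> real \<Rightarrow> (real \<Rightarrow> 'a::real_vector \<Rightarrow> real) \<Rightarrow> real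
      \<Rightarrow> (real \<Rightarrow> 'a scale_op) \<Rightarrow> 'a \<Rightarrow> real \<Rightarrow> bool" where
  "cond_B3 lo hi N T B x C3 \<longleftrightarrow> 0 < C3 \<and>
     (\<forall>t\<in>{0..<T}. \<forall>\<alpha>\<in>{lo<..hi}. N \<alpha> (B t lo \<alpha> x) \<le> C3 / (\<alpha> - lo))"

text \<open>
  Here \<open>Cx\<close> and \<open>nx\<close> stand for \<open>C(x,\<alpha>0)\<close> and for the norm of \<open>x\<close> at level \<open>lo\<close>. Division in
  \<open>ereal\<close> gives \<open>1 / \<infinity> = 0\<close>.
\<close>

definition lambda0 ::
    "real \<Rightarrow> real \<Rightarrow> real \<Rightarrow> real \<Rightarrow> real \<Rightarrow> real \<Rightarrow> real \<Rightarrow> real \<Rightarrow> real \<Rightarrow> real \<Rightarrow> real \<Rightarrow> ereal \<Rightarrow> real"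
  where
  "lambda0 lo hi T \<beta> C1 C2 C3 Cx nx \<alpha>0 \<gamma> r' =
     (let ir = real_of_ereal (1 / r') in
      Max {(hi - lo) / T,
           2 powr (2 * \<gamma> + 1 - \<beta>) * C1 * C2 / (\<gamma> - \<beta>),
           4 powr (1 - \<beta>) * C2 * (hi - \<alpha>0) powr \<beta> / (\<gamma> * (1 + nx))
             + 2 powr (2 + \<gamma>) * C1 * C2 / \<gamma>,
           Cx * (hi - \<alpha>0) * ir
             + C1 * (C3 / (\<alpha>0 - lo) + Cx) * (hi - \<alpha>0) * (1 + nx) / (1 - \<gamma>) * ir})"

text \<open>
  Riemann integral over \<open>[a,b]\<close> with values in the normed space \<open>(W, n)\<close>: all Riemann sums over
  sufficiently fine tagged divisions are \<open>n\<close>-close to \<open>I\<close>.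
\<close>

definition has_riemann_integral_on ::
    "'a::real_vector set \<Rightarrow> ('a \<Rightarrow> real) \<Rightarrow> (real \<Rightarrow> 'a) \<Rightarrow> 'a \<Rightarrow> real \<Rightarrow> real \<Rightarrow> bool" where
  "has_riemann_integral_on W n f I a b \<longleftrightarrow> I \<in> W \<and> f \<in> {a..b} \<rightarrow> W \<and>
     (\<forall>e>0. \<exists>d>0. \<forall>p. p tagged_division_of {a..b} \<and> (\<forall>(z, k)\<in>p. measure lborel k < d) \<longrightarrow>
        n ((\<Sum>(z, k)\<in>p. measure lborel k *\<^sub>R f z) - I) < e)"

text \<open>
  Solution of the integral equation on \<open>[0, (hi - \<alpha>0) / lam)\<close> in the scale over \<open>[\<alpha>0, hi]\<close>; the
  lifetime at level \<open>\<alpha>\<close> is \<open>(\<alpha> - \<alpha>0) / lam\<close>.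
\<close>

definition is_solution ::
    "real \<Rightarrow> real \<Rightarrow> (real \<Rightarrow> 'a::real_vector set) \<Rightarrow> (real \<Rightarrow> 'a \<Rightarrow> real)
      \<Rightarrow> (real \<Rightarrow> real \<Rightarrow> 'a scale_op) \<Rightarrow> (real \<Rightarrow> 'a scale_op) \<Rightarrow> ereal \<Rightarrow> 'a
      \<Rightarrow> real \<Rightarrow> real \<Rightarrow> (real \<Rightarrow> 'a) \<Rightarrow> bool" where
  "is_solution lo hi V N U B r x \<alpha>0 lam u \<longleftrightarrow>
     u \<in> {0..<(hi - \<alpha>0) / lam} \<rightarrow> V hi \<and>
     (\<forall>\<alpha>\<in>{\<alpha>0<..hi}.
        continuous_map (top_of_set {0..<(\<alpha> - \<alpha>0) / lam}) (norm_topology (V \<alpha>) (N \<alpha>)) u \<and>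
        (\<forall>t\<in>{0..<(\<alpha> - \<alpha>0) / lam}. u t \<in> scale_ball V N r \<alpha> x) \<and>
        (\<forall>t\<in>{0..<(\<alpha> - \<alpha>0) / lam}. \<exists>\<alpha>' \<alpha>'' I.
           \<alpha>0 \<le> \<alpha>' \<and> \<alpha>' < \<alpha>'' \<and> \<alpha>'' < \<alpha> \<and> t < (\<alpha>' - \<alpha>0) / lam \<and>
           has_riemann_integral_on (V \<alpha>) (N \<alpha>)
             (\<lambda>s. U t s \<alpha>'' \<alpha> (B s \<alpha>' \<alpha>'' (u s))) I 0 t \<and>
           u t = U t 0 lo \<alpha> x + I))"

end

theory Submission
  imports Defs
begin

text \<open>
  For a continuous \<open>b\<close> with \<open>N \<alpha> (b s) \<le> K * (\<alpha> - \<alpha>0 - lam * s) powr - \<gamma>\<close> on all levels, the function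
  \<open>u t = U(t,0) x + \<integral>\<^sub>0\<^sup>t U(t,s) b(s) ds\<close> is shown to stay in the ball and to satisfy the same bound for
  \<open>B(u(t),\<tau>)\<close>, so that \<open>b \<mapsto> B(u(\<cdot>),\<cdot>)\<close> can be iterated. The bound on \<open>B(u(t),\<tau>)\<close> cannot be obtained by
  comparing \<open>u t\<close> with \<open>x\<close> at one level, since the loss \<open>(\<alpha> - \<alpha>')\<close> to the power \<open>\<beta> - 1\<close> is too large.
  Instead \<open>x\<close> and \<open>u t\<close> are joined by the path \<open>U(s,0) x + \<integral>\<^sub>0\<^sup>s U(t,q) b(q) dq\<close>, \<open>0 \<le> s \<le> t\<close>, which
  unlike \<open>u\<close> is Lipschitz, and its increments at \<open>s\<close> are measured at levels that depend on \<open>s\<close>. They integrate to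
  \<open>\<integral>\<^sub>0\<^sup>t (\<alpha> - \<alpha>0 - lam * s) powr - (1 + \<gamma>) ds\<close>, which is of order \<open>(\<alpha> - \<alpha>0 - lam * t) powr - \<gamma> / (lam * \<gamma>)\<close>. The
  same integral makes the iteration a contraction for the weighted norms with ratio
  \<open>2 powr (2 + \<gamma>) * C1 * C2 / (lam * \<gamma>)\<close>.
\<close>

text \<open>Let \<open>\<rho> = \<alpha> - \<alpha>0 - lam * s\<close> be the room left at time
  \<open>s\<close>. If \<open>U\<close> and \<open>B\<close> are each given a gap of
  \<open>\<rho> / 4\<close>, their powers \<open>\<beta>\<close> and \<open>1 - \<beta>\<close>
  multiply to the cost \<open>4 / \<rho>\<close>; reading the datum at half the room costs
  \<open>2 powr \<gamma>\<close> more. This is the origin of \<open>2 powr (2 + \<gamma>)\<close>.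
  The power \<open>-1\<close> alone would integrate to a logarithm and would not reproduce itself;
  with the weight the exponent becomes \<open>-(1 + \<gamma>)\<close>, and its integral has the
  weighted form again. The time \<open>t\<close> enters \<open>u t\<close> also as the final time of
  \<open>U(t,s)\<close>, where only strong continuity is known. Freezing that argument leaves the
  upper limit of integration as the only moving part, hence the Lipschitz property of the path. The
  constant \<open>K\<close> has one summand that absorbs \<open>B(x,\<tau>)\<close> and one that
  absorbs the increments of \<open>U(s,0) x\<close>, so that the class of admissible
  \<open>b\<close> is mapped to itself with the same \<open>K\<close>. For finite \<open>r\<close>
  staying in the ball is a separate matter; there \<open>\<beta> = 0\<close>, so \<open>U\<close>
  costs no gap at all and the constants of \<open>lambda0\<close> are met exactly.\<close>

hide_const (open) Polynomial.content

section \<open>Normed carriers\<close>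

text \<open>The type \<open>'a\<close> carries a different norm on every level, so the norm is a
  locale parameter; the locale is interpreted at each level as the need arises.\<close>

locale normed_carrier =
  fixes W :: "'a::real_vector set" and n :: "'a \<Rightarrow> real"
  assumes normed: "normed_on W n"
begin

lemma subspace: "subspace W"
  using normed by (simp add: normed_on_def)

lemma n_nonneg: "u \<in> W \<Longrightarrow> 0 \<le> n u"
  using normed by (simp add: normed_on_def)

lemma eq_0_iff: "u \<in> W \<Longrightarrow> n u = 0 \<longleftrightarrow> u = 0"
  using normed by (simp add: normed_on_def)

lemma n_scale: "u \<in> W \<Longrightarrow> n (c *\<^sub>R u) = \<bar>c\<bar> * n u"
  using normed by (simp add: normed_on_def)

lemma n_triangle: "u \<in> W \<Longrightarrow> v \<in> W \<Longrightarrow> n (u + v) \<le> n u + n v"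
  using normed by (simp add: normed_on_def)

lemma zero_in: "0 \<in> W"
  and add_in: "u \<in> W \<Longrightarrow> v \<in> W \<Longrightarrow> u + v \<in> W"
  and diff_in: "u \<in> W \<Longrightarrow> v \<in> W \<Longrightarrow> u - v \<in> W"
  and scale_in: "u \<in> W \<Longrightarrow> c *\<^sub>R u \<in> W"
  and sum_in: "(\<And>i. i \<in> A \<Longrightarrow> f i \<in> W) \<Longrightarrow> sum f A \<in> W"
  using subspace by (auto intro: subspace_0 subspace_add subspace_diff subspace_scale subspace_sum)

lemma n_zero: "n 0 = 0"
  using eq_0_iff zero_in by blast

lemma n_commute: "u \<in> W \<Longrightarrow> v \<in> W \<Longrightarrow> n (u - v) = n (v - u)"
  using n_scale[of "v - u" "-1"] by (simp add: diff_in)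

lemma triangle_diff:
  assumes "u \<in> W" "v \<in> W" "w \<in> W"
  shows "n (u - w) \<le> n (u - v) + n (v - w)"
  using n_triangle[of "u - v" "v - w"] assms by (simp add: diff_in)

lemma norm_le_diff:
  assumes "u \<in> W" "v \<in> W"
  shows "n u \<le> n (u - v) + n v"
  using triangle_diff[of u v 0] assms by (simp add: zero_in)

lemma norm_sum:
  assumes "\<And>i. i \<in> A \<Longrightarrow> f i \<in> W"
  shows "n (sum f A) \<le> (\<Sum>i\<in>A. n (f i))"
  using assms
proof (induction A rule: infinite_finite_induct)
  case (insert a A)
  then have "n (sum f (insert a A)) \<le> n (f a) + n (sum f A)"
    by (simp add: n_triangle sum_in)
  with insert show ?case by force
qed (simp_all add: n_zero)

sublocale Metric_space W "norm_dist W n"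
proof
  fix u v w
  show "0 \<le> norm_dist W n u v"
    by (simp add: norm_dist_def n_nonneg diff_in)
  show "norm_dist W n u v = norm_dist W n v u"
    by (simp add: norm_dist_def n_commute)
  show "norm_dist W n u v = 0 \<longleftrightarrow> u = v" if "u \<in> W" "v \<in> W"
    using that by (simp add: norm_dist_def eq_0_iff diff_in)
  show "norm_dist W n u w \<le> norm_dist W n u v + norm_dist W n v w"
    if "u \<in> W" "v \<in> W" "w \<in> W"
    using that by (simp add: norm_dist_def triangle_diff)
qed

text \<open>The conditions and the notion of solution speak of continuity in
  \<open>norm_topology\<close>; most arguments below use this epsilon-delta form instead. The domain
  is a general metric space since both time intervals and sets of pairs \<open>(t, s)\<close>
  occur.\<close>

lemma continuous_map_norm_topology_iff:
  fixes A :: "'b::metric_space set"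
  shows "continuous_map (top_of_set A) (norm_topology W n) f \<longleftrightarrow>
    f \<in> A \<rightarrow> W \<and> (\<forall>a\<in>A. \<forall>e>0. \<exists>d>0. \<forall>y\<in>A. dist y a < d \<longrightarrow> n (f y - f a) < e)"
    (is "?L \<longleftrightarrow> ?R")
proof
  assume ?L
  then have W: "f \<in> A \<rightarrow> W"
    using continuous_map_funspace[of _ _ f] by (fastforce simp: norm_topology_def)
  moreover have "\<exists>d>0. \<forall>y\<in>A. dist y a < d \<longrightarrow> n (f y - f a) < e" if "a \<in> A" "e > 0" for a e
  proof -
    from \<open>?L\<close> that obtain S where S: "openin (top_of_set A) S" "a \<in> S"
        "\<And>y. y \<in> S \<Longrightarrow> f y \<in> mball (f a) e"
      unfolding norm_topology_def continuous_map_to_metric by (metis topspace_euclidean_subtopology)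
    then obtain d where "d > 0" "ball a d \<inter> A \<subseteq> S"
      unfolding openin_contains_ball by blast
    moreover have "n (f y - f a) < e" if "y \<in> S" for y
    proof -
      have "f a \<in> W" "f y \<in> W" "n (f a - f y) < e"
        using S(3)[OF that] by (auto simp: norm_dist_def)
      then show ?thesis by (metis n_commute)
    qed
    ultimately show ?thesis
      by (metis Int_iff dist_commute mem_ball subsetD)
  qed
  ultimately show ?R by blast
next
  assume R: ?R
  show ?L
    unfolding norm_topology_def continuous_map_to_metric
  proof (intro ballI allI impI)
    fix a and e :: real
    assume "a \<in> topspace (top_of_set A)" and e: "0 < e"
    then have a: "a \<in> A" by simp
    with e R obtain d where d: "d > 0" "\<And>y. y \<in> A \<Longrightarrow> dist y a < d \<Longrightarrow> n (f y - f a) < e"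
      by blast
    show "\<exists>S. openin (top_of_set A) S \<and> a \<in> S \<and> (\<forall>y\<in>S. f y \<in> mball (f a) e)"
    proof (intro exI conjI ballI)
      show "openin (top_of_set A) (A \<inter> ball a d)" by (simp add: openin_open_Int)
      show "a \<in> A \<inter> ball a d" using a d by simp
      show "f y \<in> mball (f a) e" if "y \<in> A \<inter> ball a d" for y
        using that d(2)[of y] R a
        by (auto simp: norm_dist_def dist_commute Pi_iff n_commute)
    qed
  qed
qed

lemma continuous_map_norm_topologyD:
  fixes A :: "'b::metric_space set"
  assumes "continuous_map (top_of_set A) (norm_topology W n) f" "a \<in> A"
  shows "f a \<in> W" and "e > 0 \<Longrightarrow> \<exists>d>0. \<forall>y\<in>A. dist y a < d \<longrightarrow> n (f y - f a) < e"
  using assms unfolding continuous_map_norm_topology_iff by (blast, simp)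

text \<open>A Lebesgue number of the cover by balls on which \<open>f\<close> stays within
  \<open>e / 2\<close> of its value at the centre: two points closer than that number lie in a
  common ball.\<close>

lemma uniformly_continuous_compact:
  fixes A :: "'b::metric_space set"
  assumes "compact A" and f: "continuous_map (top_of_set A) (norm_topology W n) f" and "e > 0"
  obtains d where "d > 0" "\<And>y z. y \<in> A \<Longrightarrow> z \<in> A \<Longrightarrow> dist y z < d \<Longrightarrow> n (f y - f z) < e"
proof -
  have W: "\<And>y. y \<in> A \<Longrightarrow> f y \<in> W"
    using f unfolding continuous_map_norm_topology_iff by blast
  have "\<forall>a\<in>A. \<exists>d>0. \<forall>y\<in>A. dist y a < d \<longrightarrow> n (f y - f a) < e / 2"
    using f half_gt_zero[OF \<open>e > 0\<close>] unfolding continuous_map_norm_topology_iff by blast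
  then obtain d where d: "\<And>a. a \<in> A \<Longrightarrow> d a > 0"
      "\<And>a y. a \<in> A \<Longrightarrow> y \<in> A \<Longrightarrow> dist y a < d a \<Longrightarrow> n (f y - f a) < e / 2"
    by (metis (no_types, lifting))
  have "A \<subseteq> \<Union>((\<lambda>a. ball a (d a)) ` A)" using d(1) by force
  then obtain \<epsilon> where \<epsilon>: "\<epsilon> > 0" "\<And>y. y \<in> A \<Longrightarrow> \<exists>G\<in>(\<lambda>a. ball a (d a)) ` A. ball y \<epsilon> \<subseteq> G"
    using Heine_Borel_lemma[OF \<open>compact A\<close>, of "(\<lambda>a. ball a (d a)) ` A"] by blast
  have "n (f y - f z) < e" if y: "y \<in> A" and z: "z \<in> A" and "dist y z < \<epsilon>" for y z
  proof -
    obtain a where a: "a \<in> A" "ball y \<epsilon> \<subseteq> ball a (d a)" using \<epsilon>(2)[OF y] by blast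
    moreover have "y \<in> ball y \<epsilon>" "z \<in> ball y \<epsilon>" using that \<epsilon>(1) by auto
    ultimately have "dist y a < d a" "dist z a < d a" by (metis dist_commute mem_ball subsetD)+
    then have "n (f y - f a) < e / 2" "n (f z - f a) < e / 2" using d(2) a(1) y z by blast+
    then show ?thesis
      using triangle_diff[of "f y" "f a" "f z"] n_commute[of "f z" "f a"] W a(1) y z by fastforce
  qed
  with \<epsilon>(1) show ?thesis using that by blast
qed

section \<open>Riemann integrals in a normed carrier\<close>

lemma riemann_sum_in:
  assumes p: "p tagged_division_of {a..b}" and f: "f \<in> {a..b::real} \<rightarrow> W"
  shows "(\<Sum>(z, k)\<in>p. content k *\<^sub>R f z) \<in> W"
proof (rule sum_in, clarify)
  fix z k assume "(z, k) \<in> p"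
  then have "z \<in> {a..b}" using tagged_division_ofD(2,3)[OF p] by blast
  then show "content k *\<^sub>R f z \<in> W" using f by (meson Pi_mem scale_in)
qed

end

text \<open>A cell inside the ball of radius \<open>d / 3\<close> about its tag has length below
  \<open>2 * d / 3\<close>. Keeping an arbitrary gauge \<open>g\<close> as well allows one division
  to serve a Riemann integral and a gauge integral at the same time.\<close>

lemma tagged_division_fine_exists:
  fixes a b :: real
  assumes "gauge g" "d > 0"
  obtains p where "p tagged_division_of {a..b}" "g fine p" "\<forall>(z, k)\<in>p. content k < d"
proof -
  have "gauge (\<lambda>z. g z \<inter> ball z (d / 3))"
    using assms by (intro gauge_Int gauge_ball_dependent) auto
  then obtain p where p: "p tagged_division_of {a..b}" "(\<lambda>z. g z \<inter> ball z (d / 3)) fine p"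
    by (rule fine_division_exists_real)
  have "content k < d" if zk: "(z, k) \<in> p" for z k
  proof -
    obtain u v where k: "k = {u..v}" using tagged_division_ofD(4)[OF p(1) zk] by (auto simp: box_real)
    have z: "z \<in> {u..v}" and sub: "{u..v} \<subseteq> ball z (d / 3)"
      using tagged_division_ofD(2)[OF p(1) zk] p(2) zk by (auto simp: fine_def k)
    from z have "u \<in> {u..v}" "v \<in> {u..v}" by auto
    with sub have "dist z u < d / 3" "dist z v < d / 3" by (meson mem_ball subsetD)+
    with z show ?thesis by (simp add: k dist_real_def)
  qed
  with p show ?thesis by (intro that[of p]) (auto simp: fine_Int)
qed

text \<open>The length of the part of a cell inside \<open>{c..d}\<close> is additive under cutting
  the cell, so its sum over a division is its value on the whole interval.\<close>

lemma content_Int_tagged_division: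
  fixes a b :: real
  assumes p: "p tagged_division_of {a..b}" and sub: "{c..d} \<subseteq> {a..b}"
  shows "(\<Sum>(z, k)\<in>p. content ({c..d} \<inter> k)) = content {c..d}"
proof -
  interpret operative_real plus 0 "\<lambda>k. content ({c..d} \<inter> k)"
    by unfold_locales (simp, simp add: min_def max_def)
  have "(\<Sum>(z, k)\<in>p. content ({c..d} \<inter> k)) = content ({c..d} \<inter> {a..b})"
    using tagged_division[OF p] unfolding sum_def .
  also have "{c..d} \<inter> {a..b} = {c..d}" using sub by blast
  finally show ?thesis .
qed

context normed_carrier
begin

text \<open>
  Both Riemann sums are refined to the pairwise intersections of their cells; two cells that
  meet have tags at distance less than \<open>2 * d\<close>.
\<close>

lemma riemann_sums_close:
  assumes p: "p tagged_division_of {a..b}" "\<forall>(z, k)\<in>p. content k < d"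
    and q: "q tagged_division_of {a..b}" "\<forall>(z, k)\<in>q. content k < d"
    and f: "f \<in> {a..b::real} \<rightarrow> W" and ab: "a \<le> b"
    and mod: "\<And>y z. y \<in> {a..b} \<Longrightarrow> z \<in> {a..b} \<Longrightarrow> \<bar>y - z\<bar> < 2 * d \<Longrightarrow> n (f y - f z) \<le> e"
  shows "n ((\<Sum>(z, k)\<in>p. content k *\<^sub>R f z) - (\<Sum>(z, k)\<in>q. content k *\<^sub>R f z)) \<le> e * (b - a)"
proof -
  have cell: "z \<in> k \<and> k \<subseteq> {a..b} \<and> (\<exists>c d. k = {c..d})"
    if "s tagged_division_of {a..b}" "(z, k) \<in> s" for s z k
    using tagged_division_ofD[OF that(1)] that(2) by (metis box_real(2))
  have expand: "(\<Sum>(z, k)\<in>s. content k *\<^sub>R f z)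
      = (\<Sum>(z, k)\<in>s. \<Sum>(y, j)\<in>s'. content (k \<inter> j) *\<^sub>R f z)"
    if s: "s tagged_division_of {a..b}" and s': "s' tagged_division_of {a..b}" for s s'
  proof (rule sum.cong[OF refl], clarify)
    fix z k assume zk: "(z, k) \<in> s"
    obtain c d where "k = {c..d}" "k \<subseteq> {a..b}" using cell[OF s zk] by blast
    then have "content k = (\<Sum>(y, j)\<in>s'. content (k \<inter> j))"
      using content_Int_tagged_division[OF s'] by metis
    then show "content k *\<^sub>R f z = (\<Sum>(y, j)\<in>s'. content (k \<inter> j) *\<^sub>R f z)"
      by (simp add: scaleR_sum_left case_prod_beta)
  qed
  have swap: "(\<Sum>(y, j)\<in>q. \<Sum>(z, k)\<in>p. content (j \<inter> k) *\<^sub>R f y)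
      = (\<Sum>(z, k)\<in>p. \<Sum>(y, j)\<in>q. content (k \<inter> j) *\<^sub>R f y)"
    unfolding case_prod_beta by (subst sum.swap) (simp add: Int_commute)
  have cell_bound: "content (k \<inter> j) *\<^sub>R (f z - f y) \<in> W \<and>
      n (content (k \<inter> j) *\<^sub>R (f z - f y)) \<le> content (k \<inter> j) * e"
    if zk: "(z, k) \<in> p" and yj: "(y, j) \<in> q" for z k y j
  proof -
    have z: "z \<in> {a..b}" and y: "y \<in> {a..b}" using cell[OF p(1) zk] cell[OF q(1) yj] by auto
    then have W: "f z - f y \<in> W" using f by (meson diff_in Pi_mem)
    moreover have "content (k \<inter> j) * n (f z - f y) \<le> content (k \<inter> j) * e"
    proof (cases "k \<inter> j = {}")
      case False
      then obtain w where w: "w \<in> k" "w \<in> j" by blast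
      have "content k < d" "content j < d" using p(2) q(2) zk yj by auto
      then have "\<bar>z - w\<bar> < d" "\<bar>y - w\<bar> < d"
        using cell[OF p(1) zk] cell[OF q(1) yj] w by (auto split: if_splits)
      then have "n (f z - f y) \<le> e" using mod z y by auto
      then show ?thesis by (intro mult_left_mono) auto
    qed simp
    ultimately show ?thesis by (simp add: n_scale scale_in)
  qed
  have "(\<Sum>(z, k)\<in>p. content k *\<^sub>R f z) - (\<Sum>(z, k)\<in>q. content k *\<^sub>R f z)
      = (\<Sum>(z, k)\<in>p. \<Sum>(y, j)\<in>q. content (k \<inter> j) *\<^sub>R (f z - f y))"
    unfolding expand[OF p(1) q(1)] expand[OF q(1) p(1)] swap
    by (simp add: case_prod_beta sum_subtractf scaleR_diff_right)
  also have "n \<dots> \<le> (\<Sum>(z, k)\<in>p. \<Sum>(y, j)\<in>q. content (k \<inter> j) * e)"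
    unfolding case_prod_beta
  proof (intro order.trans[OF norm_sum] sum_mono sum_in)
    fix i j assume "i \<in> p" "j \<in> q"
    then show "content (snd i \<inter> snd j) *\<^sub>R (f (fst i) - f (fst j)) \<in> W"
        "content (snd i \<inter> snd j) *\<^sub>R (f (fst i) - f (fst j)) \<in> W"
        "n (content (snd i \<inter> snd j) *\<^sub>R (f (fst i) - f (fst j))) \<le> content (snd i \<inter> snd j) * e"
      using cell_bound by (metis prod.collapse)+
  qed
  also have "\<dots> = (\<Sum>(z, k)\<in>p. content k * e)"
  proof (rule sum.cong[OF refl], clarify)
    fix z k assume zk: "(z, k) \<in> p"
    obtain c d where "k = {c..d}" "k \<subseteq> {a..b}" using cell[OF p(1) zk] by blast
    then have "(\<Sum>(y, j)\<in>q. content (k \<inter> j)) = content k"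
      using content_Int_tagged_division[OF q(1)] by metis
    then show "(\<Sum>(y, j)\<in>q. content (k \<inter> j) * e) = content k * e"
      by (simp add: case_prod_beta sum_distrib_right[symmetric])
  qed
  also have "\<dots> = e * (b - a)"
    using additive_content_tagged_division[of p a b] p(1) ab
    by (simp add: box_real case_prod_beta sum_distrib_right[symmetric])
  finally show ?thesis .
qed

text \<open>One division that is fine for the gauge of \<open>g\<close> and of small mesh for
  \<open>f\<close> compares the two Riemann sums term by term. The majorant needs only a gauge
  integral, so its value can be computed from a primitive.\<close>

lemma has_riemann_integral_bound:
  assumes I: "has_riemann_integral_on W n f I a b"
    and le: "\<And>s. s \<in> {a..b} \<Longrightarrow> n (f s) \<le> g s" and G: "(g has_integral G) {a..b}"
  shows "n I \<le> G"
proof (rule field_le_epsilon)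
  fix e :: real assume "e > 0"
  then obtain d where d: "d > 0" "\<And>p. p tagged_division_of {a..b} \<Longrightarrow> \<forall>(z, k)\<in>p. content k < d
      \<Longrightarrow> n ((\<Sum>(z, k)\<in>p. content k *\<^sub>R f z) - I) < e / 2"
    using I unfolding has_riemann_integral_on_def by (meson half_gt_zero)
  obtain \<gamma> where \<gamma>: "gauge \<gamma>" "\<And>p. p tagged_division_of {a..b} \<Longrightarrow> \<gamma> fine p
      \<Longrightarrow> norm ((\<Sum>(z, k)\<in>p. content k *\<^sub>R g z) - G) < e / 2"
    using G \<open>e > 0\<close> unfolding has_integral_real by (meson half_gt_zero)
  obtain p where p: "p tagged_division_of {a..b}" "\<gamma> fine p" "\<forall>(z, k)\<in>p. content k < d"
    using tagged_division_fine_exists[OF \<gamma>(1) d(1)] by blast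
  have f: "f \<in> {a..b} \<rightarrow> W" and IW: "I \<in> W"
    using I by (auto simp: has_riemann_integral_on_def)
  have tag: "z \<in> {a..b}" if "(z, k) \<in> p" for z k
    using tagged_division_ofD(2,3)[OF p(1) that] by blast
  have "n (\<Sum>(z, k)\<in>p. content k *\<^sub>R f z) \<le> (\<Sum>(z, k)\<in>p. n (content k *\<^sub>R f z))"
    unfolding case_prod_beta using tag f by (intro norm_sum scale_in) (metis Pi_mem prod.collapse)
  also have "\<dots> \<le> (\<Sum>(z, k)\<in>p. content k *\<^sub>R g z)"
  proof (rule sum_mono, clarify)
    fix z k assume "(z, k) \<in> p"
    then have "z \<in> {a..b}" by (rule tag)
    then show "n (content k *\<^sub>R f z) \<le> content k *\<^sub>R g z"
      using f le[of z] by (simp add: n_scale funcset_mem[of f] mult_left_mono)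
  qed
  finally have "n (\<Sum>(z, k)\<in>p. content k *\<^sub>R f z) \<le> G + e / 2"
    using \<gamma>(2)[OF p(1,2)] unfolding real_norm_def by linarith
  moreover have "n I \<le> n (I - (\<Sum>(z, k)\<in>p. content k *\<^sub>R f z)) + n (\<Sum>(z, k)\<in>p. content k *\<^sub>R f z)"
    using norm_le_diff IW riemann_sum_in[OF p(1) f] by blast
  ultimately show "n I \<le> G + e"
    using d(2)[OF p(1,3)] n_commute[OF IW riemann_sum_in[OF p(1) f]] by linarith
qed

lemma has_riemann_integral_diff:
  assumes "has_riemann_integral_on W n f I a b" "has_riemann_integral_on W n g J a b"
  shows "has_riemann_integral_on W n (\<lambda>s. f s - g s) (I - J) a b"
  unfolding has_riemann_integral_on_def
proof (intro conjI allI impI)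
  have W: "I \<in> W" "J \<in> W" "f \<in> {a..b} \<rightarrow> W" "g \<in> {a..b} \<rightarrow> W"
    using assms by (auto simp: has_riemann_integral_on_def)
  then show "I - J \<in> W" "(\<lambda>s. f s - g s) \<in> {a..b} \<rightarrow> W" by (auto intro: diff_in)
  fix e :: real assume "e > 0"
  obtain d where d: "d > 0" "\<And>p. p tagged_division_of {a..b} \<Longrightarrow> \<forall>(z, k)\<in>p. content k < d
      \<Longrightarrow> n ((\<Sum>(z, k)\<in>p. content k *\<^sub>R f z) - I) < e / 2"
    using assms(1) \<open>e > 0\<close> unfolding has_riemann_integral_on_def by (meson half_gt_zero)
  obtain d' where d': "d' > 0" "\<And>p. p tagged_division_of {a..b} \<Longrightarrow> \<forall>(z, k)\<in>p. content k < d'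
      \<Longrightarrow> n ((\<Sum>(z, k)\<in>p. content k *\<^sub>R g z) - J) < e / 2"
    using assms(2) \<open>e > 0\<close> unfolding has_riemann_integral_on_def by (meson half_gt_zero)
  show "\<exists>d>0. \<forall>p. p tagged_division_of {a..b} \<and> (\<forall>(z, k)\<in>p. content k < d) \<longrightarrow>
      n ((\<Sum>(z, k)\<in>p. content k *\<^sub>R (f z - g z)) - (I - J)) < e"
  proof (intro exI[of _ "min d d'"] conjI allI impI; (elim conjE)?)
    fix p assume p: "p tagged_division_of {a..b}" "\<forall>(z, k)\<in>p. content k < min d d'"
    let ?F = "\<Sum>(z, k)\<in>p. content k *\<^sub>R f z" and ?G = "\<Sum>(z, k)\<in>p. content k *\<^sub>R g z"
    have FG: "?F \<in> W" "?G \<in> W" using riemann_sum_in p(1) W by blast+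
    have "n (?F - I) < e / 2" "n (?G - J) < e / 2" using d(2) d'(2) p by force+
    moreover have "n ((?F - ?G) - (I - J)) \<le> n (?F - I) + n (J - ?G)"
      using n_triangle[of "?F - I" "J - ?G"] W FG by (simp add: diff_in algebra_simps)
    moreover have "?F - ?G = (\<Sum>(z, k)\<in>p. content k *\<^sub>R (f z - g z))"
      by (simp add: sum_subtractf[symmetric] case_prod_beta scaleR_diff_right)
    ultimately show "n ((\<Sum>(z, k)\<in>p. content k *\<^sub>R (f z - g z)) - (I - J)) < e"
      using n_commute[of J ?G] FG W by simp
  qed (use d d' in auto)
qed

text \<open>\<open>I - J\<close> is an integral of \<open>f - f\<close>, to which the bound with
  majorant 0 applies.\<close>

lemma has_riemann_integral_unique:
  assumes "has_riemann_integral_on W n f I a b" "has_riemann_integral_on W n f J a b"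
  shows "I = J"
proof -
  have IJ: "I - J \<in> W" using assms by (auto simp: has_riemann_integral_on_def diff_in)
  have "n (I - J) \<le> 0"
    using has_riemann_integral_bound[OF has_riemann_integral_diff[OF assms], of "\<lambda>_. 0" 0]
    by (simp add: n_zero)
  then show ?thesis using n_nonneg[OF IJ] eq_0_iff[OF IJ] by simp
qed

end

lemma has_riemann_integral_on_cong:
  assumes I: "has_riemann_integral_on W n f I a b"
    and eq: "\<And>s. s \<in> {a..b} \<Longrightarrow> f s = g s"
  shows "has_riemann_integral_on W n g I a b"
proof -
  have sum: "(\<Sum>(z, k)\<in>p. content k *\<^sub>R f z) = (\<Sum>(z, k)\<in>p. content k *\<^sub>R g z)"
    if p: "p tagged_division_of {a..b}" for p
  proof (rule sum.cong[OF refl], clarify)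
    fix z k assume "(z, k) \<in> p"
    then have "z \<in> {a..b}" using tagged_division_ofD(2,3)[OF p] by blast
    then show "content k *\<^sub>R f z = content k *\<^sub>R g z" by (simp only: eq)
  qed
  have "g \<in> {a..b} \<rightarrow> W"
    using I eq by (metis Pi_cong has_riemann_integral_on_def)
  moreover have "\<exists>d>0. \<forall>p. p tagged_division_of {a..b} \<and> (\<forall>(z, k)\<in>p. content k < d) \<longrightarrow>
      n ((\<Sum>(z, k)\<in>p. content k *\<^sub>R g z) - I) < e" if "e > 0" for e
  proof -
    obtain d where "d > 0" "\<And>p. p tagged_division_of {a..b} \<Longrightarrow> \<forall>(z, k)\<in>p. content k < d
        \<Longrightarrow> n ((\<Sum>(z, k)\<in>p. content k *\<^sub>R f z) - I) < e"
      using I \<open>e > 0\<close> unfolding has_riemann_integral_on_def by blast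
    then show ?thesis using sum by (intro exI[of _ d]) simp
  qed
  ultimately show ?thesis using I unfolding has_riemann_integral_on_def by blast
qed

text \<open>Riemann sums do not depend on the norm, and a weaker norm only makes them closer. This
  is what identifies integrals taken at different levels of the scale.\<close>

lemma has_riemann_integral_on_mono:
  assumes "has_riemann_integral_on W n f I a b" "normed_on W n"
    and "W \<subseteq> W'" "\<And>u. u \<in> W \<Longrightarrow> n' u \<le> n u"
  shows "has_riemann_integral_on W' n' f I a b"
proof -
  interpret normed_carrier W n by unfold_locales fact
  have f: "f \<in> {a..b} \<rightarrow> W" "I \<in> W" using assms(1) by (auto simp: has_riemann_integral_on_def)
  then have "n' ((\<Sum>(z, k)\<in>p. content k *\<^sub>R f z) - I) \<le> n ((\<Sum>(z, k)\<in>p. content k *\<^sub>R f z) - I)"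
    if "p tagged_division_of {a..b}" for p
    using assms(4) diff_in riemann_sum_in that by blast
  then show ?thesis
    using assms(1,3) unfolding has_riemann_integral_on_def by (meson order.strict_trans1 subsetD Pi_mono)
qed

section \<open>Completeness: existence and additivity of the Riemann integral\<close>

locale banach_carrier = normed_carrier +
  assumes complete: "mcomplete"
begin

lemma Cauchy_limit:
  fixes \<sigma> :: "nat \<Rightarrow> 'a"
  assumes "\<And>k. \<sigma> k \<in> W" "\<And>e. e > 0 \<Longrightarrow> \<exists>M. \<forall>i\<ge>M. \<forall>j\<ge>M. n (\<sigma> i - \<sigma> j) < e"
  obtains l where "l \<in> W" "\<And>e. e > 0 \<Longrightarrow> \<exists>M. \<forall>i\<ge>M. n (\<sigma> i - l) < e"
proof -
  have "MCauchy \<sigma>"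
    unfolding MCauchy_def norm_dist_def using assms by (simp add: image_subset_iff)
  then obtain l where "limitin mtopology \<sigma> l sequentially"
    using complete by (auto simp: mcomplete_def)
  then have "l \<in> W" "\<And>e. e > 0 \<Longrightarrow> \<exists>M. \<forall>i\<ge>M. \<sigma> i \<in> W \<and> norm_dist W n (\<sigma> i) l < e"
    unfolding limit_metric_sequentially by blast+
  then show ?thesis using that[of l] by (metis norm_dist_def)
qed

text \<open>Uniform continuity makes any two Riemann sums of small mesh close. A sequence of
  divisions with mesh tending to 0 therefore has Cauchy sums, and their limit attracts the sums of
  all fine divisions.\<close>

lemma has_riemann_integral_exists:
  fixes f :: "real \<Rightarrow> 'a"
  assumes f: "continuous_map (top_of_set {a..b}) (norm_topology W n) f" and ab: "a \<le> b"
  obtains I where "has_riemann_integral_on W n f I a b"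
proof -
  let ?S = "\<lambda>p. \<Sum>(z, k)\<in>p. content k *\<^sub>R f z"
  have fW: "f \<in> {a..b} \<rightarrow> W" using f unfolding continuous_map_norm_topology_iff by blast
  have close: "\<exists>d>0. \<forall>p q. p tagged_division_of {a..b} \<and> (\<forall>(z, k)\<in>p. content k < d) \<and>
      q tagged_division_of {a..b} \<and> (\<forall>(z, k)\<in>q. content k < d) \<longrightarrow> n (?S p - ?S q) < e"
    if "e > 0" for e
  proof -
    \<comment> \<open>The summand 1 allows \<open>a = b\<close> and makes the final inequality
      strict.\<close>
    have "e / (b - a + 1) > 0" using ab that by simp
    then obtain d where d: "d > 0"
        "\<And>y z. y \<in> {a..b} \<Longrightarrow> z \<in> {a..b} \<Longrightarrow> dist y z < d \<Longrightarrow> n (f y - f z) < e / (b - a + 1)"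
      using uniformly_continuous_compact[OF _ f] by (metis compact_Icc)
    have "e / (b - a + 1) * (b - a) < e" using ab that by (simp add: field_simps)
    \<comment> \<open>Mesh \<open>d / 2\<close>, because tags of meeting cells may be up to two
      meshes apart.\<close>
    moreover have le: "n (?S p - ?S q) \<le> e / (b - a + 1) * (b - a)"
      if "p tagged_division_of {a..b}" "\<forall>(z, k)\<in>p. content k < d / 2"
        "q tagged_division_of {a..b}" "\<forall>(z, k)\<in>q. content k < d / 2" for p q
      using d(2) by (intro riemann_sums_close[OF that fW ab]) (auto simp: dist_real_def less_imp_le)
    ultimately have "n (?S p - ?S q) < e"
      if "p tagged_division_of {a..b} \<and> (\<forall>(z, k)\<in>p. content k < d / 2) \<and>
        q tagged_division_of {a..b} \<and> (\<forall>(z, k)\<in>q. content k < d / 2)" for p q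
      using le[of p q] that by linarith
    then show ?thesis using half_gt_zero[OF d(1)] by blast
  qed
  have "\<exists>p. p tagged_division_of {a..b} \<and> (\<forall>(z, k)\<in>p. content k < 1 / real (Suc i))" for i
  proof -
    have "1 / real (Suc i) > 0" by simp
    then obtain p where "p tagged_division_of {a..b}" "\<forall>(z, k)\<in>p. content k < 1 / real (Suc i)"
      by (rule tagged_division_fine_exists[OF gauge_trivial])
    then show ?thesis by blast
  qed
  then obtain p where p: "\<And>i. p i tagged_division_of {a..b}"
      "\<And>i. \<forall>(z, k)\<in>p i. content k < 1 / real (Suc i)" by metis
  have fine: "\<exists>M. \<forall>i\<ge>M. \<forall>(z, k)\<in>p i. content k < d" if d: "d > 0" for d
  proof -
    obtain M where M: "1 / real (Suc M) < d" using d nat_approx_posE by blast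
    have "1 / real (Suc i) < d" if "i \<ge> M" for i
      using M that by (smt (verit) frac_le of_nat_0_less_iff of_nat_le_iff Suc_le_mono zero_less_Suc)
    then show ?thesis using p(2) by (intro exI[of _ M]) (fastforce intro: order.strict_trans)
  qed
  obtain I where I: "I \<in> W" "\<And>e. e > 0 \<Longrightarrow> \<exists>M. \<forall>i\<ge>M. n (?S (p i) - I) < e"
  proof (rule Cauchy_limit[of "\<lambda>i. ?S (p i)"])
    show "?S (p i) \<in> W" for i using riemann_sum_in[OF p(1) fW] .
    show "\<exists>M. \<forall>i\<ge>M. \<forall>j\<ge>M. n (?S (p i) - ?S (p j)) < e" if e: "e > 0" for e
    proof -
      obtain d where d: "d > 0" "\<And>p q. p tagged_division_of {a..b} \<Longrightarrow> \<forall>(z, k)\<in>p. content k < d \<Longrightarrow>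
          q tagged_division_of {a..b} \<Longrightarrow> \<forall>(z, k)\<in>q. content k < d \<Longrightarrow> n (?S p - ?S q) < e"
        using close[OF e] by blast
      then show ?thesis using fine[OF d(1)] p(1) by blast
    qed
  qed blast
  have "has_riemann_integral_on W n f I a b"
    unfolding has_riemann_integral_on_def
  proof (intro conjI allI impI)
    show "I \<in> W" "f \<in> {a..b} \<rightarrow> W" by fact+
    fix e :: real assume "e > 0"
    then obtain d where d: "d > 0" "\<And>p q. p tagged_division_of {a..b} \<Longrightarrow> \<forall>(z, k)\<in>p. content k < d \<Longrightarrow>
        q tagged_division_of {a..b} \<Longrightarrow> \<forall>(z, k)\<in>q. content k < d \<Longrightarrow> n (?S p - ?S q) < e / 2"
      using close[OF half_gt_zero[OF \<open>e > 0\<close>]] by blast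
    show "\<exists>d>0. \<forall>p. p tagged_division_of {a..b} \<and> (\<forall>(z, k)\<in>p. content k < d) \<longrightarrow> n (?S p - I) < e"
    proof (intro exI[of _ d] conjI allI impI; (elim conjE)?)
      fix q assume q: "q tagged_division_of {a..b}" "\<forall>(z, k)\<in>q. content k < d"
      obtain M where M: "\<forall>i\<ge>M. \<forall>(z, k)\<in>p i. content k < d" using fine[OF d(1)] by blast
      obtain M' where M': "\<forall>i\<ge>M'. n (?S (p i) - I) < e / 2" using I(2)[of "e / 2"] \<open>e > 0\<close> by auto
      define i where "i = max M M'"
      have "\<forall>(z, k)\<in>p i. content k < d" using M max.cobounded1 unfolding i_def by blast
      then have "n (?S q - ?S (p i)) < e / 2" using d(2)[OF q p(1)[of i]] by blast
      moreover have "n (?S (p i) - I) < e / 2" using M' by (simp add: i_def)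
      ultimately show "n (?S q - I) < e"
        using triangle_diff[OF riemann_sum_in[OF q(1) fW] riemann_sum_in[OF p(1)[of i] fW] I(1)]
        by linarith
    qed (fact d)
  qed
  then show ?thesis by (rule that)
qed

text \<open>An integral \<open>K\<close> over the whole interval exists by continuity and only has
  to be identified: joining fine divisions of the two halves gives a fine division of the whole, and
  this already pins down \<open>K\<close>.\<close>

lemma has_riemann_integral_combine:
  fixes f :: "real \<Rightarrow> 'a"
  assumes f: "continuous_map (top_of_set {a..b}) (norm_topology W n) f"
    and c: "a \<le> c" "c \<le> b"
    and I: "has_riemann_integral_on W n f I a c" and J: "has_riemann_integral_on W n f J c b"
  shows "has_riemann_integral_on W n f (I + J) a b"
proof -
  let ?S = "\<lambda>p. \<Sum>(z, k)\<in>p. content k *\<^sub>R f z"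
  obtain K where K: "has_riemann_integral_on W n f K a b"
    using has_riemann_integral_exists[OF f] c by fastforce
  have W: "I \<in> W" "J \<in> W" "K \<in> W" "f \<in> {a..b} \<rightarrow> W" "f \<in> {a..c} \<rightarrow> W" "f \<in> {c..b} \<rightarrow> W"
    using I J K by (auto simp: has_riemann_integral_on_def)
  have "n (K - (I + J)) \<le> 0 + e" if e: "e > 0" for e
  proof -
    have e3: "e / 3 > 0" using e by simp
    obtain d1 where d1: "d1 > 0" "\<And>p. p tagged_division_of {a..c} \<Longrightarrow>
        \<forall>(z, k)\<in>p. content k < d1 \<Longrightarrow> n (?S p - I) < e / 3"
      using I e3 unfolding has_riemann_integral_on_def by meson
    obtain d2 where d2: "d2 > 0" "\<And>p. p tagged_division_of {c..b} \<Longrightarrow>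
        \<forall>(z, k)\<in>p. content k < d2 \<Longrightarrow> n (?S p - J) < e / 3"
      using J e3 unfolding has_riemann_integral_on_def by meson
    obtain d3 where d3: "d3 > 0" "\<And>p. p tagged_division_of {a..b} \<Longrightarrow>
        \<forall>(z, k)\<in>p. content k < d3 \<Longrightarrow> n (?S p - K) < e / 3"
      using K e3 unfolding has_riemann_integral_on_def by meson
    have d: "min d1 (min d2 d3) > 0" using d1 d2 d3 by simp
    obtain p where p: "p tagged_division_of {a..c}" "\<forall>(z, k)\<in>p. content k < min d1 (min d2 d3)"
      by (rule tagged_division_fine_exists[OF gauge_trivial d])
    obtain q where q: "q tagged_division_of {c..b}" "\<forall>(z, k)\<in>q. content k < min d1 (min d2 d3)"
      by (rule tagged_division_fine_exists[OF gauge_trivial d])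
    have pq: "(p \<union> q) tagged_division_of {a..b}"
    proof (rule tagged_division_Un_interval_real)
      have "{a..b} \<inter> {x. x \<bullet> 1 \<le> c} = {a..c}" "{a..b} \<inter> {x. x \<bullet> 1 \<ge> c} = {c..b}"
        using c by auto
      then show "p tagged_division_of {a..b} \<inter> {x. x \<bullet> 1 \<le> c}"
          "q tagged_division_of {a..b} \<inter> {x. x \<bullet> 1 \<ge> c}"
        using p(1) q(1) by simp_all
    qed simp
    have "?S (p \<union> q) = ?S p + ?S q"
    proof (rule sum.union_inter_neutral)
      show "finite p" "finite q" using p q by auto
      show "\<forall>i\<in>p \<inter> q. (case i of (z, k) \<Rightarrow> content k *\<^sub>R f z) = 0"
      proof clarify
        \<comment> \<open>A cell common to both divisions lies in \<open>{c}\<close> and has length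
          0, so the sum over the union does not count anything twice.\<close>
        fix z k assume "(z, k) \<in> p" "(z, k) \<in> q"
        then have "k \<subseteq> {c}"
          using tagged_division_ofD(3)[OF p(1)] tagged_division_ofD(3)[OF q(1)] by fastforce
        then have "k = {} \<or> k = {c}" by blast
        then show "content k *\<^sub>R f z = 0" by auto
      qed
    qed
    moreover have "n (?S p - I) < e / 3" "n (?S q - J) < e / 3" "n (?S (p \<union> q) - K) < e / 3"
      using d1(2)[OF p(1)] d2(2)[OF q(1)] d3(2)[OF pq] p(2) q(2) by fastforce+
    moreover have S: "?S p \<in> W" "?S q \<in> W" using riemann_sum_in p(1) q(1) W by blast+
    ultimately have "n (K - (?S p + ?S q)) < e / 3"
      using n_commute[of K "?S p + ?S q"] W by (simp add: add_in)
    moreover have "n (K - (I + J)) \<le> n (K - (?S p + ?S q)) + n ((?S p - I) + (?S q - J))"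
      using triangle_diff[of K "?S p + ?S q" "I + J"] S W by (simp add: add_in algebra_simps)
    moreover have "n ((?S p - I) + (?S q - J)) \<le> n (?S p - I) + n (?S q - J)"
      using S W by (simp add: n_triangle diff_in)
    ultimately show ?thesis
      using \<open>n (?S p - I) < e / 3\<close> \<open>n (?S q - J) < e / 3\<close> by linarith
  qed
  then have "n (K - (I + J)) \<le> 0" by (rule field_le_epsilon)
  then have "K = I + J"
    using n_nonneg[of "K - (I + J)"] eq_0_iff[of "K - (I + J)"] W by (simp add: diff_in add_in)
  with K show ?thesis by simp
qed

end

section \<open>Real inequalities\<close>

text \<open>Needed on both sides of \<open>p = 1\<close>: with \<open>p = \<gamma>\<close> the
  integral stays bounded up to the end of the lifetime, which keeps the path in the ball; with
  \<open>p = 1 + \<gamma>\<close> it reproduces the singularity of the weighted norms.\<close>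

lemma has_integral_powr_affine:
  fixes A l p t :: real
  assumes "0 < l" "0 \<le> t" "l * t < A" "p \<noteq> 1"
  shows "((\<lambda>s. (A - l * s) powr (- p)) has_integral
    ((A - l * t) powr (1 - p) - A powr (1 - p)) / (l * (p - 1))) {0..t}"
proof -
  have pos: "0 < A - l * s" if "s \<in> {0..t}" for s
  proof -
    have "l * s \<le> l * t" using that assms by simp
    then show ?thesis using assms(3) by simp
  qed
  have "((\<lambda>s. (A - l * s) powr (- p)) has_integral
      (A - l * t) powr (1 - p) / (l * (p - 1)) - (A - l * 0) powr (1 - p) / (l * (p - 1))) {0..t}"
  proof (rule fundamental_theorem_of_calculus)
    fix s assume s: "s \<in> {0..t}"
    have "((\<lambda>s. (A - l * s) powr (1 - p) / (l * (p - 1))) has_real_derivative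
        (1 - p) * (A - l * s) powr (1 - p - 1) * (- l) / (l * (p - 1))) (at s)"
      using pos[OF s] assms(4) by (auto intro!: derivative_eq_intros)
    also have "(1 - p) * (A - l * s) powr (1 - p - 1) * (- l) / (l * (p - 1)) = (A - l * s) powr (- p)"
      using assms by (simp add: field_simps)
    finally show "((\<lambda>s. (A - l * s) powr (1 - p) / (l * (p - 1))) has_vector_derivative
        (A - l * s) powr (- p)) (at s within {0..t})"
      using has_real_derivative_iff_has_vector_derivative has_vector_derivative_at_within by blast
  qed fact
  then show ?thesis by (simp add: diff_divide_distrib)
qed

text \<open>
  The increment over \<open>[s, s']\<close> is controlled by \<open>k\<close> at the right endpoint only, so this is not
  an instance of the mean value theorem for \<open>f\<close>.
\<close>

lemma increment_le_primitive:
  fixes f k \<Phi> :: "real \<Rightarrow> real"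
  assumes "0 \<le> t"
    and f: "\<And>s s'. 0 \<le> s \<Longrightarrow> s \<le> s' \<Longrightarrow> s' \<le> t \<Longrightarrow> f s' - f s \<le> (s' - s) * k s'"
    and k: "continuous_on {0..t} k"
    and \<Phi>: "\<And>s. s \<in> {0..t} \<Longrightarrow> (\<Phi> has_real_derivative k s) (at s)"
  shows "f t - f 0 \<le> \<Phi> t - \<Phi> 0"
proof -
  have le: "f t - f 0 \<le> \<Phi> t - \<Phi> 0 + e * (t - 0)" if "e > 0" for e
  proof -
    have "0 \<le> (0::real) \<and> t \<le> t \<longrightarrow> f t - f 0 \<le> \<Phi> t - \<Phi> 0 + e * (t - 0)"
    \<comment> \<open>The inequality with error \<open>e\<close> times the length adds up over
      adjacent intervals, so by bisection it suffices to have it for short intervals around each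
      point.\<close>
    proof (rule Bolzano[where P = "\<lambda>u v. 0 \<le> u \<and> v \<le> t \<longrightarrow> f v - f u \<le> \<Phi> v - \<Phi> u + e * (v - u)"])
      show "0 \<le> a \<and> c \<le> t \<longrightarrow> f c - f a \<le> \<Phi> c - \<Phi> a + e * (c - a)"
        if "0 \<le> a \<and> b \<le> t \<longrightarrow> f b - f a \<le> \<Phi> b - \<Phi> a + e * (b - a)"
          "0 \<le> b \<and> c \<le> t \<longrightarrow> f c - f b \<le> \<Phi> c - \<Phi> b + e * (c - b)" "a \<le> b" "b \<le> c"
        for a b c using that by (auto simp: algebra_simps)
      fix w assume w: "0 \<le> w" "w \<le> t"
      with k \<open>e > 0\<close> obtain d where d: "d > 0"
          "\<And>y. y \<in> {0..t} \<Longrightarrow> dist y w < d \<Longrightarrow> dist (k y) (k w) < e / 2"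
        unfolding continuous_on_iff by (metis atLeastAtMost_iff half_gt_zero)
      have "f v - f u \<le> \<Phi> v - \<Phi> u + e * (v - u)"
        if uv: "u \<le> w" "w \<le> v" "v - u < d" "0 \<le> u" "v \<le> t" for u v
      proof (cases "u = v")
        case False
        then have "u < v" using uv by simp
        \<comment> \<open>The mean value theorem is applied to \<open>\<Phi>\<close>; continuity of
          \<open>k\<close> then exchanges \<open>k \<xi>\<close> for the endpoint value
          \<open>k v\<close> at the expense of \<open>e\<close>.\<close>
        then obtain \<xi> where \<xi>: "u < \<xi>" "\<xi> < v" "\<Phi> v - \<Phi> u = (v - u) * k \<xi>"
          using MVT2[of u v \<Phi> k] \<Phi> uv by auto
        have "dist (k \<xi>) (k w) < e / 2" "dist (k v) (k w) < e / 2"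
          using uv \<xi> by (intro d(2); simp add: dist_real_def)+
        then have "k v \<le> k \<xi> + e" unfolding dist_real_def by linarith
        then have "(v - u) * k v \<le> (v - u) * (k \<xi> + e)"
          using uv by (intro mult_left_mono) auto
        then show ?thesis using f[of u v] uv \<xi>(3) by (simp add: algebra_simps)
      qed simp
      then show "\<exists>d>0. \<forall>a b. a \<le> w \<and> w \<le> b \<and> b - a < d \<longrightarrow>
          0 \<le> a \<and> b \<le> t \<longrightarrow> f b - f a \<le> \<Phi> b - \<Phi> a + e * (b - a)"
        using d(1) by blast
      qed fact
    then show ?thesis by simp
  qed
  show ?thesis
  proof (rule field_le_epsilon)
    fix e :: real assume "e > 0"
    then have "e / (t + 1) > 0" "e / (t + 1) * t \<le> e"
      using \<open>0 \<le> t\<close> by (auto simp: field_simps)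
    then show "f t - f 0 \<le> \<Phi> t - \<Phi> 0 + e" using le[of "e / (t + 1)"] by simp
  qed
qed

section \<open>Operators in the scale without level indices\<close>

text \<open>
  The compatibility conditions make \<open>L \<alpha>' \<alpha> y\<close> depend on \<open>y\<close> alone; the levels are removed once
  and for all. The choice is meaningful only if \<open>y\<close> lies in some ball below the top level.
\<close>

definition level_free where
  "level_free lo hi V N r x L y = L (SOME \<alpha>. lo \<le> \<alpha> \<and> \<alpha> < hi \<and> y \<in> scale_ball V N r \<alpha> x) hi y"

text \<open>The chosen level and \<open>\<alpha>'\<close> may differ, but they are comparable, and
  compatibility started from the lower of the two makes both maps into the top level agree at
  \<open>y\<close>.\<close>

lemma level_free_eq:
  assumes L: "nonlinear_scale_op lo hi V N r x L"
    and \<alpha>: "lo \<le> \<alpha>'" "\<alpha>' < \<alpha>" "\<alpha> \<le> hi" and y: "y \<in> scale_ball V N r \<alpha>' x"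
  shows "L \<alpha>' \<alpha> y = level_free lo hi V N r x L y"
proof -
  define \<sigma> where "\<sigma> = (SOME \<alpha>. lo \<le> \<alpha> \<and> \<alpha> < hi \<and> y \<in> scale_ball V N r \<alpha> x)"
  have \<sigma>: "lo \<le> \<sigma> \<and> \<sigma> < hi \<and> y \<in> scale_ball V N r \<sigma> x"
    unfolding \<sigma>_def by (rule someI[of _ \<alpha>']) (use \<alpha> y in auto)
  have compat: "L \<beta> \<delta>' y = L \<beta> \<delta> y \<and> L \<beta> \<delta>' y = L \<delta> \<delta>' y"
    if "lo \<le> \<beta>" "\<beta> < \<delta>" "\<delta> < \<delta>'" "\<delta>' \<le> hi" "y \<in> scale_ball V N r \<beta> x" for \<beta> \<delta> \<delta>'
    using L that unfolding nonlinear_scale_op_def by blast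
  have "L \<alpha>' \<alpha> y = L \<alpha>' hi y" using compat[of \<alpha>' \<alpha> hi] \<alpha> y by (cases "\<alpha> = hi") auto
  also have "\<dots> = L \<sigma> hi y"
    using compat[of \<alpha>' \<sigma> hi] compat[of \<sigma> \<alpha>' hi] \<sigma> \<alpha> y by (cases \<alpha>' \<sigma> rule: linorder_cases) auto
  finally show ?thesis by (simp add: level_free_def \<sigma>_def)
qed

lemma scale_ball_infinity [simp]: "scale_ball V N \<infinity> \<alpha> x = V \<alpha>"
  by (simp add: scale_ball_def)

locale evolution_problem =
  fixes V :: "real \<Rightarrow> 'a::real_vector set"
    and N :: "real \<Rightarrow> 'a \<Rightarrow> real"
    and lo hi T \<beta> C1 C2 C3 \<alpha>0 \<gamma> lam :: real
    and C :: "real \<Rightarrow> real"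
    and r :: ereal
    and x :: 'a
    and U :: "real \<Rightarrow> real \<Rightarrow> 'a scale_op"
    and B :: "real \<Rightarrow> 'a scale_op"
  assumes scale: "banach_scale lo hi V N"
    and T_pos: "0 < T"
    and x_in_lo: "x \<in> V lo"
    and A1: "cond_A1 lo hi V N T U"
    and A2: "cond_A2 lo hi V N T U \<beta> C1"
    and A3: "cond_A3 lo hi V N T U x C"
    and B1: "cond_B1 lo hi V N T B r x"
    and B2: "cond_B2 lo hi V N T B r x \<beta> C2"
    and B3: "cond_B3 lo hi N T B x C3"
    and \<beta>_r: "\<beta> = 0 \<or> r = \<infinity>"
    and \<alpha>0: "lo < \<alpha>0" "\<alpha>0 < hi"
    and \<gamma>: "\<beta> < \<gamma>" "\<gamma> < 1 - \<beta>"
    and C_mono: "\<forall>\<alpha>\<in>{\<alpha>0..hi}. C \<alpha> \<le> C \<alpha>0"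
    and lam: "lambda0 lo hi T \<beta> C1 C2 C3 (C \<alpha>0) (N lo x) \<alpha>0 \<gamma> r < lam"
begin

text \<open>The right-hand side of the a-priori estimate. It is fixed in advance as the bound in
  \<open>admissible\<close>, so that the estimate for the solution is inherited from the
  iterates.\<close>

definition K where
  "K = (C3 / (\<alpha>0 - lo) + C \<alpha>0) * (hi - \<alpha>0) powr \<gamma> * (1 + N lo x)"

definition E where "E t s = level_free lo hi V N \<infinity> 0 (U t s)"

definition F where "F t = level_free lo hi V N r x (B t)"

abbreviation "xball \<alpha> \<equiv> scale_ball V N r \<alpha> x"

lemma constants:
  shows "0 < C1" "0 < C2" "0 < C3" "0 < C \<alpha>0" "0 \<le> \<beta>" "0 < \<gamma>" "\<gamma> < 1" "0 < r"
  using A2 A3 B1 B2 B3 \<alpha>0 \<gamma>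
  by (auto simp: cond_A2_def cond_A3_def cond_B1_def cond_B2_def cond_B3_def)

lemma banach: "lo \<le> \<alpha> \<Longrightarrow> \<alpha> \<le> hi \<Longrightarrow> banach_carrier (V \<alpha>) (N \<alpha>)"
  using scale by (simp add: banach_scale_def banach_on_def banach_carrier_def
      banach_carrier_axioms_def normed_carrier_def)

lemma V_mono: "lo \<le> \<alpha>' \<Longrightarrow> \<alpha>' \<le> \<alpha> \<Longrightarrow> \<alpha> \<le> hi \<Longrightarrow> u \<in> V \<alpha>' \<Longrightarrow> u \<in> V \<alpha>"
  using scale unfolding banach_scale_def by (metis order_le_less subsetD)

lemma N_mono: "lo \<le> \<alpha>' \<Longrightarrow> \<alpha>' \<le> \<alpha> \<Longrightarrow> \<alpha> \<le> hi \<Longrightarrow> u \<in> V \<alpha>' \<Longrightarrow> N \<alpha> u \<le> N \<alpha>' u"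
  using scale unfolding banach_scale_def by (metis order_le_less order_refl)

lemma x_in: "lo \<le> \<alpha> \<Longrightarrow> \<alpha> \<le> hi \<Longrightarrow> x \<in> V \<alpha>"
  using V_mono x_in_lo by blast

lemma x_in_ball: "lo \<le> \<alpha> \<Longrightarrow> \<alpha> \<le> hi \<Longrightarrow> x \<in> xball \<alpha>"
  using x_in constants(8) normed_carrier.n_zero[of "V \<alpha>" "N \<alpha>"] banach[of \<alpha>]
  by (simp add: scale_ball_def banach_carrier_def less_imp_le zero_ereal_def)

lemma N_x_nonneg: "0 \<le> N lo x"
  using normed_carrier.n_nonneg[of "V lo" "N lo"] banach[of lo] \<alpha>0 x_in_lo
  by (simp add: banach_carrier_def)

lemma K_pos: "0 < K"
  using constants \<alpha>0 N_x_nonneg by (auto simp: K_def intro!: mult_pos_pos add_pos_pos add_pos_nonneg)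

text \<open>The first inequality keeps all lifetimes inside \<open>[0, T)\<close>, the second closes
  the a-priori bound and gives the contraction, the third keeps the path in a ball of finite radius.
  There the reciprocal of the radius is an ordinary real and both terms are put over it.\<close>

lemma lam_bounds:
  shows "(hi - lo) / T < lam"
    and "4 powr (1 - \<beta>) * C2 * (hi - \<alpha>0) powr \<beta> / (\<gamma> * (1 + N lo x)) + 2 powr (2 + \<gamma>) * C1 * C2 / \<gamma> < lam"
    and "r = ereal R \<Longrightarrow> (C \<alpha>0 * (hi - \<alpha>0)
      + C1 * (C3 / (\<alpha>0 - lo) + C \<alpha>0) * (hi - \<alpha>0) * (1 + N lo x) / (1 - \<gamma>)) / R < lam"
proof -
  have "real_of_ereal (1 / ereal R) = 1 / R" if "0 < R" for R
    using that by (simp add: one_ereal_def)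
  then show "r = ereal R \<Longrightarrow> (C \<alpha>0 * (hi - \<alpha>0)
      + C1 * (C3 / (\<alpha>0 - lo) + C \<alpha>0) * (hi - \<alpha>0) * (1 + N lo x) / (1 - \<gamma>)) / R < lam"
    using lam constants(8) by (simp add: lambda0_def Let_def add_divide_distrib mult.commute[of R])
qed (use lam in \<open>simp_all add: lambda0_def Let_def\<close>)

lemma lam_pos: "0 < lam"
proof -
  have "0 < (hi - lo) / T" using \<alpha>0 T_pos by simp
  then show ?thesis using lam_bounds(1) by linarith
qed

text \<open>Since \<open>lam * T > hi - lo\<close>, the lifetime counted from
  \<open>\<alpha>0\<close> is shorter than the one that A3 grants, counted from \<open>lo\<close>.
  The assumption is a weak inequality so that the right endpoint of the lifetime is covered.\<close>

lemma time_le: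
  assumes "\<alpha>0 + lam * t \<le> \<alpha>" "\<alpha> \<le> hi" "0 \<le> t"
  shows "t \<le> (\<alpha> - lo) / (hi - lo) * T" "t < T"
proof -
  have lamT: "hi - lo < lam * T" using lam_bounds(1) T_pos by (simp add: field_simps)
  have "t * (hi - lo) \<le> t * (lam * T)" using lamT assms(3) by (intro mult_left_mono) auto
  also have "\<dots> = lam * t * T" by simp
  also have "\<dots> \<le> (\<alpha> - lo) * T" using assms \<alpha>0 T_pos by (intro mult_right_mono) auto
  finally show "t \<le> (\<alpha> - lo) / (hi - lo) * T" using \<alpha>0 by (simp add: field_simps)
  have "lam * t < lam * T" using assms lamT \<alpha>0 by simp
  then show "t < T" using lam_pos by simp
qed

lemma E_eq:
  assumes "0 \<le> s" "s \<le> t" "t < T" "lo \<le> \<alpha>'" "\<alpha>' < \<alpha>" "\<alpha> \<le> hi" "y \<in> V \<alpha>'"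
  shows "U t s \<alpha>' \<alpha> y = E t s y"
  unfolding E_def
  using A1 assms by (intro level_free_eq) (auto simp: cond_A1_def bounded_linear_scale_op_def)

lemma F_eq:
  assumes "0 \<le> t" "t < T" "lo \<le> \<alpha>'" "\<alpha>' < \<alpha>" "\<alpha> \<le> hi" "y \<in> xball \<alpha>'"
  shows "B t \<alpha>' \<alpha> y = F t y"
  unfolding F_def using B1 assms by (intro level_free_eq) (auto simp: cond_B1_def)

lemma U_bounded_linear:
  assumes "0 \<le> s" "s \<le> t" "t < T" "lo \<le> \<alpha>'" "\<alpha>' < \<alpha>" "\<alpha> \<le> hi"
  shows "bounded_linear_on (V \<alpha>') (N \<alpha>') (V \<alpha>) (N \<alpha>) (U t s \<alpha>' \<alpha>)"
  using A1 assms by (auto simp: cond_A1_def bounded_linear_scale_op_def)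

lemma E_in:
  assumes "0 \<le> s" "s \<le> t" "t < T" "lo \<le> \<alpha>'" "\<alpha>' < \<alpha>" "\<alpha> \<le> hi" "y \<in> V \<alpha>'"
  shows "E t s y \<in> V \<alpha>"
  using U_bounded_linear[OF assms(1-6)] E_eq[OF assms] assms(7)
  by (metis Pi_mem bounded_linear_on_def)

lemma E_diff:
  assumes st: "0 \<le> s" "s \<le> t" "t < T" and \<alpha>: "lo \<le> \<alpha>" "\<alpha> < hi" and yz: "y \<in> V \<alpha>" "z \<in> V \<alpha>"
  shows "E t s (y - z) = E t s y - E t s z"
proof -
  interpret banach_carrier "V \<alpha>" "N \<alpha>" using banach \<alpha> by simp
  note L = U_bounded_linear[OF st \<alpha> order_refl, unfolded bounded_linear_on_def]
  have "U t s \<alpha> hi (y + (- 1) *\<^sub>R z) = U t s \<alpha> hi y + (- 1) *\<^sub>R U t s \<alpha> hi z"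
    using L yz scale_in by metis
  then show ?thesis using E_eq[OF st \<alpha> order_refl] yz diff_in[OF yz] by simp
qed

text \<open>\<open>onorm_on\<close> is a supremum of reals and bounds its members only if it is
  taken over a set bounded above; A1 supplies this, after which A2 can be read off at a single
  vector.\<close>

lemma E_norm:
  assumes "0 \<le> s" "s \<le> t" "t < T" "lo \<le> \<alpha>'" "\<alpha>' < \<alpha>" "\<alpha> \<le> hi" "y \<in> V \<alpha>'"
  shows "N \<alpha> (E t s y) \<le> C1 / (\<alpha> - \<alpha>') powr \<beta> * N \<alpha>' y"
proof -
  interpret A: banach_carrier "V \<alpha>'" "N \<alpha>'" using banach assms by simp
  note L = U_bounded_linear[OF assms(1-6)]
  obtain M where M: "\<And>u. u \<in> V \<alpha>' \<Longrightarrow> N \<alpha> (U t s \<alpha>' \<alpha> u) \<le> M * N \<alpha>' u"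
    using L unfolding bounded_linear_on_def by blast
  show ?thesis
  proof (cases "y = 0")
    case True
    then show ?thesis using M[OF A.zero_in] E_eq[OF assms] by (simp add: A.n_zero)
  next
    case False
    then have pos: "0 < N \<alpha>' y" using A.n_nonneg A.eq_0_iff assms(7) by (metis order_le_less)
    \<comment> \<open>The maximum with 0 covers \<open>u = 0\<close>, where the quotient is 0 by
      convention.\<close>
    have "N \<alpha> (U t s \<alpha>' \<alpha> u) / N \<alpha>' u \<le> max M 0" if "u \<in> V \<alpha>'" for u
      using M[OF that] A.n_nonneg[OF that]
      by (cases "N \<alpha>' u = 0") (auto simp: divide_le_eq intro: order.trans mult_right_mono)
    then have "bdd_above ((\<lambda>u. N \<alpha> (U t s \<alpha>' \<alpha> u) / N \<alpha>' u) ` V \<alpha>')" by (intro bdd_aboveI2)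
    then have "N \<alpha> (U t s \<alpha>' \<alpha> y) / N \<alpha>' y \<le> onorm_on (V \<alpha>') (N \<alpha>') (N \<alpha>) (U t s \<alpha>' \<alpha>)"
      unfolding onorm_on_def using assms(7) by (rule cSUP_upper[rotated])
    also have "\<dots> \<le> C1 / (\<alpha> - \<alpha>') powr \<beta>" using A2 assms unfolding cond_A2_def by blast
    finally show ?thesis using pos E_eq[OF assms] by (simp add: pos_divide_le_eq)
  qed
qed

lemma E_continuous:
  assumes "lo \<le> \<alpha>'" "\<alpha>' < \<alpha>" "\<alpha> \<le> hi" "y \<in> V \<alpha>'"
  shows "continuous_map (top_of_set {(t, s). 0 \<le> s \<and> s \<le> t \<and> t < T})
    (norm_topology (V \<alpha>) (N \<alpha>)) (\<lambda>(t, s). E t s y)"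
proof (rule continuous_map_eq)
  show "continuous_map (top_of_set {(t, s). 0 \<le> s \<and> s \<le> t \<and> t < T})
      (norm_topology (V \<alpha>) (N \<alpha>)) (\<lambda>(t, s). U t s \<alpha>' \<alpha> y)"
    using A1 assms unfolding cond_A1_def by blast
qed (use E_eq assms in auto)

lemma F_in:
  assumes "0 \<le> t" "t < T" "lo \<le> \<alpha>'" "\<alpha>' < \<alpha>" "\<alpha> \<le> hi" "y \<in> xball \<alpha>'"
  shows "F t y \<in> V \<alpha>"
proof -
  have "B t \<alpha>' \<alpha> \<in> xball \<alpha>' \<rightarrow> V \<alpha>"
    using B1 assms unfolding cond_B1_def nonlinear_scale_op_def by simp
  then show ?thesis using assms(6) F_eq[OF assms] by (metis Pi_mem)
qed

lemma F_lipschitz: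
  assumes "0 \<le> t" "t < T" "lo \<le> \<alpha>'" "\<alpha>' < \<alpha>" "\<alpha> \<le> hi" "y \<in> xball \<alpha>'" "z \<in> xball \<alpha>'"
  shows "N \<alpha> (F t y - F t z) \<le> C2 / (\<alpha> - \<alpha>') powr (1 - \<beta>) * N \<alpha>' (y - z)"
proof -
  have "N \<alpha> (B t \<alpha>' \<alpha> y - B t \<alpha>' \<alpha> z) \<le> C2 / (\<alpha> - \<alpha>') powr (1 - \<beta>) * N \<alpha>' (y - z)"
    using B2 assms unfolding cond_B2_def by simp
  then show ?thesis using F_eq[of t \<alpha>' \<alpha>] assms by simp
qed

lemma F_continuous:
  assumes \<alpha>: "lo \<le> \<alpha>'" "\<alpha>' < \<alpha>" "\<alpha> \<le> hi" and S: "S \<subseteq> {0..<T}"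
    and u: "continuous_map (top_of_set S) (norm_topology (V \<alpha>') (N \<alpha>')) u"
    and ball: "\<And>s. s \<in> S \<Longrightarrow> u s \<in> xball \<alpha>'"
  shows "continuous_map (top_of_set S) (norm_topology (V \<alpha>) (N \<alpha>)) (\<lambda>s. F s (u s))"
proof -
  have "continuous_map (top_of_set S)
      (prod_topology (subtopology (norm_topology (V \<alpha>') (N \<alpha>')) (xball \<alpha>')) (top_of_set {0..<T}))
      (\<lambda>s. (u s, s))"
    using u ball S
    by (intro continuous_map_pairedI continuous_map_into_subtopology) (auto simp: continuous_on_id)
  moreover have "continuous_map
      (prod_topology (subtopology (norm_topology (V \<alpha>') (N \<alpha>')) (xball \<alpha>')) (top_of_set {0..<T}))
      (norm_topology (V \<alpha>) (N \<alpha>)) (\<lambda>(u, t). B t \<alpha>' \<alpha> u)"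
    using B1 \<alpha> unfolding cond_B1_def by blast
  ultimately have "continuous_map (top_of_set S) (norm_topology (V \<alpha>) (N \<alpha>))
      ((\<lambda>(u, t). B t \<alpha>' \<alpha> u) \<circ> (\<lambda>s. (u s, s)))"
    by (rule continuous_map_compose)
  then show ?thesis
    by (rule continuous_map_eq) (use F_eq[OF _ _ \<alpha>] S ball in auto)
qed

section \<open>The free evolution and the Duhamel term\<close>

definition g where "g t = E t 0 x"

lemma g_eq: "0 \<le> t \<Longrightarrow> t < T \<Longrightarrow> lo < \<alpha> \<Longrightarrow> \<alpha> \<le> hi \<Longrightarrow> g t = U t 0 lo \<alpha> x"
  unfolding g_def using E_eq[of 0 t lo \<alpha> x] x_in_lo by simp

lemma g_in: "0 \<le> t \<Longrightarrow> t < T \<Longrightarrow> lo < \<alpha> \<Longrightarrow> \<alpha> \<le> hi \<Longrightarrow> g t \<in> V \<alpha>"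
  unfolding g_def using E_in[of 0 t lo \<alpha> x] x_in_lo by simp

lemma g_0: "g 0 = x"
proof -
  have "U 0 0 lo hi x = x" using A1 \<alpha>0 T_pos x_in_lo unfolding cond_A1_def by simp
  then show ?thesis using g_eq[of 0 hi] \<alpha>0 T_pos by simp
qed

text \<open>A3 applies at level \<open>\<alpha>\<close> because of \<open>time_le\<close>; the
  monotonicity of the constants then replaces \<open>C \<alpha>\<close> by a constant common to all
  levels.\<close>

lemma g_lipschitz:
  assumes "0 \<le> s" "0 \<le> t" "\<alpha>0 + lam * s \<le> \<alpha>" "\<alpha>0 + lam * t \<le> \<alpha>" "\<alpha> \<le> hi"
  shows "N \<alpha> (g t - g s) \<le> C \<alpha>0 * \<bar>t - s\<bar>"
proof -
  have "0 \<le> lam * s" using lam_pos assms(1) by simp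
  then have \<alpha>: "\<alpha>0 \<le> \<alpha>" using assms by simp
  then have "N \<alpha> (U t 0 lo \<alpha> x - U s 0 lo \<alpha> x) \<le> C \<alpha> * \<bar>t - s\<bar>"
    using A3 assms \<alpha>0 time_le[of s \<alpha>] time_le[of t \<alpha>] unfolding cond_A3_def by simp
  also have "\<dots> \<le> C \<alpha>0 * \<bar>t - s\<bar>" using C_mono \<alpha> assms by (intro mult_right_mono) auto
  finally show ?thesis using g_eq[of _ \<alpha>] assms \<alpha> \<alpha>0 time_le(2)[of _ \<alpha>] by simp
qed

text \<open>The candidates for \<open>B(u(s),s)\<close>. The iteration is run on these right-hand
  sides. A lifetime is written as \<open>\<alpha>0 + lam * s < \<alpha>\<close>, the form in which
  levels are compared.\<close>

definition admissible where
  "admissible b \<longleftrightarrow> (\<forall>\<alpha>. \<alpha>0 < \<alpha> \<and> \<alpha> \<le> hi \<longrightarrow>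
    continuous_map (top_of_set {s. 0 \<le> s \<and> \<alpha>0 + lam * s < \<alpha>}) (norm_topology (V \<alpha>) (N \<alpha>)) b \<and>
    (\<forall>s. 0 \<le> s \<and> \<alpha>0 + lam * s < \<alpha> \<longrightarrow> N \<alpha> (b s) \<le> K * (\<alpha> - \<alpha>0 - lam * s) powr (- \<gamma>)))"

lemma level_gt: "0 \<le> s \<Longrightarrow> \<alpha>0 + lam * s < \<alpha> \<Longrightarrow> \<alpha>0 < \<alpha>"
  using lam_pos by (smt (verit) mult_nonneg_nonneg)

lemma level_nbhd:
  assumes "\<alpha>0 + lam * s0 < \<alpha>"
  obtains d where "d > 0" "\<And>s. dist s s0 < d \<Longrightarrow> \<alpha>0 + lam * s < \<alpha>"
proof (rule that)
  show "(\<alpha> - \<alpha>0 - lam * s0) / lam > 0" using assms lam_pos by simp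
  fix s assume "dist s s0 < (\<alpha> - \<alpha>0 - lam * s0) / lam"
  then have "s < s0 + (\<alpha> - \<alpha>0 - lam * s0) / lam" by (simp add: dist_real_def)
  then have "lam * s < lam * (s0 + (\<alpha> - \<alpha>0 - lam * s0) / lam)" using lam_pos by simp
  also have "\<dots> = \<alpha> - \<alpha>0" using lam_pos by (simp add: field_simps)
  finally show "\<alpha>0 + lam * s < \<alpha>" by simp
qed

lemma admissible_zero: "admissible (\<lambda>_. 0)"
proof -
  have "continuous_map (top_of_set S) (norm_topology (V \<alpha>) (N \<alpha>)) (\<lambda>_. 0) \<and> N \<alpha> 0 = 0"
    if "\<alpha>0 < \<alpha>" "\<alpha> \<le> hi" for \<alpha> and S :: "real set"
  proof -
    interpret banach_carrier "V \<alpha>" "N \<alpha>" using banach that \<alpha>0 by simp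
    show ?thesis by (simp add: zero_in n_zero norm_topology_def)
  qed
  then show ?thesis using K_pos by (simp add: admissible_def)
qed

section \<open>The integrand \<open>E t s (b s)\<close>: bounds and joint continuity\<close>

context
  fixes b
  assumes b: "admissible b"
begin

lemma b_continuous:
  assumes "\<alpha>0 < \<alpha>" "\<alpha> \<le> hi"
  shows "continuous_map (top_of_set {s. 0 \<le> s \<and> \<alpha>0 + lam * s < \<alpha>}) (norm_topology (V \<alpha>) (N \<alpha>)) b"
  using b assms unfolding admissible_def by blast

lemma b_in:
  assumes s: "0 \<le> s" "\<alpha>0 + lam * s < \<alpha>" "\<alpha> \<le> hi"
  shows "b s \<in> V \<alpha>"
proof -
  note \<alpha> = level_gt[OF s(1,2)]
  interpret banach_carrier "V \<alpha>" "N \<alpha>" using banach s \<alpha> \<alpha>0 by simp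
  show ?thesis
    using continuous_map_norm_topologyD(1)[OF b_continuous[OF \<alpha> s(3)], of s] s by simp
qed

lemma b_bound:
  "0 \<le> s \<Longrightarrow> \<alpha>0 + lam * s < \<alpha> \<Longrightarrow> \<alpha> \<le> hi \<Longrightarrow> N \<alpha> (b s) \<le> K * (\<alpha> - \<alpha>0 - lam * s) powr (- \<gamma>)"
  using b level_gt unfolding admissible_def by blast

lemma Eb_in:
  assumes *: "0 \<le> s" "s \<le> t" "t < T" "\<alpha>0 + lam * s < \<alpha>" "\<alpha> \<le> hi"
  shows "E t s (b s) \<in> V \<alpha>"
proof -
  obtain \<alpha>' where \<alpha>': "\<alpha>0 + lam * s < \<alpha>'" "\<alpha>' < \<alpha>" using dense[OF *(4)] by blast
  then have "lo \<le> \<alpha>'" using level_gt[of s \<alpha>'] * \<alpha>0 by simp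
  then show ?thesis using E_in[of s t \<alpha>' \<alpha> "b s"] b_in[of s \<alpha>'] * \<alpha>' by simp
qed

lemma Eb_bound_level:
  assumes "0 \<le> s" "s \<le> t" "t < T" "\<alpha>0 + lam * s < \<alpha>'" "\<alpha>' < \<alpha>" "\<alpha> \<le> hi"
  shows "N \<alpha> (E t s (b s)) \<le> C1 / (\<alpha> - \<alpha>') powr \<beta> * (K * (\<alpha>' - \<alpha>0 - lam * s) powr (- \<gamma>))"
proof -
  have "lo \<le> \<alpha>'" using level_gt[of s \<alpha>'] assms \<alpha>0 by simp
  then have "N \<alpha> (E t s (b s)) \<le> C1 / (\<alpha> - \<alpha>') powr \<beta> * N \<alpha>' (b s)"
    using assms b_in[of s \<alpha>'] by (intro E_norm) auto
  also have "\<dots> \<le> C1 / (\<alpha> - \<alpha>') powr \<beta> * (K * (\<alpha>' - \<alpha>0 - lam * s) powr (- \<gamma>))"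
    using b_bound[of s \<alpha>'] assms constants(1) by (intro mult_left_mono) auto
  finally show ?thesis .
qed

text \<open>Half of the room \<open>\<rho>\<close> is spent on \<open>U\<close> and the other half
  is left for the weight of \<open>b\<close>.\<close>

lemma Eb_bound:
  assumes "0 \<le> s" "s \<le> t" "t < T" "\<alpha>0 + lam * s < \<alpha>" "\<alpha> \<le> hi"
  shows "N \<alpha> (E t s (b s)) \<le> C1 * K * ((\<alpha> - \<alpha>0 - lam * s) / 2) powr (- (\<beta> + \<gamma>))"
proof -
  define \<rho> where "\<rho> = \<alpha> - \<alpha>0 - lam * s"
  have \<rho>: "0 < \<rho>" using assms by (simp add: \<rho>_def)
  have "N \<alpha> (E t s (b s)) \<le> C1 / (\<alpha> - (\<alpha> - \<rho> / 2)) powr \<beta> * (K * ((\<alpha> - \<rho> / 2) - \<alpha>0 - lam * s) powr (- \<gamma>))"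
    using \<rho> assms by (intro Eb_bound_level) (auto simp: \<rho>_def field_simps)
  also have "(\<alpha> - \<rho> / 2) - \<alpha>0 - lam * s = \<rho> / 2" by (simp add: \<rho>_def field_simps)
  also have "C1 / (\<alpha> - (\<alpha> - \<rho> / 2)) powr \<beta> * (K * (\<rho> / 2) powr (- \<gamma>)) = C1 * K * (\<rho> / 2) powr (- (\<beta> + \<gamma>))"
    by (simp add: powr_minus powr_add powr_diff field_simps)
  finally show ?thesis by (simp add: \<rho>_def)
qed

text \<open>For \<open>\<beta> = 0\<close> the bound on \<open>U\<close> does not depend on the gap,
  so the intermediate level can tend to \<open>\<alpha>\<close>. This removes a factor
  \<open>2 powr \<gamma>\<close>, which the fourth number in \<open>lambda0\<close> does not
  contain.\<close>

lemma Eb_bound_sharp: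
  assumes "\<beta> = 0" "0 \<le> s" "s \<le> t" "t < T" "\<alpha>0 + lam * s < \<alpha>" "\<alpha> \<le> hi"
  shows "N \<alpha> (E t s (b s)) \<le> C1 * K * (\<alpha> - \<alpha>0 - lam * s) powr (- \<gamma>)"
proof (rule tendsto_lowerbound)
  show "((\<lambda>\<alpha>'. C1 * K * (\<alpha>' - \<alpha>0 - lam * s) powr (- \<gamma>)) \<longlongrightarrow>
      C1 * K * (\<alpha> - \<alpha>0 - lam * s) powr (- \<gamma>)) (at_left \<alpha>)"
    using assms by (intro tendsto_intros) auto
  have "eventually (\<lambda>\<alpha>'. \<alpha>' \<in> {\<alpha>0 + lam * s<..<\<alpha>}) (at_left \<alpha>)"
    by (rule eventually_at_leftI[OF _ assms(5)]) auto
  then show "eventually (\<lambda>\<alpha>'. N \<alpha> (E t s (b s)) \<le> C1 * K * (\<alpha>' - \<alpha>0 - lam * s) powr (- \<gamma>)) (at_left \<alpha>)"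
    by eventually_elim (use Eb_bound_level[of s t _ \<alpha>] assms in \<open>auto simp: algebra_simps\<close>)
qed auto

text \<open>Strong continuity of \<open>U\<close> handles the fixed vector \<open>b s0\<close>;
  exchanging \<open>b s\<close> for \<open>b s0\<close> is controlled by the bound A2, which is
  uniform in \<open>(t, s)\<close>. An intermediate level above \<open>\<alpha>0 + lam * s0\<close>
  provides the gap and remains valid for all \<open>s\<close> near \<open>s0\<close>.\<close>

lemma Eb_continuous:
  assumes \<alpha>: "\<alpha>0 < \<alpha>" "\<alpha> \<le> hi"
  shows "continuous_map (top_of_set {(t, s). 0 \<le> s \<and> s \<le> t \<and> t < T \<and> \<alpha>0 + lam * s < \<alpha>})
    (norm_topology (V \<alpha>) (N \<alpha>)) (\<lambda>(t, s). E t s (b s))"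
proof -
  interpret A: banach_carrier "V \<alpha>" "N \<alpha>" using banach \<alpha> \<alpha>0 by simp
  let ?S = "{(t, s). 0 \<le> s \<and> s \<le> t \<and> t < T \<and> \<alpha>0 + lam * s < \<alpha>}"
  have "\<exists>d>0. \<forall>(t, s)\<in>?S. dist (t, s) (t0, s0) < d \<longrightarrow> N \<alpha> (E t s (b s) - E t0 s0 (b s0)) < e"
    if st: "0 \<le> s0" "s0 \<le> t0" "t0 < T" "\<alpha>0 + lam * s0 < \<alpha>" and e: "e > 0" for t0 s0 e
  proof -
    obtain \<alpha>' where \<alpha>': "\<alpha>0 + lam * s0 < \<alpha>'" "\<alpha>' < \<alpha>" using dense[OF st(4)] by blast
    then have lo: "\<alpha>0 < \<alpha>'" "lo \<le> \<alpha>'" "\<alpha>' < hi" "\<alpha>' \<le> hi"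
      using level_gt[of s0 \<alpha>'] st \<alpha>0 \<alpha> by auto
    interpret A': banach_carrier "V \<alpha>'" "N \<alpha>'" using banach lo by simp
    define M where "M = C1 / (\<alpha> - \<alpha>') powr \<beta>"
    have M: "M > 0" using constants \<alpha>' by (simp add: M_def)
    have b0: "b s0 \<in> V \<alpha>'" using b_in st \<alpha>' lo by simp
    obtain d1 where d1: "d1 > 0" "\<And>s. 0 \<le> s \<Longrightarrow> \<alpha>0 + lam * s < \<alpha>' \<Longrightarrow> dist s s0 < d1
        \<Longrightarrow> N \<alpha>' (b s - b s0) < e / 2 / M"
    proof -
      have "e / 2 / M > 0" "s0 \<in> {s. 0 \<le> s \<and> \<alpha>0 + lam * s < \<alpha>'}" using e M st \<alpha>' by auto
      then obtain d where "d > 0" "\<forall>y\<in>{s. 0 \<le> s \<and> \<alpha>0 + lam * s < \<alpha>'}.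
          dist y s0 < d \<longrightarrow> N \<alpha>' (b y - b s0) < e / 2 / M"
        using A'.continuous_map_norm_topologyD(2)[OF b_continuous[OF lo(1,4)]] by blast
      then show ?thesis by (intro that[of d]) auto
    qed
    obtain d2 where d2: "d2 > 0" "\<And>t s. 0 \<le> s \<Longrightarrow> s \<le> t \<Longrightarrow> t < T \<Longrightarrow> dist (t, s) (t0, s0) < d2
        \<Longrightarrow> N \<alpha> (E t s (b s0) - E t0 s0 (b s0)) < e / 2"
    proof -
      let ?D = "{(t, s). 0 \<le> s \<and> s \<le> t \<and> t < T}"
      have "e / 2 > 0" "(t0, s0) \<in> ?D" using e st by auto
      then obtain d where "d > 0" "\<forall>y\<in>?D. dist y (t0, s0) < d \<longrightarrow>
          N \<alpha> ((\<lambda>(t, s). E t s (b s0)) y - (\<lambda>(t, s). E t s (b s0)) (t0, s0)) < e / 2"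
        using A.continuous_map_norm_topologyD(2)[OF E_continuous[OF lo(2) \<alpha>'(2) \<alpha>(2) b0]] by blast
      then show ?thesis by (intro that[of d]) auto
    qed
    obtain d3 where d3: "d3 > 0" "\<And>s. dist s s0 < d3 \<Longrightarrow> \<alpha>0 + lam * s < \<alpha>'"
      using level_nbhd[OF \<alpha>'(1)] by blast
    show ?thesis
    proof (intro exI[of _ "min d1 (min d2 d3)"] conjI ballI; clarify?)
      fix t s assume s: "0 \<le> s" "s \<le> t" "t < T" "\<alpha>0 + lam * s < \<alpha>"
        and dist: "dist (t, s) (t0, s0) < min d1 (min d2 d3)"
      have "dist s s0 \<le> dist (t, s) (t0, s0)" using dist_snd_le[of "(t, s)" "(t0, s0)"] by simp
      then have dist': "dist s s0 < d1" "dist s s0 < d3" "dist (t, s) (t0, s0) < d2" using dist by auto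
      have bs: "b s \<in> V \<alpha>'" using b_in s d3(2) dist' lo by simp
      have "N \<alpha> (E t s (b s) - E t s (b s0)) = N \<alpha> (E t s (b s - b s0))"
        using E_diff[of s t \<alpha>'] s lo bs b0 by simp
      also have "\<dots> \<le> M * N \<alpha>' (b s - b s0)"
        unfolding M_def using s lo \<alpha>' \<alpha> bs b0 by (intro E_norm) (auto intro: A'.diff_in)
      also have "\<dots> < e / 2"
        using d1(2)[of s] s d3(2) dist' M by (simp add: field_simps)
      finally have "N \<alpha> (E t s (b s) - E t s (b s0)) < e / 2" .
      moreover have "N \<alpha> (E t s (b s0) - E t0 s0 (b s0)) < e / 2" using d2(2) s dist' by simp
      moreover have "N \<alpha> (E t s (b s) - E t0 s0 (b s0))
          \<le> N \<alpha> (E t s (b s) - E t s (b s0)) + N \<alpha> (E t s (b s0) - E t0 s0 (b s0))"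
        using E_in[of _ _ \<alpha>' \<alpha>] s st lo \<alpha>' \<alpha> bs b0 by (intro A.triangle_diff) auto
      ultimately show "N \<alpha> (E t s (b s) - E t0 s0 (b s0)) < e" by linarith
    qed (use d1 d2 d3 in auto)
  qed
  then show ?thesis
    unfolding A.continuous_map_norm_topology_iff using Eb_in \<alpha> by fastforce
qed

lemma Eb_slice_continuous:
  assumes "0 \<le> s" "s \<le> t" "t < T" "\<alpha>0 + lam * s < \<alpha>" "\<alpha> \<le> hi"
  shows "continuous_map (top_of_set {0..s}) (norm_topology (V \<alpha>) (N \<alpha>)) (\<lambda>q. E t q (b q))"
proof -
  have "\<alpha>0 + lam * q < \<alpha>" if "q \<le> s" for q
    using assms(4) mult_left_mono[OF that, of lam] lam_pos by linarith
  then have "continuous_map (top_of_set {0..s})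
      (top_of_set {(t, s). 0 \<le> s \<and> s \<le> t \<and> t < T \<and> \<alpha>0 + lam * s < \<alpha>}) (\<lambda>q. (t, q))"
    using assms by (auto intro!: continuous_intros)
  from continuous_map_compose[OF this Eb_continuous] show ?thesis
    using assms level_gt by (simp add: o_def)
qed

end

text \<open>The integral of \<open>U(t,q) b(q)\<close> over \<open>[0, s]\<close>, with the final
  time \<open>t\<close> and the upper limit \<open>s\<close> kept apart for the sake of the path. It
  is selected at the top level, the one common to all times of interest.\<close>

definition duh where
  "duh b t s = (SOME I. has_riemann_integral_on (V hi) (N hi) (\<lambda>q. E t q (b q)) I 0 s)"

definition sol where "sol b t = g t + duh b t t"

text \<open>Every time below the lifetime of \<open>\<alpha>\<close> is below that of some smaller
  \<open>\<alpha>'\<close>. On the times of \<open>\<alpha>'\<close> the room at level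
  \<open>\<alpha>\<close> stays at least \<open>\<alpha> - \<alpha>'\<close>, so weighted bounds
  become uniform there.\<close>

lemma continuous_localI:
  assumes \<alpha>: "\<alpha>0 < \<alpha>" "\<alpha> \<le> hi"
    and f: "\<And>\<alpha>'. \<alpha>0 < \<alpha>' \<Longrightarrow> \<alpha>' < \<alpha> \<Longrightarrow>
      continuous_map (top_of_set {s. 0 \<le> s \<and> \<alpha>0 + lam * s < \<alpha>'}) (norm_topology (V \<alpha>) (N \<alpha>)) f"
  shows "continuous_map (top_of_set {s. 0 \<le> s \<and> \<alpha>0 + lam * s < \<alpha>}) (norm_topology (V \<alpha>) (N \<alpha>)) f"
proof -
  interpret banach_carrier "V \<alpha>" "N \<alpha>" using banach \<alpha> \<alpha>0 by simp
  have "f s0 \<in> V \<alpha> \<and> (\<forall>e>0. \<exists>d>0. \<forall>s. 0 \<le> s \<and> \<alpha>0 + lam * s < \<alpha> \<longrightarrow> dist s s0 < d \<longrightarrow> N \<alpha> (f s - f s0) < e)"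
    if s0: "0 \<le> s0" "\<alpha>0 + lam * s0 < \<alpha>" for s0
  proof -
    obtain \<alpha>' where \<alpha>': "\<alpha>0 + lam * s0 < \<alpha>'" "\<alpha>' < \<alpha>" using dense[OF s0(2)] by blast
    then have c: "continuous_map (top_of_set {s. 0 \<le> s \<and> \<alpha>0 + lam * s < \<alpha>'}) (norm_topology (V \<alpha>) (N \<alpha>)) f"
      using f level_gt[OF s0(1)] by blast
    have s0': "s0 \<in> {s. 0 \<le> s \<and> \<alpha>0 + lam * s < \<alpha>'}" using s0 \<alpha>' by simp
    obtain d1 where d1: "d1 > 0" "\<And>s. dist s s0 < d1 \<Longrightarrow> \<alpha>0 + lam * s < \<alpha>'"
      using level_nbhd[OF \<alpha>'(1)] by blast
    have "\<exists>d>0. \<forall>s. 0 \<le> s \<and> \<alpha>0 + lam * s < \<alpha> \<longrightarrow> dist s s0 < d \<longrightarrow> N \<alpha> (f s - f s0) < e" if "e > 0" for e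
    proof -
      obtain d2 where d2: "d2 > 0" "\<forall>s\<in>{s. 0 \<le> s \<and> \<alpha>0 + lam * s < \<alpha>'}. dist s s0 < d2 \<longrightarrow> N \<alpha> (f s - f s0) < e"
        using continuous_map_norm_topologyD(2)[OF c s0' \<open>e > 0\<close>] by blast
      show ?thesis by (rule exI[of _ "min d1 d2"]) (use d1 d2 in auto)
    qed
    then show ?thesis using continuous_map_norm_topologyD(1)[OF c s0'] by blast
  qed
  then show ?thesis unfolding continuous_map_norm_topology_iff by fastforce
qed

section \<open>The Duhamel integral and the path in the ball\<close>

context
  fixes b
  assumes b: "admissible b"
begin

text \<open>An integral at level \<open>\<alpha>\<close> is also one at level \<open>hi\<close>, and
  uniqueness there shows that it is the selected vector.\<close>

lemma duh_integral:
  assumes st: "0 \<le> s" "s \<le> t" "t < T" "\<alpha>0 + lam * s < \<alpha>" "\<alpha> \<le> hi"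
  shows "has_riemann_integral_on (V \<alpha>) (N \<alpha>) (\<lambda>q. E t q (b q)) (duh b t s) 0 s"
proof -
  have \<alpha>: "lo \<le> \<alpha>" using level_gt[OF st(1,4)] \<alpha>0 by simp
  interpret A: banach_carrier "V \<alpha>" "N \<alpha>" using banach \<alpha> st by simp
  interpret H: banach_carrier "V hi" "N hi" using banach \<alpha>0 by simp
  obtain I where I: "has_riemann_integral_on (V \<alpha>) (N \<alpha>) (\<lambda>q. E t q (b q)) I 0 s"
    using A.has_riemann_integral_exists[OF Eb_slice_continuous[OF b st] st(1)] by blast
  have "has_riemann_integral_on (V hi) (N hi) (\<lambda>q. E t q (b q)) I 0 s"
    using I A.normed by (rule has_riemann_integral_on_mono) (use V_mono N_mono \<alpha> st in auto)
  moreover from this have "has_riemann_integral_on (V hi) (N hi) (\<lambda>q. E t q (b q)) (duh b t s) 0 s"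
    unfolding duh_def by (rule someI)
  ultimately have "duh b t s = I" using H.has_riemann_integral_unique by blast
  with I show ?thesis by simp
qed

lemma duh_in:
  assumes "0 \<le> s" "s \<le> t" "t < T" "\<alpha>0 + lam * s < \<alpha>" "\<alpha> \<le> hi"
  shows "duh b t s \<in> V \<alpha>"
  using duh_integral[OF assms] by (simp add: has_riemann_integral_on_def)

lemma duh_bound:
  assumes st: "0 \<le> s" "s \<le> t" "t < T" "\<alpha>0 + lam * s < \<alpha>" "\<alpha> \<le> hi"
    and "\<And>q. q \<in> {0..s} \<Longrightarrow> N \<alpha> (E t q (b q)) \<le> h q" "(h has_integral H) {0..s}"
  shows "N \<alpha> (duh b t s) \<le> H"
proof -
  interpret A: banach_carrier "V \<alpha>" "N \<alpha>" using banach level_gt[OF st(1,4)] \<alpha>0 st by simp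
  show ?thesis using A.has_riemann_integral_bound[OF duh_integral[OF st]] assms(6,7) by blast
qed

lemma duh_0:
  assumes "0 \<le> t" "t < T"
  shows "duh b t 0 = 0"
proof -
  interpret H: banach_carrier "V hi" "N hi" using banach \<alpha>0 by simp
  have st: "0 \<le> (0::real)" "0 \<le> t" "t < T" "\<alpha>0 + lam * 0 < hi" "hi \<le> hi" using assms \<alpha>0 by auto
  have "N hi (duh b t 0) \<le> 0" using st by (rule duh_bound) (auto intro: has_integral_refl)
  then show ?thesis using duh_in[OF st] H.n_nonneg H.eq_0_iff by (metis order_antisym)
qed

text \<open>Both terms have the same final time \<open>t\<close>, so their difference is the
  integral over \<open>[s, s']\<close> alone.\<close>

lemma duh_increment:
  assumes st: "0 \<le> s" "s \<le> s'" "s' \<le> t" "t < T" "\<alpha>0 + lam * s' < \<alpha>" "\<alpha> \<le> hi"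
    and M: "\<And>q. q \<in> {s..s'} \<Longrightarrow> N \<alpha> (E t q (b q)) \<le> M"
  shows "N \<alpha> (duh b t s' - duh b t s) \<le> M * (s' - s)"
proof -
  have s': "0 \<le> s'" using st by simp
  have s: "\<alpha>0 + lam * s < \<alpha>" using st(5) mult_left_mono[OF st(2), of lam] lam_pos by linarith
  interpret A: banach_carrier "V \<alpha>" "N \<alpha>" using banach level_gt[OF s' st(5)] \<alpha>0 st by simp
  have c: "continuous_map (top_of_set {0..s'}) (norm_topology (V \<alpha>) (N \<alpha>)) (\<lambda>q. E t q (b q))"
    using Eb_slice_continuous[OF b s'] st by simp
  then have "continuous_map (top_of_set {s..s'}) (norm_topology (V \<alpha>) (N \<alpha>)) (\<lambda>q. E t q (b q))"
    by (rule continuous_map_from_subtopology_mono) (use st in auto)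
  then obtain J where J: "has_riemann_integral_on (V \<alpha>) (N \<alpha>) (\<lambda>q. E t q (b q)) J s s'"
    using A.has_riemann_integral_exists st by blast
  have "has_riemann_integral_on (V \<alpha>) (N \<alpha>) (\<lambda>q. E t q (b q)) (duh b t s + J) 0 s'"
    using A.has_riemann_integral_combine[OF c st(1,2) duh_integral J] st s by simp
  then have "duh b t s' = duh b t s + J"
    using A.has_riemann_integral_unique duh_integral[OF s' st(3-6)] by blast
  moreover have "N \<alpha> J \<le> (s' - s) *\<^sub>R M"
    using A.has_riemann_integral_bound[OF J M has_integral_const_real] st by simp
  ultimately show ?thesis by (simp add: mult.commute)
qed

text \<open>Only finite \<open>r\<close> needs work. Then \<open>\<beta> = 0\<close>, the sharp
  bound has an integrable singularity, and the sum of the bounds for \<open>g s - x\<close> and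
  \<open>duh b t s\<close> is the numerator of the fourth number in \<open>lambda0\<close>, divided
  by \<open>lam\<close>.\<close>

lemma path_in_ball:
  assumes st: "0 \<le> s" "s \<le> t" "t < T" "\<alpha>0 + lam * s < \<alpha>" "\<alpha> \<le> hi"
  shows "g s + duh b t s \<in> xball \<alpha>"
proof -
  have \<alpha>: "\<alpha>0 < \<alpha>" using level_gt[OF st(1,4)] .
  interpret A: banach_carrier "V \<alpha>" "N \<alpha>" using banach \<alpha> \<alpha>0 st by simp
  have in_V: "g s \<in> V \<alpha>" "duh b t s \<in> V \<alpha>" "x \<in> V \<alpha>"
    using g_in[of s \<alpha>] duh_in[OF st] x_in[of \<alpha>] st \<alpha> \<alpha>0 by auto
  show ?thesis
  proof (cases r)
    case PInf
    then show ?thesis using in_V by (simp add: A.add_in)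
  next
    case MInf
    then show ?thesis using constants(8) by simp
  next
    case (real R)
    then have R: "0 < R" and \<beta>: "\<beta> = 0" using constants(8) \<beta>_r by auto
    define D where "D = hi - \<alpha>0"
    have D: "0 < D" using \<alpha>0 by (simp add: D_def)
    have "N \<alpha> (duh b t s) \<le> C1 * K * (((\<alpha> - \<alpha>0 - lam * s) powr (1 - \<gamma>) - (\<alpha> - \<alpha>0) powr (1 - \<gamma>)) / (lam * (\<gamma> - 1)))"
    proof (rule duh_bound[OF st])
      show "((\<lambda>q. C1 * K * (\<alpha> - \<alpha>0 - lam * q) powr (- \<gamma>)) has_integral
          C1 * K * (((\<alpha> - \<alpha>0 - lam * s) powr (1 - \<gamma>) - (\<alpha> - \<alpha>0) powr (1 - \<gamma>)) / (lam * (\<gamma> - 1)))) {0..s}"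
        using lam_pos st constants by (intro has_integral_mult_right has_integral_powr_affine) auto
      fix q assume q: "q \<in> {0..s}"
      then have "lam * q \<le> lam * s" using lam_pos by simp
      then show "N \<alpha> (E t q (b q)) \<le> C1 * K * (\<alpha> - \<alpha>0 - lam * q) powr (- \<gamma>)"
        using q st by (intro Eb_bound_sharp[OF b \<beta>]) auto
    qed
    also have "((\<alpha> - \<alpha>0 - lam * s) powr (1 - \<gamma>) - (\<alpha> - \<alpha>0) powr (1 - \<gamma>)) / (lam * (\<gamma> - 1))
        = ((\<alpha> - \<alpha>0) powr (1 - \<gamma>) - (\<alpha> - \<alpha>0 - lam * s) powr (1 - \<gamma>)) / (lam * (1 - \<gamma>))"
      by (metis minus_diff_eq minus_divide_divide mult_minus_right)
    also have "\<dots> \<le> D powr (1 - \<gamma>) / (lam * (1 - \<gamma>))"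
    proof (rule divide_right_mono)
      have "(\<alpha> - \<alpha>0) powr (1 - \<gamma>) \<le> D powr (1 - \<gamma>)"
        using \<alpha> st constants by (intro powr_mono2) (auto simp: D_def)
      then show "(\<alpha> - \<alpha>0) powr (1 - \<gamma>) - (\<alpha> - \<alpha>0 - lam * s) powr (1 - \<gamma>) \<le> D powr (1 - \<gamma>)"
        using powr_ge_zero[of "\<alpha> - \<alpha>0 - lam * s" "1 - \<gamma>"] by linarith
    qed (use lam_pos constants in simp)
    also have "C1 * K * (D powr (1 - \<gamma>) / (lam * (1 - \<gamma>)))
        = C1 * (C3 / (\<alpha>0 - lo) + C \<alpha>0) * D * (1 + N lo x) / (1 - \<gamma>) / lam"
    proof -
      define S where "S = (C3 / (\<alpha>0 - lo) + C \<alpha>0) * (1 + N lo x)"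
      \<comment> \<open>The factor \<open>D powr \<gamma>\<close> is hidden in
        \<open>K\<close>.\<close>
      have "D powr \<gamma> * D powr (1 - \<gamma>) = D" using D by (simp add: powr_add[symmetric])
      then have "K * D powr (1 - \<gamma>) = S * D"
        unfolding K_def S_def D_def[symmetric] by (simp add: mult.assoc mult.left_commute)
      then have "C1 * (K * D powr (1 - \<gamma>)) / (lam * (1 - \<gamma>)) = C1 * (S * D) / (1 - \<gamma>) / lam"
        by (simp add: mult.commute)
      then show ?thesis unfolding S_def by (simp add: mult.commute mult.left_commute)
    qed
    finally have duh: "N \<alpha> (duh b t s) \<le> C1 * (C3 / (\<alpha>0 - lo) + C \<alpha>0) * D * (1 + N lo x) / (1 - \<gamma>) / lam"
      using constants K_pos by (simp add: mult_left_mono)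
    have "N \<alpha> (g s - g 0) \<le> C \<alpha>0 * \<bar>s - 0\<bar>"
      using st \<alpha> by (intro g_lipschitz) auto
    also have "\<dots> \<le> C \<alpha>0 * (D / lam)"
      using st constants lam_pos by (intro mult_left_mono) (auto simp: D_def field_simps)
    finally have gs: "N \<alpha> (g s - x) \<le> C \<alpha>0 * D / lam" by (simp add: g_0)
    have "(C \<alpha>0 * D + C1 * (C3 / (\<alpha>0 - lo) + C \<alpha>0) * D * (1 + N lo x) / (1 - \<gamma>)) / R < lam"
      using lam_bounds(3)[OF real] by (simp add: D_def)
    then have "(C \<alpha>0 * D + C1 * (C3 / (\<alpha>0 - lo) + C \<alpha>0) * D * (1 + N lo x) / (1 - \<gamma>)) / lam \<le> R"
      using R lam_pos by (simp add: pos_divide_less_eq pos_divide_le_eq mult.commute)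
    then have "C \<alpha>0 * D / lam + C1 * (C3 / (\<alpha>0 - lo) + C \<alpha>0) * D * (1 + N lo x) / (1 - \<gamma>) / lam \<le> R"
      by (simp only: add_divide_distrib)
    moreover have "N \<alpha> (g s + duh b t s - x) \<le> N \<alpha> (g s - x) + N \<alpha> (duh b t s)"
      using A.n_triangle[of "g s - x" "duh b t s"] in_V by (simp add: A.diff_in algebra_simps)
    ultimately have "N \<alpha> (g s + duh b t s - x) \<le> R" using duh gs by linarith
    then show ?thesis using real in_V by (simp add: scale_ball_def A.add_in)
  qed
qed

section \<open>The a-priori bound along the path\<close>

definition path_const where
  "path_const = 4 powr (1 - \<beta>) * C2 * C \<alpha>0 * (hi - \<alpha>0) powr (\<beta> + \<gamma>) + 2 powr (2 + \<gamma>) * C1 * C2 * K"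

text \<open>With \<open>\<rho>\<close> the room left at \<open>s'\<close>, \<open>b\<close> is read
  at \<open>\<alpha> - \<rho> / 2\<close>, the path at \<open>\<alpha> - \<rho> / 4\<close> and
  \<open>F\<close> at \<open>\<alpha>\<close>. The later endpoint is the binding one: levels fit for
  \<open>s'\<close> are fit for all earlier times. The first summand of \<open>path_const\<close>
  stems from \<open>g\<close>, the second from \<open>duh\<close>.\<close>

lemma F_path_increment:
  assumes st: "0 \<le> s" "s \<le> s'" "s' \<le> t" "t < T" "\<alpha>0 + lam * s' < \<alpha>" "\<alpha> \<le> hi"
    and \<tau>: "0 \<le> \<tau>" "\<tau> < T"
  shows "N \<alpha> (F \<tau> (g s' + duh b t s') - F \<tau> (g s + duh b t s))
    \<le> (s' - s) * (path_const * (\<alpha> - \<alpha>0 - lam * s') powr (- (1 + \<gamma>)))"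
proof -
  define \<rho> where "\<rho> = \<alpha> - \<alpha>0 - lam * s'"
  define \<alpha>' where "\<alpha>' = \<alpha> - \<rho> / 4"
  have s': "0 \<le> s'" using st by simp
  have mono: "lam * q \<le> lam * s'" if "q \<le> s'" for q using that lam_pos by simp
  have "0 \<le> lam * s'" using lam_pos s' by simp
  then have \<rho>: "0 < \<rho>" "\<rho> \<le> hi - \<alpha>0" using st by (auto simp: \<rho>_def)
  have \<alpha>': "\<alpha>0 + lam * s' < \<alpha>'" "\<alpha>' < \<alpha>" "\<alpha>' \<le> hi" using \<rho> st by (auto simp: \<alpha>'_def \<rho>_def field_simps)
  have lo: "\<alpha>0 < \<alpha>'" "lo < \<alpha>'" using level_gt[OF s' \<alpha>'(1)] \<alpha>0 by auto
  have s: "\<alpha>0 + lam * s < \<alpha>'" using \<alpha>'(1) mono[OF st(2)] by linarith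
  interpret A: banach_carrier "V \<alpha>'" "N \<alpha>'" using banach lo \<alpha>' by simp
  have in_V: "g s \<in> V \<alpha>'" "g s' \<in> V \<alpha>'" "duh b t s \<in> V \<alpha>'" "duh b t s' \<in> V \<alpha>'"
    using g_in lo \<alpha>' duh_in st s by auto
  \<comment> \<open>At earlier times \<open>q\<close> the room below
    \<open>\<alpha> - \<rho> / 2\<close> is at least \<open>\<rho> / 2\<close>, which makes the
    bound uniform on \<open>[s, s']\<close>.\<close>
  have quarter: "C1 / (\<alpha>' - (\<alpha> - \<rho> / 2)) powr \<beta> * (K * ((\<alpha> - \<rho> / 2) - \<alpha>0 - lam * q) powr (- \<gamma>))
      \<le> C1 / (\<rho> / 4) powr \<beta> * (K * (\<rho> / 2) powr (- \<gamma>))" if q: "q \<le> s'" for q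
  proof -
    have "\<rho> / 2 \<le> (\<alpha> - \<rho> / 2) - \<alpha>0 - lam * q" using mono[OF q] by (simp add: \<rho>_def field_simps)
    then have "((\<alpha> - \<rho> / 2) - \<alpha>0 - lam * q) powr (- \<gamma>) \<le> (\<rho> / 2) powr (- \<gamma>)"
      using \<rho> constants by (intro powr_mono2') auto
    moreover have eq: "\<alpha>' - (\<alpha> - \<rho> / 2) = \<rho> / 4" by (simp add: \<alpha>'_def)
    ultimately show ?thesis unfolding eq using constants K_pos by (intro mult_left_mono) auto
  qed
  have "N \<alpha>' (duh b t s' - duh b t s) \<le> C1 / (\<rho> / 4) powr \<beta> * (K * (\<rho> / 2) powr (- \<gamma>)) * (s' - s)"
  proof (rule duh_increment[OF st(1-4) \<alpha>'(1,3)])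
    fix q assume q: "q \<in> {s..s'}"
    have "\<alpha>0 + lam * q < \<alpha> - \<rho> / 2" using mono[of q] q \<rho> by (simp add: \<rho>_def field_simps)
    then show "N \<alpha>' (E t q (b q)) \<le> C1 / (\<rho> / 4) powr \<beta> * (K * (\<rho> / 2) powr (- \<gamma>))"
      using order.trans[OF Eb_bound_level[OF b, of q t "\<alpha> - \<rho> / 2" \<alpha>'] quarter[of q]] q st \<rho> \<alpha>'(3)
      by (simp add: \<alpha>'_def)
  qed
  moreover have "N \<alpha>' (g s' - g s) \<le> C \<alpha>0 * (s' - s)"
    using g_lipschitz[of s s' \<alpha>'] s' st s \<alpha>' by simp
  moreover have "N \<alpha>' ((g s' + duh b t s') - (g s + duh b t s)) \<le> N \<alpha>' (g s' - g s) + N \<alpha>' (duh b t s' - duh b t s)"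
    using A.n_triangle[of "g s' - g s" "duh b t s' - duh b t s"] in_V by (simp add: A.diff_in algebra_simps)
  ultimately have incr: "N \<alpha>' ((g s' + duh b t s') - (g s + duh b t s))
      \<le> (s' - s) * (C \<alpha>0 + C1 / (\<rho> / 4) powr \<beta> * (K * (\<rho> / 2) powr (- \<gamma>)))"
    by (simp add: algebra_simps)
  have "N \<alpha> (F \<tau> (g s' + duh b t s') - F \<tau> (g s + duh b t s))
      \<le> C2 / (\<alpha> - \<alpha>') powr (1 - \<beta>) * N \<alpha>' ((g s' + duh b t s') - (g s + duh b t s))"
    using \<tau> lo \<alpha>' st s by (intro F_lipschitz path_in_ball) auto
  also have "\<dots> \<le> C2 / (\<rho> / 4) powr (1 - \<beta>) *
      ((s' - s) * (C \<alpha>0 + C1 / (\<rho> / 4) powr \<beta> * (K * (\<rho> / 2) powr (- \<gamma>))))"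
  proof -
    have "\<alpha> - \<alpha>' = \<rho> / 4" by (simp add: \<alpha>'_def)
    then show ?thesis using constants by (simp only:) (intro mult_left_mono[OF incr], simp)
  qed
  also have "\<dots> = (s' - s) * (C2 * C \<alpha>0 / (\<rho> / 4) powr (1 - \<beta>)
      + C1 * C2 * K / ((\<rho> / 4) powr (1 - \<beta>) * (\<rho> / 4) powr \<beta>) * (\<rho> / 2) powr (- \<gamma>))"
  proof -
    have "C2 / p * (d * (c + C1 / q * (K * w))) = d * (C2 * c / p + C1 * C2 * K / (p * q) * w)"
      if "p > 0" "q > 0" for p q c d w :: real
      using that by (simp add: field_simps)
    then show ?thesis using \<rho> by simp
  qed
  also have "(\<rho> / 4) powr (1 - \<beta>) * (\<rho> / 4) powr \<beta> = \<rho> / 4"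
    using \<rho> by (simp add: powr_add[symmetric])
  also have "C1 * C2 * K / (\<rho> / 4) * (\<rho> / 2) powr (- \<gamma>) = 2 powr (2 + \<gamma>) * C1 * C2 * K * \<rho> powr (- (1 + \<gamma>))"
    using \<rho> by (simp add: powr_divide powr_add powr_minus powr_diff field_simps)
  also have "C2 * C \<alpha>0 / (\<rho> / 4) powr (1 - \<beta>)
      \<le> 4 powr (1 - \<beta>) * C2 * C \<alpha>0 * (hi - \<alpha>0) powr (\<beta> + \<gamma>) * \<rho> powr (- (1 + \<gamma>))"
  proof -
    \<comment> \<open>The singularity \<open>\<rho> powr (\<beta> - 1)\<close> is weaker than
      required; the surplus \<open>\<rho> powr (\<beta> + \<gamma>)\<close> is estimated by the full
      room \<open>hi - \<alpha>0\<close>, so that both summands share the exponent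
      \<open>-(1 + \<gamma>)\<close>.\<close>
    have "C2 * C \<alpha>0 / (\<rho> / 4) powr (1 - \<beta>) = 4 powr (1 - \<beta>) * C2 * C \<alpha>0 * (\<rho> powr (\<beta> + \<gamma>) * \<rho> powr (- (1 + \<gamma>)))"
      using \<rho> by (simp add: powr_divide powr_add[symmetric] powr_diff powr_minus field_simps)
    also have "\<dots> \<le> 4 powr (1 - \<beta>) * C2 * C \<alpha>0 * ((hi - \<alpha>0) powr (\<beta> + \<gamma>) * \<rho> powr (- (1 + \<gamma>)))"
      using \<rho> constants by (intro mult_left_mono mult_right_mono powr_mono2) auto
    finally show ?thesis by (simp add: mult.assoc)
  qed
  finally show ?thesis
    using st by (simp add: path_const_def \<rho>_def[symmetric] distrib_right mult_left_mono)
qed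

text \<open>After division by \<open>\<gamma>\<close> the coefficients are the two summands of the
  third number in \<open>lambda0\<close>, multiplied by \<open>c\<close> and by \<open>K\<close>.
  Here \<open>c\<close> is the part of \<open>K\<close> that comes from \<open>C \<alpha>0\<close>,
  which explains the denominator \<open>1 + N lo x\<close>.\<close>

lemma path_const_bound: "path_const / (lam * \<gamma>) \<le> K"
proof -
  define c where "c = C \<alpha>0 * (hi - \<alpha>0) powr \<gamma> * (1 + N lo x)"
  have nx: "0 < 1 + N lo x" using N_x_nonneg by simp
  have cK: "c \<le> K"
    unfolding c_def K_def using constants \<alpha>0 nx by (intro mult_right_mono) auto
  have "path_const / \<gamma> = 4 powr (1 - \<beta>) * C2 * (hi - \<alpha>0) powr \<beta> / (\<gamma> * (1 + N lo x)) * c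
      + 2 powr (2 + \<gamma>) * C1 * C2 / \<gamma> * K"
  proof -
    define m where "m = 1 + N lo x"
    have "m \<noteq> 0" "\<gamma> \<noteq> 0" using nx constants by (auto simp: m_def)
    then show ?thesis unfolding path_const_def c_def m_def[symmetric] powr_add by (simp add: field_simps)
  qed
  also have "\<dots> \<le> 4 powr (1 - \<beta>) * C2 * (hi - \<alpha>0) powr \<beta> / (\<gamma> * (1 + N lo x)) * K
      + 2 powr (2 + \<gamma>) * C1 * C2 / \<gamma> * K"
    using cK nx constants by (intro add_right_mono mult_left_mono) auto
  also have "\<dots> = (4 powr (1 - \<beta>) * C2 * (hi - \<alpha>0) powr \<beta> / (\<gamma> * (1 + N lo x))
      + 2 powr (2 + \<gamma>) * C1 * C2 / \<gamma>) * K" by (simp only: distrib_right)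
  also have "\<dots> \<le> lam * K" using lam_bounds(2) K_pos by (intro mult_right_mono) auto
  finally show ?thesis using lam_pos constants by (simp add: field_simps)
qed

text \<open>Integration along the path yields \<open>K\<close> times the difference of
  \<open>powr - \<gamma>\<close> at the times \<open>t\<close> and 0. The negative part is kept,
  since it is exactly the allowance for \<open>F \<tau> x\<close> obtained from B3; the two bounds
  add up to \<open>K\<close> without loss.\<close>

lemma F_sol_bound:
  assumes t: "0 \<le> t" "\<alpha>0 + lam * t < \<alpha>" "\<alpha> \<le> hi" and \<tau>: "0 \<le> \<tau>" "\<tau> < T"
  shows "N \<alpha> (F \<tau> (sol b t)) \<le> K * (\<alpha> - \<alpha>0 - lam * t) powr (- \<gamma>)"
proof -
  have \<alpha>: "\<alpha>0 < \<alpha>" using level_gt t by blast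
  have tT: "t < T" using time_le(2)[of t \<alpha>] t by simp
  interpret A: banach_carrier "V \<alpha>" "N \<alpha>" using banach \<alpha> \<alpha>0 t by simp
  define z where "z s = g s + duh b t s" for s
  have mono: "\<alpha>0 + lam * s < \<alpha>" if "s \<le> t" for s
    using t(2) mult_left_mono[OF that, of lam] lam_pos by linarith
  have z0: "z 0 = x" using duh_0[OF t(1) tT] by (simp add: z_def g_0)
  have Fz: "F \<tau> (z s) \<in> V \<alpha>" if s: "0 \<le> s" "s \<le> t" for s
  proof -
    obtain \<alpha>' where \<alpha>': "\<alpha>0 + lam * s < \<alpha>'" "\<alpha>' < \<alpha>" using dense[OF mono[OF s(2)]] by blast
    then have "lo \<le> \<alpha>'" using level_gt[OF s(1)] \<alpha>0 by fastforce
    then show ?thesis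
      unfolding z_def using s tT \<tau> \<alpha>' t by (intro F_in[of \<tau> \<alpha>' \<alpha>] path_in_ball) auto
  qed
  \<comment> \<open>The distance of \<open>F \<tau> (z s)\<close> from its initial value is a real
    function of \<open>s\<close> whose increments inherit the bound by the triangle
    inequality.\<close>
  have "N \<alpha> (F \<tau> (z t) - F \<tau> (z 0)) - N \<alpha> (F \<tau> (z 0) - F \<tau> (z 0))
      \<le> path_const / (lam * \<gamma>) * (\<alpha> - \<alpha>0 - lam * t) powr (- \<gamma>)
        - path_const / (lam * \<gamma>) * (\<alpha> - \<alpha>0 - lam * 0) powr (- \<gamma>)"
  proof (rule increment_le_primitive[where k = "\<lambda>s. path_const * (\<alpha> - \<alpha>0 - lam * s) powr (- (1 + \<gamma>))"])
    fix s s' assume s: "0 \<le> s" "s \<le> s'" "s' \<le> t"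
    have "N \<alpha> (F \<tau> (z s') - F \<tau> (z s)) \<le> (s' - s) * (path_const * (\<alpha> - \<alpha>0 - lam * s') powr (- (1 + \<gamma>)))"
      unfolding z_def using s tT mono t \<tau> by (intro F_path_increment) auto
    moreover have "N \<alpha> (F \<tau> (z s') - F \<tau> (z 0))
        \<le> N \<alpha> (F \<tau> (z s') - F \<tau> (z s)) + N \<alpha> (F \<tau> (z s) - F \<tau> (z 0))"
      using s by (intro A.triangle_diff Fz) auto
    ultimately show "N \<alpha> (F \<tau> (z s') - F \<tau> (z 0)) - N \<alpha> (F \<tau> (z s) - F \<tau> (z 0))
        \<le> (s' - s) * (path_const * (\<alpha> - \<alpha>0 - lam * s') powr (- (1 + \<gamma>)))" by linarith
  next
    show "continuous_on {0..t} (\<lambda>s. path_const * (\<alpha> - \<alpha>0 - lam * s) powr (- (1 + \<gamma>)))"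
    proof (intro continuous_intros ballI)
      fix s assume "s \<in> {0..t}"
      then show "\<alpha> - \<alpha>0 - lam * s \<noteq> 0" using mono[of s] by simp
    qed
  next
    fix s assume "s \<in> {0..t}"
    then have "0 < \<alpha> - \<alpha>0 - lam * s" using mono[of s] by simp
    then have "((\<lambda>s. path_const / (lam * \<gamma>) * (\<alpha> - \<alpha>0 - lam * s) powr (- \<gamma>)) has_real_derivative
        path_const / (lam * \<gamma>) * (- \<gamma> * (\<alpha> - \<alpha>0 - lam * s) powr (- \<gamma> - 1) * (- lam))) (at s)"
      by (auto intro!: derivative_eq_intros)
    also have "path_const / (lam * \<gamma>) * (- \<gamma> * (\<alpha> - \<alpha>0 - lam * s) powr (- \<gamma> - 1) * (- lam))
        = path_const * (\<alpha> - \<alpha>0 - lam * s) powr (- (1 + \<gamma>))"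
    proof -
      have "- \<gamma> - 1 = - (1 + \<gamma>)" by simp
      then show ?thesis using lam_pos constants by (simp only:) simp
    qed
    finally show "((\<lambda>s. path_const / (lam * \<gamma>) * (\<alpha> - \<alpha>0 - lam * s) powr (- \<gamma>)) has_real_derivative
        path_const * (\<alpha> - \<alpha>0 - lam * s) powr (- (1 + \<gamma>))) (at s)" .
  qed (fact t)
  then have "N \<alpha> (F \<tau> (z t) - F \<tau> x)
      \<le> path_const / (lam * \<gamma>) * ((\<alpha> - \<alpha>0 - lam * t) powr (- \<gamma>) - (\<alpha> - \<alpha>0) powr (- \<gamma>))"
    by (simp add: z0 A.n_zero right_diff_distrib)
  also have "\<dots> \<le> K * ((\<alpha> - \<alpha>0 - lam * t) powr (- \<gamma>) - (\<alpha> - \<alpha>0) powr (- \<gamma>))"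
  proof (rule mult_right_mono[OF path_const_bound])
    have "0 \<le> lam * t" using lam_pos t by simp
    then show "0 \<le> (\<alpha> - \<alpha>0 - lam * t) powr (- \<gamma>) - (\<alpha> - \<alpha>0) powr (- \<gamma>)"
      using powr_mono2'[of "- \<gamma>" "\<alpha> - \<alpha>0 - lam * t" "\<alpha> - \<alpha>0"] constants t by simp
  qed
  finally have "N \<alpha> (F \<tau> (z t) - F \<tau> x) \<le> K * ((\<alpha> - \<alpha>0 - lam * t) powr (- \<gamma>) - (\<alpha> - \<alpha>0) powr (- \<gamma>))" .
  moreover have "N \<alpha> (F \<tau> x) \<le> K * (\<alpha> - \<alpha>0) powr (- \<gamma>)"
  proof -
    have "N \<alpha> (B \<tau> lo \<alpha> x) \<le> C3 / (\<alpha> - lo)"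
      using B3 \<tau> \<alpha> \<alpha>0 t unfolding cond_B3_def by auto
    then have "N \<alpha> (F \<tau> x) \<le> C3 / (\<alpha> - lo)"
      using F_eq[OF \<tau> order_refl, of \<alpha> x] \<alpha> \<alpha>0 t x_in_ball[of lo] by simp
    also have "\<dots> \<le> C3 / (\<alpha>0 - lo)" using \<alpha> \<alpha>0 constants by (intro divide_left_mono) auto
    also have "C3 / (\<alpha>0 - lo) \<le> C3 / (\<alpha>0 - lo) + C \<alpha>0" using constants by simp
    also have "\<dots> \<le> (C3 / (\<alpha>0 - lo) + C \<alpha>0) * (1 + N lo x)"
      using mult_left_mono[of 1 "1 + N lo x" "C3 / (\<alpha>0 - lo) + C \<alpha>0"] constants \<alpha>0 N_x_nonneg by simp
    also have "\<dots> = K * (hi - \<alpha>0) powr (- \<gamma>)"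
    proof -
      have "(hi - \<alpha>0) powr \<gamma> * (hi - \<alpha>0) powr (- \<gamma>) = 1" using \<alpha>0 by (simp add: powr_add[symmetric])
      then show ?thesis unfolding K_def by (simp add: mult.assoc mult.left_commute)
    qed
    also have "\<dots> \<le> K * (\<alpha> - \<alpha>0) powr (- \<gamma>)"
      using K_pos \<alpha> t constants by (intro mult_left_mono powr_mono2') auto
    finally show ?thesis .
  qed
  moreover have "N \<alpha> (F \<tau> (z t)) \<le> N \<alpha> (F \<tau> (z t) - F \<tau> x) + N \<alpha> (F \<tau> x)"
    using A.norm_le_diff Fz[of t] Fz[of 0] t z0 by simp
  ultimately show ?thesis by (simp add: z_def sol_def right_diff_distrib)
qed

end

section \<open>Continuity of \<open>sol b\<close> and invariance of the admissible class\<close>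

lemma sol_in_ball:
  assumes "admissible b" "0 \<le> t" "\<alpha>0 + lam * t < \<alpha>" "\<alpha> \<le> hi"
  shows "sol b t \<in> xball \<alpha>"
  unfolding sol_def using assms time_le(2)[of t \<alpha>] by (intro path_in_ball) auto

lemma xball_subset: "u \<in> xball \<alpha> \<Longrightarrow> u \<in> V \<alpha>"
  by (simp add: scale_ball_def)

text \<open>For \<open>u \<le> v\<close> the increment consists of that of \<open>g\<close>, the
  integral over \<open>[u, v]\<close>, and the integral over \<open>[0, u]\<close> of the change
  caused by the final time. The last one has no Lipschitz bound and is handled by uniform
  continuity.\<close>

lemma sol_continuous:
  assumes b: "admissible b" and \<alpha>: "\<alpha>0 < \<alpha>" "\<alpha> \<le> hi"
  shows "continuous_map (top_of_set {s. 0 \<le> s \<and> \<alpha>0 + lam * s < \<alpha>}) (norm_topology (V \<alpha>) (N \<alpha>)) (sol b)"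
proof (rule continuous_localI[OF \<alpha>])
  fix \<alpha>' assume \<alpha>': "\<alpha>0 < \<alpha>'" "\<alpha>' < \<alpha>"
  interpret A: banach_carrier "V \<alpha>" "N \<alpha>" using banach \<alpha> \<alpha>0 by simp
  define t1 where "t1 = (\<alpha>' - \<alpha>0) / lam"
  have t1: "0 < t1" "\<alpha>0 + lam * t1 = \<alpha>'" using \<alpha>' lam_pos by (auto simp: t1_def)
  have t1T: "t1 < T" using time_le(2)[of t1 \<alpha>'] t1 \<alpha>' \<alpha> by simp
  have level: "\<alpha>0 + lam * s < \<alpha>" if "s \<le> t1" for s
    using t1(2) \<alpha>'(2) mult_left_mono[OF that, of lam] lam_pos by linarith
  \<comment> \<open>A compact triangle on which the integrand is continuous at level
    \<open>\<alpha>\<close> up to and including \<open>t1\<close>, because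
    \<open>\<alpha>' < \<alpha>\<close>.\<close>
  define \<Delta> where "\<Delta> = {(t, s). 0 \<le> s \<and> s \<le> t \<and> t \<le> t1}"
  have "\<Delta> = ({0..t1} \<times> {0..t1}) \<inter> {p. snd p \<le> fst p}" by (auto simp: \<Delta>_def)
  moreover have "closed {p :: real \<times> real. snd p \<le> fst p}"
    by (intro closed_Collect_le continuous_intros)
  ultimately have \<Delta>: "compact \<Delta>" by (simp add: compact_Times compact_Int_closed)
  have cont: "continuous_map (top_of_set \<Delta>) (norm_topology (V \<alpha>) (N \<alpha>)) (\<lambda>(t, s). E t s (b s))"
    by (rule continuous_map_from_subtopology_mono[OF Eb_continuous[OF b \<alpha>]])
      (use level t1T in \<open>auto simp: \<Delta>_def\<close>)
  define M where "M = C1 * K * ((\<alpha> - \<alpha>') / 2) powr (- (\<beta> + \<gamma>))"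
  have M_nonneg: "0 \<le> M" using constants K_pos by (simp add: M_def)
  have M: "N \<alpha> (E t s (b s)) \<le> M" if s: "0 \<le> s" "s \<le> t" "t \<le> t1" for t s
  proof -
    have "lam * s \<le> lam * t1" using s lam_pos by simp
    then have "\<alpha> - \<alpha>' \<le> \<alpha> - \<alpha>0 - lam * s" using t1 by simp
    then have "((\<alpha> - \<alpha>0 - lam * s) / 2) powr (- (\<beta> + \<gamma>)) \<le> ((\<alpha> - \<alpha>') / 2) powr (- (\<beta> + \<gamma>))"
      using \<alpha>' constants by (intro powr_mono2') auto
    then show ?thesis
      using order.trans[OF Eb_bound[OF b, of s t \<alpha>]] s t1T level \<alpha> constants K_pos
      by (simp add: M_def mult_left_mono)
  qed
  have step: "N \<alpha> (sol b v - sol b u) \<le> C \<alpha>0 * (v - u) + (M * (v - u) + e * t1)"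
    if uv: "0 \<le> u" "u \<le> v" "v \<le> t1" and e: "0 \<le> e"
      and close: "\<And>q. 0 \<le> q \<Longrightarrow> q \<le> u \<Longrightarrow> N \<alpha> (E v q (b q) - E u q (b q)) \<le> e" for u v e
  proof -
    have in_V: "duh b v v \<in> V \<alpha>" "duh b v u \<in> V \<alpha>" "duh b u u \<in> V \<alpha>" "g u \<in> V \<alpha>" "g v \<in> V \<alpha>"
      using duh_in[OF b] g_in uv t1T level \<alpha> \<alpha>0 by auto
    have "N \<alpha> (duh b v v - duh b v u) \<le> M * (v - u)"
      using uv t1T level \<alpha> M by (intro duh_increment[OF b]) auto
    moreover have "N \<alpha> (duh b v u - duh b u u) \<le> e * t1"
    proof -
      have "N \<alpha> (duh b v u - duh b u u) \<le> (u - 0) *\<^sub>R e"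
      proof (rule A.has_riemann_integral_bound)
        show "has_riemann_integral_on (V \<alpha>) (N \<alpha>) (\<lambda>q. E v q (b q) - E u q (b q)) (duh b v u - duh b u u) 0 u"
          using uv t1T level \<alpha> by (intro A.has_riemann_integral_diff duh_integral[OF b]) auto
        show "((\<lambda>q. e) has_integral (u - 0) *\<^sub>R e) {0..u}"
          using has_integral_const_real[of e 0 u] uv by simp
      qed (use close in auto)
      also have "\<dots> \<le> e * t1" using uv e by (simp add: mult.commute mult_left_mono)
      finally show ?thesis .
    qed
    moreover have "N \<alpha> (duh b v v - duh b u u) \<le> N \<alpha> (duh b v v - duh b v u) + N \<alpha> (duh b v u - duh b u u)"
      using in_V by (intro A.triangle_diff)
    moreover have "N \<alpha> (g v - g u) \<le> C \<alpha>0 * (v - u)"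
      using g_lipschitz[of u v \<alpha>] uv level[of u] level[of v] \<alpha> by simp
    moreover have "N \<alpha> (sol b v - sol b u) \<le> N \<alpha> (g v - g u) + N \<alpha> (duh b v v - duh b u u)"
      using A.n_triangle[of "g v - g u" "duh b v v - duh b u u"] in_V
      by (simp add: sol_def A.diff_in algebra_simps)
    ultimately show ?thesis by linarith
  qed
  have in_V: "sol b t \<in> V \<alpha>" if "0 \<le> t" "t \<le> t1" for t
    using sol_in_ball[OF b, of t \<alpha>] that level \<alpha> xball_subset by blast
  have set: "{s. 0 \<le> s \<and> \<alpha>0 + lam * s < \<alpha>'} \<subseteq> {0..t1}"
    using lam_pos by (auto simp: t1_def field_simps)
  show "continuous_map (top_of_set {s. 0 \<le> s \<and> \<alpha>0 + lam * s < \<alpha>'}) (norm_topology (V \<alpha>) (N \<alpha>)) (sol b)"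
  proof (rule continuous_map_from_subtopology_mono[OF _ set])
    have "\<exists>d>0. \<forall>y\<in>{0..t1}. dist y a < d \<longrightarrow> N \<alpha> (sol b y - sol b a) < e"
      if a: "a \<in> {0..t1}" and e: "e > 0" for a e
    proof -
      have e': "e / 2 / (t1 + 1) > 0" using e t1 by simp
      obtain d where d: "d > 0" "\<And>y z. y \<in> \<Delta> \<Longrightarrow> z \<in> \<Delta> \<Longrightarrow> dist y z < d
          \<Longrightarrow> N \<alpha> ((\<lambda>(t, s). E t s (b s)) y - (\<lambda>(t, s). E t s (b s)) z) < e / 2 / (t1 + 1)"
        using A.uniformly_continuous_compact[OF \<Delta> cont e'] by blast
      \<comment> \<open>\<open>d\<close> keeps the change of the integrand small enough for a
        contribution of at most \<open>e / 2\<close>; the second bound leaves less than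
        \<open>e / 2\<close> to the Lipschitz terms.\<close>
      define d' where "d' = min d (e / 2 / (C \<alpha>0 + M + 1))"
      have CM: "0 < C \<alpha>0 + M + 1" using constants M_nonneg by simp
      have small: "N \<alpha> (sol b v - sol b u) < e" if uv: "0 \<le> u" "u \<le> v" "v \<le> t1" "v - u < d'" for u v
      proof -
        have "N \<alpha> (E v q (b q) - E u q (b q)) \<le> e / 2 / (t1 + 1)" if "0 \<le> q" "q \<le> u" for q
        proof -
          have "dist (v, q) (u, q) < d" using uv by (simp add: dist_Pair_Pair dist_real_def d'_def)
          then show ?thesis using d(2)[of "(v, q)" "(u, q)"] that uv by (simp add: \<Delta>_def)
        qed
        then have "N \<alpha> (sol b v - sol b u) \<le> C \<alpha>0 * (v - u) + (M * (v - u) + e / 2 / (t1 + 1) * t1)"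
          using uv e' by (intro step) auto
        also have "\<dots> \<le> (C \<alpha>0 + M + 1) * (v - u) + e / 2 / (t1 + 1) * t1"
          using uv by (simp add: algebra_simps)
        also have "(C \<alpha>0 + M + 1) * (v - u) < e / 2"
        proof -
          have "v - u < e / 2 / (C \<alpha>0 + M + 1)" using uv(4) by (simp add: d'_def)
          then show ?thesis unfolding pos_less_divide_eq[OF CM] by (simp only: mult.commute)
        qed
        also have "e / 2 / (t1 + 1) * t1 \<le> e / 2" using e t1 by (simp add: field_simps)
        finally show ?thesis by simp
      qed
      have "N \<alpha> (sol b y - sol b a) < e" if "y \<in> {0..t1}" "dist y a < d'" for y
      proof (cases "a \<le> y")
        case True
        then show ?thesis using small[of a y] that a by (simp add: dist_real_def)
      next
        case False
        then show ?thesis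
          using small[of y a] A.n_commute[of "sol b y" "sol b a"] in_V that a by (simp add: dist_real_def)
      qed
      moreover have "d' > 0" using d(1) e CM by (simp add: d'_def)
      ultimately show ?thesis by blast
    qed
    then show "continuous_map (top_of_set {0..t1}) (norm_topology (V \<alpha>) (N \<alpha>)) (sol b)"
      unfolding A.continuous_map_norm_topology_iff using in_V by fastforce
  qed
qed

text \<open>Applying \<open>F\<close> costs a level: continuity of \<open>u\<close> at
  \<open>\<alpha>'\<close> gives that of \<open>F s (u s)\<close> at \<open>\<alpha>\<close>.
  Localisation recovers the full lifetime of \<open>\<alpha>\<close>.\<close>

lemma admissible_F:
  assumes cont: "\<And>\<alpha>. \<alpha>0 < \<alpha> \<Longrightarrow> \<alpha> \<le> hi \<Longrightarrow>
      continuous_map (top_of_set {s. 0 \<le> s \<and> \<alpha>0 + lam * s < \<alpha>}) (norm_topology (V \<alpha>) (N \<alpha>)) u"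
    and ball: "\<And>s \<alpha>. 0 \<le> s \<Longrightarrow> \<alpha>0 + lam * s < \<alpha> \<Longrightarrow> \<alpha> \<le> hi \<Longrightarrow> u s \<in> xball \<alpha>"
    and bound: "\<And>s \<alpha>. 0 \<le> s \<Longrightarrow> \<alpha>0 + lam * s < \<alpha> \<Longrightarrow> \<alpha> \<le> hi \<Longrightarrow>
      N \<alpha> (F s (u s)) \<le> K * (\<alpha> - \<alpha>0 - lam * s) powr (- \<gamma>)"
  shows "admissible (\<lambda>s. F s (u s))"
  unfolding admissible_def
proof (intro allI impI conjI; (elim conjE)?)
  fix \<alpha> assume \<alpha>: "\<alpha>0 < \<alpha>" "\<alpha> \<le> hi"
  show "continuous_map (top_of_set {s. 0 \<le> s \<and> \<alpha>0 + lam * s < \<alpha>}) (norm_topology (V \<alpha>) (N \<alpha>)) (\<lambda>s. F s (u s))"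
  proof (rule continuous_localI[OF \<alpha>])
    fix \<alpha>' assume \<alpha>': "\<alpha>0 < \<alpha>'" "\<alpha>' < \<alpha>"
    show "continuous_map (top_of_set {s. 0 \<le> s \<and> \<alpha>0 + lam * s < \<alpha>'}) (norm_topology (V \<alpha>) (N \<alpha>)) (\<lambda>s. F s (u s))"
      using \<alpha>' \<alpha> \<alpha>0 cont[of \<alpha>'] ball time_le(2)[of _ \<alpha>']
      by (intro F_continuous[of \<alpha>']) auto
  qed
qed (use bound in auto)

lemma admissible_step: "admissible b \<Longrightarrow> admissible (\<lambda>s. F s (sol b s))"
  using time_le(2)[OF less_imp_le] by (intro admissible_F sol_continuous sol_in_ball F_sol_bound) auto

section \<open>Contraction in the weighted norms\<close>

definition q where "q = 2 powr (2 + \<gamma>) * C1 * C2 / (lam * \<gamma>)"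

lemma q: "0 \<le> q" "q < 1"
proof -
  show "0 \<le> q" using constants lam_pos by (simp add: q_def)
  have "0 \<le> 4 powr (1 - \<beta>) * C2 * (hi - \<alpha>0) powr \<beta> / (\<gamma> * (1 + N lo x))"
    using constants N_x_nonneg by simp
  then have "2 powr (2 + \<gamma>) * C1 * C2 / \<gamma> < lam" using lam_bounds(2) by linarith
  then show "q < 1" using lam_pos constants by (simp add: q_def field_simps)
qed

text \<open>The free evolution cancels and the remaining integrand is majorised by the power
  \<open>-(1 + \<gamma>)\<close>, whose integral costs a factor
  \<open>1 / (lam * \<gamma>)\<close>.\<close>

lemma sol_diff_bound:
  assumes b: "admissible b" "admissible b'" and t: "0 \<le> t" "\<alpha>0 + lam * t < \<alpha>" "\<alpha> \<le> hi" and m: "0 \<le> m"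
    and le: "\<And>s. 0 \<le> s \<Longrightarrow> s \<le> t \<Longrightarrow>
      N \<alpha> (E t s (b s) - E t s (b' s)) \<le> m * (\<alpha> - \<alpha>0 - lam * s) powr (- (1 + \<gamma>))"
  shows "N \<alpha> (sol b t - sol b' t) \<le> m / (lam * \<gamma>) * (\<alpha> - \<alpha>0 - lam * t) powr (- \<gamma>)"
proof -
  have \<alpha>: "\<alpha>0 < \<alpha>" using level_gt t by blast
  have tT: "t < T" using time_le(2)[of t \<alpha>] t by simp
  interpret A: banach_carrier "V \<alpha>" "N \<alpha>" using banach \<alpha> \<alpha>0 t by simp
  have "N \<alpha> (duh b t t - duh b' t t)
      \<le> m * (((\<alpha> - \<alpha>0 - lam * t) powr (1 - (1 + \<gamma>)) - (\<alpha> - \<alpha>0) powr (1 - (1 + \<gamma>))) / (lam * (1 + \<gamma> - 1)))"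
  proof (rule A.has_riemann_integral_bound)
    show "has_riemann_integral_on (V \<alpha>) (N \<alpha>) (\<lambda>s. E t s (b s) - E t s (b' s)) (duh b t t - duh b' t t) 0 t"
      using t tT by (intro A.has_riemann_integral_diff duh_integral b) auto
    show "((\<lambda>s. m * (\<alpha> - \<alpha>0 - lam * s) powr (- (1 + \<gamma>))) has_integral
        m * (((\<alpha> - \<alpha>0 - lam * t) powr (1 - (1 + \<gamma>)) - (\<alpha> - \<alpha>0) powr (1 - (1 + \<gamma>))) / (lam * (1 + \<gamma> - 1)))) {0..t}"
      using lam_pos t constants by (intro has_integral_mult_right has_integral_powr_affine) auto
  qed (use le in auto)
  also have "\<dots> = m / (lam * \<gamma>) * ((\<alpha> - \<alpha>0 - lam * t) powr (- \<gamma>) - (\<alpha> - \<alpha>0) powr (- \<gamma>))" by simp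
  also have "\<dots> \<le> m / (lam * \<gamma>) * (\<alpha> - \<alpha>0 - lam * t) powr (- \<gamma>)"
    using m lam_pos constants by (intro mult_left_mono) auto
  finally show ?thesis by (simp add: sol_def)
qed

lemma contraction:
  assumes b: "admissible (\<lambda>s. F s (u s))" "admissible (\<lambda>s. F s (v s))"
    and ball: "\<And>s \<alpha>. 0 \<le> s \<Longrightarrow> \<alpha>0 + lam * s < \<alpha> \<Longrightarrow> \<alpha> \<le> hi \<Longrightarrow> u s \<in> xball \<alpha> \<and> v s \<in> xball \<alpha>"
    and m: "0 \<le> m" "\<And>s \<alpha>. 0 \<le> s \<Longrightarrow> \<alpha>0 + lam * s < \<alpha> \<Longrightarrow> \<alpha> \<le> hi \<Longrightarrow>
      N \<alpha> (u s - v s) \<le> m * (\<alpha> - \<alpha>0 - lam * s) powr (- \<gamma>)"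
    and t: "0 \<le> t" "\<alpha>0 + lam * t < \<alpha>" "\<alpha> \<le> hi"
  shows "N \<alpha> (sol (\<lambda>s. F s (u s)) t - sol (\<lambda>s. F s (v s)) t) \<le> q * m * (\<alpha> - \<alpha>0 - lam * t) powr (- \<gamma>)"
proof -
  have tT: "t < T" using time_le(2)[of t \<alpha>] t by simp
  have "N \<alpha> (E t s (F s (u s)) - E t s (F s (v s)))
      \<le> 2 powr (2 + \<gamma>) * C1 * C2 * m * (\<alpha> - \<alpha>0 - lam * s) powr (- (1 + \<gamma>))" if s: "0 \<le> s" "s \<le> t" for s
  proof -
    have "lam * s \<le> lam * t" using s lam_pos by simp
    then have level: "\<alpha>0 + lam * s < \<alpha>" using t by simp
    define \<rho> where "\<rho> = \<alpha> - \<alpha>0 - lam * s"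
    \<comment> \<open>\<open>u - v\<close> is measured at \<open>\<alpha>1\<close>, its image under
      \<open>F\<close> at \<open>\<alpha>2\<close>, and the result of \<open>U\<close> at
      \<open>\<alpha>\<close>. Equal gaps let the powers \<open>\<beta>\<close> and
      \<open>1 - \<beta>\<close> combine.\<close>
    define \<alpha>1 where "\<alpha>1 = \<alpha> - \<rho> / 2"
    define \<alpha>2 where "\<alpha>2 = \<alpha> - \<rho> / 4"
    have \<rho>: "0 < \<rho>" using level by (simp add: \<rho>_def)
    have \<alpha>12: "\<alpha>0 + lam * s < \<alpha>1" "\<alpha>1 < \<alpha>2" "\<alpha>2 < \<alpha>" "\<alpha>1 < hi" "\<alpha>2 < hi"
      using \<rho> t by (auto simp: \<alpha>1_def \<alpha>2_def \<rho>_def field_simps)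
    then have lo: "lo \<le> \<alpha>1" "lo \<le> \<alpha>2" using level_gt[OF s(1)] \<alpha>0 by fastforce+
    have gaps: "\<alpha> - \<alpha>2 = \<rho> / 4" "\<alpha>2 - \<alpha>1 = \<rho> / 4" "\<alpha>1 - \<alpha>0 - lam * s = \<rho> / 2"
      by (auto simp: \<alpha>1_def \<alpha>2_def \<rho>_def field_simps)
    interpret A2: banach_carrier "V \<alpha>2" "N \<alpha>2" using banach lo \<alpha>12 by simp
    have sT: "s < T" using s tT by simp
    have FV: "F s (u s) \<in> V \<alpha>2" "F s (v s) \<in> V \<alpha>2"
      using F_in[OF s(1) sT lo(1) \<alpha>12(2)] ball[OF s(1) \<alpha>12(1)] \<alpha>12 by auto
    have "N \<alpha> (E t s (F s (u s)) - E t s (F s (v s))) = N \<alpha> (E t s (F s (u s) - F s (v s)))"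
      using E_diff[OF s tT lo(2) \<alpha>12(5) FV] by simp
    also have "\<dots> \<le> C1 / (\<alpha> - \<alpha>2) powr \<beta> * N \<alpha>2 (F s (u s) - F s (v s))"
      using E_norm[OF s tT lo(2) \<alpha>12(3) t(3)] FV A2.diff_in by blast
    also have "\<dots> \<le> C1 / (\<alpha> - \<alpha>2) powr \<beta> * (C2 / (\<alpha>2 - \<alpha>1) powr (1 - \<beta>) * N \<alpha>1 (u s - v s))"
      using F_lipschitz[OF s(1) sT lo(1) \<alpha>12(2)] ball[OF s(1) \<alpha>12(1)] \<alpha>12 constants
      by (intro mult_left_mono) auto
    also have "\<dots> \<le> C1 / (\<alpha> - \<alpha>2) powr \<beta> * (C2 / (\<alpha>2 - \<alpha>1) powr (1 - \<beta>) * (m * (\<alpha>1 - \<alpha>0 - lam * s) powr (- \<gamma>)))"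
      using m(2)[OF s(1) \<alpha>12(1)] \<alpha>12 constants by (intro mult_left_mono) auto
    also have "\<dots> = C1 * C2 * m / ((\<rho> / 4) powr \<beta> * (\<rho> / 4) powr (1 - \<beta>)) * (\<rho> / 2) powr (- \<gamma>)"
      unfolding gaps by simp
    also have "(\<rho> / 4) powr \<beta> * (\<rho> / 4) powr (1 - \<beta>) = \<rho> / 4"
      using \<rho> by (simp add: powr_add[symmetric])
    also have "C1 * C2 * m / (\<rho> / 4) * (\<rho> / 2) powr (- \<gamma>) = 2 powr (2 + \<gamma>) * C1 * C2 * m * \<rho> powr (- (1 + \<gamma>))"
      using \<rho> by (simp add: powr_divide powr_add powr_minus powr_diff field_simps)
    finally show ?thesis by (simp add: \<rho>_def)
  qed
  then have "N \<alpha> (sol (\<lambda>s. F s (u s)) t - sol (\<lambda>s. F s (v s)) t)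
      \<le> 2 powr (2 + \<gamma>) * C1 * C2 * m / (lam * \<gamma>) * (\<alpha> - \<alpha>0 - lam * t) powr (- \<gamma>)"
    using b t m constants by (intro sol_diff_bound) auto
  then show ?thesis by (simp add: q_def)
qed

text \<open>The weighted size of the first Picard step. The integrand has only the singularity
  \<open>-(\<beta> + \<gamma>)\<close>; it is worsened to \<open>-(1 + \<gamma>)\<close>, at the
  cost of \<open>(hi - \<alpha>0) powr (1 - \<beta>)\<close>, in order to use
  \<open>sol_diff_bound\<close> again.\<close>

definition M0 where "M0 = C1 * K * 2 powr (\<beta> + \<gamma>) * (hi - \<alpha>0) powr (1 - \<beta>) / (lam * \<gamma>)"

lemma M0_nonneg: "0 \<le> M0"
  using constants K_pos lam_pos by (simp add: M0_def)

lemma E_zero: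
  assumes "0 \<le> s" "s \<le> t" "t < T"
  shows "E t s 0 = 0"
proof -
  interpret banach_carrier "V lo" "N lo" using banach \<alpha>0 by simp
  show ?thesis using E_diff[OF assms, of lo 0 0] \<alpha>0 zero_in by simp
qed

lemma sol_zero_diff:
  assumes b: "admissible b" and t: "0 \<le> t" "\<alpha>0 + lam * t < \<alpha>" "\<alpha> \<le> hi"
  shows "N \<alpha> (sol b t - sol (\<lambda>_. 0) t) \<le> M0 * (\<alpha> - \<alpha>0 - lam * t) powr (- \<gamma>)"
proof -
  have tT: "t < T" using time_le(2)[of t \<alpha>] t by simp
  have \<beta>1: "\<beta> < 1" using \<gamma> constants by simp
  have "N \<alpha> (E t s (b s) - E t s 0)
      \<le> C1 * K * 2 powr (\<beta> + \<gamma>) * (hi - \<alpha>0) powr (1 - \<beta>) * (\<alpha> - \<alpha>0 - lam * s) powr (- (1 + \<gamma>))"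
    if s: "0 \<le> s" "s \<le> t" for s
  proof -
    have "lam * s \<le> lam * t" "0 \<le> lam * s" using s lam_pos by auto
    then have level: "\<alpha>0 + lam * s < \<alpha>" and \<rho>: "0 < \<alpha> - \<alpha>0 - lam * s" "\<alpha> - \<alpha>0 - lam * s \<le> hi - \<alpha>0" using t by auto
    define \<rho> where "\<rho> = \<alpha> - \<alpha>0 - lam * s"
    have "N \<alpha> (E t s (b s) - E t s 0) \<le> C1 * K * (\<rho> / 2) powr (- (\<beta> + \<gamma>))"
      using Eb_bound[OF b s tT level t(3)] E_zero[OF s tT] by (simp add: \<rho>_def)
    also have "(\<rho> / 2) powr (- (\<beta> + \<gamma>)) = 2 powr (\<beta> + \<gamma>) * (\<rho> powr (1 - \<beta>) * \<rho> powr (- (1 + \<gamma>)))"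
    proof -
      have "\<rho> powr (1 - \<beta>) * \<rho> powr (- (1 + \<gamma>)) = \<rho> powr (- (\<beta> + \<gamma>))"
        by (simp add: powr_add[symmetric])
      moreover have "(\<rho> / 2) powr (- \<sigma>) = 2 powr \<sigma> * \<rho> powr (- \<sigma>)" for \<sigma>
        using \<rho> by (simp add: \<rho>_def powr_divide powr_minus field_simps)
      ultimately show ?thesis by (simp only:)
    qed
    also have "C1 * K * (2 powr (\<beta> + \<gamma>) * (\<rho> powr (1 - \<beta>) * \<rho> powr (- (1 + \<gamma>))))
        \<le> C1 * K * (2 powr (\<beta> + \<gamma>) * ((hi - \<alpha>0) powr (1 - \<beta>) * \<rho> powr (- (1 + \<gamma>))))"
      using \<rho> \<beta>1 constants K_pos by (intro mult_left_mono mult_right_mono powr_mono2) (auto simp: \<rho>_def)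
    finally show ?thesis by (simp add: \<rho>_def mult.assoc)
  qed
  then have "N \<alpha> (sol b t - sol (\<lambda>_. 0) t)
      \<le> C1 * K * 2 powr (\<beta> + \<gamma>) * (hi - \<alpha>0) powr (1 - \<beta>) / (lam * \<gamma>) * (\<alpha> - \<alpha>0 - lam * t) powr (- \<gamma>)"
    using b t constants K_pos by (intro sol_diff_bound admissible_zero) auto
  then show ?thesis by (simp add: M0_def)
qed

section \<open>Picard iteration\<close>

text \<open>The iterates are right-hand sides; the approximate solutions are
  \<open>sol (picard n)\<close>, beginning with the free evolution.\<close>

primrec picard where
  "picard 0 = (\<lambda>_. 0)"
| "picard (Suc n) = (\<lambda>s. F s (sol (picard n) s))"

lemma admissible_picard: "admissible (picard n)"
  by (induction n) (auto intro: admissible_zero admissible_step)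

lemma picard_diff_Suc:
  assumes "0 \<le> t" "\<alpha>0 + lam * t < \<alpha>" "\<alpha> \<le> hi"
  shows "N \<alpha> (sol (picard (Suc n)) t - sol (picard n) t) \<le> M0 * q ^ n * (\<alpha> - \<alpha>0 - lam * t) powr (- \<gamma>)"
  using assms
proof (induction n arbitrary: t \<alpha>)
  case 0
  then show ?case using sol_zero_diff[OF admissible_picard[of 1]] by simp
next
  case (Suc n)
  have "N \<alpha> (sol (picard (Suc (Suc n))) t - sol (picard (Suc n)) t)
      \<le> q * (M0 * q ^ n) * (\<alpha> - \<alpha>0 - lam * t) powr (- \<gamma>)"
    using contraction[of "sol (picard (Suc n))" "sol (picard n)" "M0 * q ^ n" t \<alpha>]
      Suc admissible_picard[of "Suc (Suc n)"] admissible_picard[of "Suc n"]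
      sol_in_ball[OF admissible_picard[of n]] sol_in_ball[OF admissible_picard[of "Suc n"]] M0_nonneg q(1)
    by simp
  then show ?case by (simp add: mult_ac)
qed

text \<open>The partial geometric sum is carried through the induction on \<open>k\<close>; dropping
  \<open>q ^ k\<close> at the end gives a bound independent of \<open>k\<close>.\<close>

lemma picard_diff:
  assumes t: "0 \<le> t" "\<alpha>0 + lam * t < \<alpha>" "\<alpha> \<le> hi"
  shows "N \<alpha> (sol (picard (n + k)) t - sol (picard n) t) \<le> M0 / (1 - q) * q ^ n * (\<alpha> - \<alpha>0 - lam * t) powr (- \<gamma>)"
proof -
  interpret A: banach_carrier "V \<alpha>" "N \<alpha>" using banach level_gt[OF t(1,2)] \<alpha>0 t by simp
  have in_V: "sol (picard j) t \<in> V \<alpha>" for j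
    using sol_in_ball[OF admissible_picard t] xball_subset by blast
  define w where "w = M0 * (\<alpha> - \<alpha>0 - lam * t) powr (- \<gamma>)"
  have w: "0 \<le> w" using M0_nonneg by (simp add: w_def)
  have "N \<alpha> (sol (picard (n + k)) t - sol (picard n) t) \<le> w * q ^ n * ((1 - q ^ k) / (1 - q))"
  proof (induction k)
    case 0
    then show ?case by (simp add: A.n_zero)
  next
    case (Suc k)
    have "N \<alpha> (sol (picard (n + Suc k)) t - sol (picard n) t)
        \<le> N \<alpha> (sol (picard (Suc (n + k))) t - sol (picard (n + k)) t) + N \<alpha> (sol (picard (n + k)) t - sol (picard n) t)"
      using A.triangle_diff[OF in_V in_V in_V, of "n + Suc k" n "n + k"] by simp
    also have "\<dots> \<le> w * q ^ (n + k) + w * q ^ n * ((1 - q ^ k) / (1 - q))"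
      using picard_diff_Suc[OF t, of "n + k"] Suc.IH by (simp add: w_def mult_ac)
    also have "\<dots> = w * q ^ n * ((1 - q ^ Suc k) / (1 - q))"
      using q by (simp add: power_add field_simps)
    finally show ?case .
  qed
  also have "\<dots> \<le> w * q ^ n * (1 / (1 - q))"
    using w q by (intro mult_left_mono divide_right_mono) auto
  finally show ?thesis by (simp add: w_def mult_ac)
qed

text \<open>Completeness provides a limit for each level separately. The norm of \<open>hi\<close>
  is the weakest, so convergence at any level implies convergence there, and all these limits are
  one vector. Letting the later index tend to infinity in \<open>picard_diff\<close> gives the
  rate.\<close>

lemma picard_limit_exists:
  assumes t: "0 \<le> t" "\<alpha>0 + lam * t < hi"
  shows "\<exists>l. \<forall>\<alpha>. \<alpha>0 + lam * t < \<alpha> \<and> \<alpha> \<le> hi \<longrightarrow> l \<in> V \<alpha> \<and>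
    (\<forall>n. N \<alpha> (l - sol (picard n) t) \<le> M0 / (1 - q) * q ^ n * (\<alpha> - \<alpha>0 - lam * t) powr (- \<gamma>))"
proof -
  have ex: "\<exists>l. l \<in> V \<alpha> \<and> (\<forall>e>0. \<exists>M. \<forall>i\<ge>M. N \<alpha> (sol (picard i) t - l) < e)"
    if \<alpha>: "\<alpha>0 + lam * t < \<alpha>" "\<alpha> \<le> hi" for \<alpha>
  proof -
    interpret A: banach_carrier "V \<alpha>" "N \<alpha>" using banach level_gt[OF t(1) \<alpha>(1)] \<alpha>0 \<alpha> by simp
    have in_V: "sol (picard j) t \<in> V \<alpha>" for j
      using sol_in_ball[OF admissible_picard t(1) \<alpha>] xball_subset by blast
    define w where "w = M0 / (1 - q) * (\<alpha> - \<alpha>0 - lam * t) powr (- \<gamma>)"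
    have cauchy: "\<exists>M. \<forall>i\<ge>M. \<forall>j\<ge>M. N \<alpha> (sol (picard i) t - sol (picard j) t) < e" if "e > 0" for e
    proof -
      have "(\<lambda>n. w * q ^ n) \<longlonglongrightarrow> w * 0"
        using q by (intro tendsto_intros LIMSEQ_power_zero) auto
      then have "eventually (\<lambda>n. w * q ^ n < e / 2) sequentially"
        using that by (intro order_tendstoD) auto
      then obtain M where M: "w * q ^ M < e / 2" by (auto simp: eventually_sequentially)
      have near: "N \<alpha> (sol (picard i) t - sol (picard M) t) < e / 2" if "i \<ge> M" for i
        using picard_diff[OF t(1) \<alpha>, of M "i - M"] M that by (simp add: w_def mult_ac)
      have "N \<alpha> (sol (picard i) t - sol (picard j) t) < e" if "i \<ge> M" "j \<ge> M" for i j
        using near[OF that(1)] near[OF that(2)] A.n_commute[OF in_V in_V, of j M]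
          A.triangle_diff[OF in_V in_V in_V, of i j M] by linarith
      then show ?thesis by blast
    qed
    obtain l where "l \<in> V \<alpha>" "\<And>e. e > 0 \<Longrightarrow> \<exists>M. \<forall>i\<ge>M. N \<alpha> (sol (picard i) t - l) < e"
      using A.Cauchy_limit[OF in_V cauchy] by blast
    then show ?thesis by blast
  qed
  interpret H: banach_carrier "V hi" "N hi" using banach \<alpha>0 by simp
  obtain l where l: "l \<in> V hi" "\<forall>e>0. \<exists>M. \<forall>i\<ge>M. N hi (sol (picard i) t - l) < e"
    using ex[OF t(2) order_refl] by blast
  have "l \<in> V \<alpha> \<and> (\<forall>n. N \<alpha> (l - sol (picard n) t) \<le> M0 / (1 - q) * q ^ n * (\<alpha> - \<alpha>0 - lam * t) powr (- \<gamma>))"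
    if \<alpha>: "\<alpha>0 + lam * t < \<alpha>" "\<alpha> \<le> hi" for \<alpha>
  proof -
    have lo: "lo \<le> \<alpha>" using level_gt[OF t(1) \<alpha>(1)] \<alpha>0 by simp
    interpret A: banach_carrier "V \<alpha>" "N \<alpha>" using banach lo \<alpha> by simp
    have in_V: "sol (picard j) t \<in> V \<alpha>" for j
      using sol_in_ball[OF admissible_picard t(1) \<alpha>] xball_subset by blast
    have in_H: "sol (picard j) t \<in> V hi" for j using in_V V_mono lo \<alpha> by blast
    obtain l' where l': "l' \<in> V \<alpha>" "\<forall>e>0. \<exists>M. \<forall>i\<ge>M. N \<alpha> (sol (picard i) t - l') < e"
      using ex[OF \<alpha>] by blast
    have l'H: "l' \<in> V hi" using l'(1) V_mono lo \<alpha> by blast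
    have "N hi (l - l') \<le> 0 + e" if e: "e > 0" for e
    proof -
      obtain M where M: "\<forall>i\<ge>M. N hi (sol (picard i) t - l) < e / 2"
        using l(2) half_gt_zero[OF e] by blast
      obtain M' where M': "\<forall>i\<ge>M'. N \<alpha> (sol (picard i) t - l') < e / 2"
        using l'(2) half_gt_zero[OF e] by blast
      define i where "i = max M M'"
      have i: "N hi (sol (picard i) t - l) < e / 2" "N \<alpha> (sol (picard i) t - l') < e / 2"
        using M M' by (auto simp: i_def)
      have "N hi (sol (picard i) t - l') \<le> N \<alpha> (sol (picard i) t - l')"
        using N_mono[OF lo \<alpha>(2) order_refl] in_V l'(1) A.diff_in by blast
      then show ?thesis
        using i H.triangle_diff[OF l(1) in_H l'H, of i] H.n_commute[OF l(1) in_H, of i] by linarith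
    qed
    then have "N hi (l - l') \<le> 0" by (rule field_le_epsilon)
    then have "l = l'"
      using H.n_nonneg[of "l - l'"] H.eq_0_iff[of "l - l'"] H.diff_in[OF l(1) l'H] by simp
    have lV: "l \<in> V \<alpha>" and lim: "\<forall>e>0. \<exists>M. \<forall>i\<ge>M. N \<alpha> (sol (picard i) t - l) < e"
      unfolding \<open>l = l'\<close> by (fact l')+
    have "N \<alpha> (l - sol (picard n) t) \<le> M0 / (1 - q) * q ^ n * (\<alpha> - \<alpha>0 - lam * t) powr (- \<gamma>)" for n
    proof (rule field_le_epsilon)
      fix e :: real assume "e > 0"
      then obtain M where M: "\<forall>i\<ge>M. N \<alpha> (sol (picard i) t - l) < e" using lim by blast
      have "N \<alpha> (l - sol (picard n) t) \<le> N \<alpha> (l - sol (picard (n + M)) t) + N \<alpha> (sol (picard (n + M)) t - sol (picard n) t)"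
        using A.triangle_diff lV in_V by blast
      moreover have "N \<alpha> (l - sol (picard (n + M)) t) < e"
        using M A.n_commute[OF lV in_V] by simp
      ultimately show "N \<alpha> (l - sol (picard n) t) \<le> M0 / (1 - q) * q ^ n * (\<alpha> - \<alpha>0 - lam * t) powr (- \<gamma>) + e"
        using picard_diff[OF t(1) \<alpha>, of n M] by linarith
    qed
    with lV show ?thesis by blast
  qed
  then show ?thesis by blast
qed

section \<open>The limit of the iterates\<close>

definition usol where
  "usol t = (SOME l. \<forall>\<alpha>. \<alpha>0 + lam * t < \<alpha> \<and> \<alpha> \<le> hi \<longrightarrow> l \<in> V \<alpha> \<and>
    (\<forall>n. N \<alpha> (l - sol (picard n) t) \<le> M0 / (1 - q) * q ^ n * (\<alpha> - \<alpha>0 - lam * t) powr (- \<gamma>)))"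

lemma usol_approx:
  assumes t: "0 \<le> t" "\<alpha>0 + lam * t < \<alpha>" "\<alpha> \<le> hi"
  shows "usol t \<in> V \<alpha>"
    and "N \<alpha> (usol t - sol (picard n) t) \<le> M0 / (1 - q) * q ^ n * (\<alpha> - \<alpha>0 - lam * t) powr (- \<gamma>)"
proof -
  have "\<alpha>0 + lam * t < hi" using t by simp
  from someI_ex[OF picard_limit_exists[OF t(1) this]] t(2,3)
  have "usol t \<in> V \<alpha> \<and>
      (\<forall>n. N \<alpha> (usol t - sol (picard n) t) \<le> M0 / (1 - q) * q ^ n * (\<alpha> - \<alpha>0 - lam * t) powr (- \<gamma>))"
    unfolding usol_def by blast
  then show "usol t \<in> V \<alpha>"
    and "N \<alpha> (usol t - sol (picard n) t) \<le> M0 / (1 - q) * q ^ n * (\<alpha> - \<alpha>0 - lam * t) powr (- \<gamma>)"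
    by blast+
qed

lemma geometric_small:
  fixes e w :: real
  assumes "e > 0"
  obtains n where "w * q ^ n < e"
proof -
  have "(\<lambda>n. w * q ^ n) \<longlonglongrightarrow> w * 0"
    using q by (intro tendsto_intros LIMSEQ_power_zero) auto
  then have "eventually (\<lambda>n. w * q ^ n < e) sequentially"
    using assms by (intro order_tendstoD) auto
  then show ?thesis using that by (auto simp: eventually_sequentially)
qed

text \<open>The balls are closed under limits in their own norm.\<close>

lemma usol_in_ball:
  assumes t: "0 \<le> t" "\<alpha>0 + lam * t < \<alpha>" "\<alpha> \<le> hi"
  shows "usol t \<in> xball \<alpha>"
proof -
  interpret A: banach_carrier "V \<alpha>" "N \<alpha>" using banach level_gt[OF t(1,2)] \<alpha>0 t by simp
  have x: "x \<in> V \<alpha>" using x_in level_gt[OF t(1,2)] \<alpha>0 t by simp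
  show ?thesis
  proof (cases r)
    case (real R)
    have "N \<alpha> (usol t - x) \<le> R"
    proof (rule field_le_epsilon)
      fix e :: real assume "e > 0"
      then obtain n where n: "M0 / (1 - q) * (\<alpha> - \<alpha>0 - lam * t) powr (- \<gamma>) * q ^ n < e"
        by (rule geometric_small)
      have sol: "sol (picard n) t \<in> V \<alpha>" "N \<alpha> (sol (picard n) t - x) \<le> R"
        using sol_in_ball[OF admissible_picard t, of n] real by (auto simp: scale_ball_def)
      then show "N \<alpha> (usol t - x) \<le> R + e"
        using usol_approx(2)[OF t, of n] n A.triangle_diff[OF usol_approx(1)[OF t] sol(1) x]
        by (simp add: mult_ac)
    qed
    then show ?thesis using usol_approx(1)[OF t] real by (simp add: scale_ball_def)
  qed (use usol_approx(1)[OF t] constants(8) in auto)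
qed

text \<open>On the times of a smaller level \<open>\<alpha>'\<close> the weight is at most
  \<open>(\<alpha> - \<alpha>') powr - \<gamma>\<close>, so the convergence is uniform and
  continuity passes to the limit by the usual splitting into thirds.\<close>

lemma usol_continuous:
  assumes \<alpha>: "\<alpha>0 < \<alpha>" "\<alpha> \<le> hi"
  shows "continuous_map (top_of_set {s. 0 \<le> s \<and> \<alpha>0 + lam * s < \<alpha>}) (norm_topology (V \<alpha>) (N \<alpha>)) usol"
proof (rule continuous_localI[OF \<alpha>])
  fix \<alpha>' assume \<alpha>': "\<alpha>0 < \<alpha>'" "\<alpha>' < \<alpha>"
  interpret A: banach_carrier "V \<alpha>" "N \<alpha>" using banach \<alpha> \<alpha>0 by simp
  let ?S = "{s. 0 \<le> s \<and> \<alpha>0 + lam * s < \<alpha>'}"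
  define w where "w = M0 / (1 - q) * (\<alpha> - \<alpha>') powr (- \<gamma>)"
  have approx: "N \<alpha> (usol s - sol (picard n) s) \<le> w * q ^ n" if "s \<in> ?S" for s n
  proof -
    have "N \<alpha> (usol s - sol (picard n) s) \<le> M0 / (1 - q) * q ^ n * (\<alpha> - \<alpha>0 - lam * s) powr (- \<gamma>)"
      using usol_approx(2)[of s \<alpha> n] that \<alpha>' \<alpha> by simp
    also have "\<dots> \<le> M0 / (1 - q) * q ^ n * (\<alpha> - \<alpha>') powr (- \<gamma>)"
      using that \<alpha>' constants M0_nonneg q by (intro mult_left_mono powr_mono2') auto
    finally show ?thesis by (simp add: w_def mult_ac)
  qed
  have in_V: "usol s \<in> V \<alpha>" "sol (picard n) s \<in> V \<alpha>" if "s \<in> ?S" for s n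
    using that usol_approx(1)[of s \<alpha>] sol_in_ball[OF admissible_picard, of s \<alpha> n] xball_subset \<alpha>' \<alpha> by auto
  have "\<exists>d>0. \<forall>y\<in>?S. dist y a < d \<longrightarrow> N \<alpha> (usol y - usol a) < e" if a: "a \<in> ?S" and e: "e > 0" for a e
  proof -
    have e3: "e / 3 > 0" using e by simp
    then obtain n where n: "w * q ^ n < e / 3" by (rule geometric_small)
    have "a \<in> {s. 0 \<le> s \<and> \<alpha>0 + lam * s < \<alpha>}" using a \<alpha>' by simp
    then obtain d where d: "d > 0" "\<forall>y\<in>{s. 0 \<le> s \<and> \<alpha>0 + lam * s < \<alpha>}. dist y a < d \<longrightarrow>
        N \<alpha> (sol (picard n) y - sol (picard n) a) < e / 3"
      using A.continuous_map_norm_topologyD(2)[OF sol_continuous[OF admissible_picard \<alpha>] _ e3] by blast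
    have "N \<alpha> (usol y - usol a) < e" if y: "y \<in> ?S" and "dist y a < d" for y
    proof -
      have "N \<alpha> (sol (picard n) y - sol (picard n) a) < e / 3" using d(2) that \<alpha>' by simp
      moreover have "N \<alpha> (usol y - usol a) \<le> N \<alpha> (usol y - sol (picard n) y) + N \<alpha> (sol (picard n) y - usol a)"
        using in_V a y by (intro A.triangle_diff) auto
      moreover have "N \<alpha> (sol (picard n) y - usol a)
          \<le> N \<alpha> (sol (picard n) y - sol (picard n) a) + N \<alpha> (sol (picard n) a - usol a)"
        using in_V a y by (intro A.triangle_diff) auto
      moreover have "N \<alpha> (sol (picard n) a - usol a) = N \<alpha> (usol a - sol (picard n) a)"
        using in_V a by (intro A.n_commute) auto
      ultimately show ?thesis using approx[OF y, of n] approx[OF a, of n] n by linarith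
    qed
    then show ?thesis using d(1) by blast
  qed
  then show "continuous_map (top_of_set ?S) (norm_topology (V \<alpha>) (N \<alpha>)) usol"
    unfolding A.continuous_map_norm_topology_iff using in_V(1) by blast
qed

text \<open>The Lipschitz estimate from an intermediate level \<open>\<alpha>'\<close> makes
  \<open>F\<close> of the iterates converge, and their common bound does not involve
  \<open>\<alpha>'\<close>.\<close>

lemma F_usol_bound:
  assumes t: "0 \<le> t" "\<alpha>0 + lam * t < \<alpha>" "\<alpha> \<le> hi" and \<tau>: "0 \<le> \<tau>" "\<tau> < T"
  shows "N \<alpha> (F \<tau> (usol t)) \<le> K * (\<alpha> - \<alpha>0 - lam * t) powr (- \<gamma>)"
proof (rule field_le_epsilon)
  fix e :: real assume "e > 0"
  obtain \<alpha>' where \<alpha>': "\<alpha>0 + lam * t < \<alpha>'" "\<alpha>' < \<alpha>" using dense[OF t(2)] by blast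
  then have lo: "lo \<le> \<alpha>'" and hi: "\<alpha>' \<le> hi" using level_gt[OF t(1) \<alpha>'(1)] \<alpha>0 t by auto
  interpret A: banach_carrier "V \<alpha>" "N \<alpha>" using banach lo \<alpha>' t by simp
  obtain n where n: "C2 / (\<alpha> - \<alpha>') powr (1 - \<beta>) * (M0 / (1 - q)) * (\<alpha>' - \<alpha>0 - lam * t) powr (- \<gamma>) * q ^ n < e"
    using geometric_small[OF \<open>e > 0\<close>] by blast
  have ball: "usol t \<in> xball \<alpha>'" "sol (picard n) t \<in> xball \<alpha>'"
    using usol_in_ball sol_in_ball[OF admissible_picard] t(1) \<alpha>'(1) hi by auto
  have "N \<alpha> (F \<tau> (usol t) - F \<tau> (sol (picard n) t)) \<le> C2 / (\<alpha> - \<alpha>') powr (1 - \<beta>) * N \<alpha>' (usol t - sol (picard n) t)"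
    using F_lipschitz[OF \<tau> lo \<alpha>'(2) t(3)] ball by blast
  also have "\<dots> \<le> C2 / (\<alpha> - \<alpha>') powr (1 - \<beta>) * (M0 / (1 - q) * q ^ n * (\<alpha>' - \<alpha>0 - lam * t) powr (- \<gamma>))"
    using usol_approx(2)[OF t(1) \<alpha>'(1) hi] constants by (intro mult_left_mono) auto
  also have "\<dots> < e" using n by (simp add: mult_ac)
  finally have "N \<alpha> (F \<tau> (usol t) - F \<tau> (sol (picard n) t)) < e" .
  moreover have "N \<alpha> (F \<tau> (usol t)) \<le> N \<alpha> (F \<tau> (usol t) - F \<tau> (sol (picard n) t)) + N \<alpha> (F \<tau> (sol (picard n) t))"
    using F_in[OF \<tau> lo \<alpha>'(2) t(3)] ball by (intro A.norm_le_diff) auto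
  ultimately show "N \<alpha> (F \<tau> (usol t)) \<le> K * (\<alpha> - \<alpha>0 - lam * t) powr (- \<gamma>) + e"
    using F_sol_bound[OF admissible_picard t \<tau>, of n] by linarith
qed

lemma admissible_usol: "admissible (\<lambda>s. F s (usol s))"
  using time_le(2)[OF less_imp_le] by (intro admissible_F usol_continuous usol_in_ball F_usol_bound) auto

text \<open>Both sides are within \<open>w * q ^ (n + 1)\<close> of the iterate with index
  \<open>n + 1\<close>: one by contraction, the other by the rate of convergence. The top level
  suffices since equality of vectors does not depend on the norm.\<close>

lemma usol_fixed_point:
  assumes t: "0 \<le> t" "\<alpha>0 + lam * t < hi"
  shows "sol (\<lambda>s. F s (usol s)) t = usol t"
proof -
  interpret H: banach_carrier "V hi" "N hi" using banach \<alpha>0 by simp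
  have in_V: "sol (\<lambda>s. F s (usol s)) t \<in> V hi" "usol t \<in> V hi" "sol (picard n) t \<in> V hi" for n
    using sol_in_ball[OF admissible_usol t order_refl] usol_approx(1)[OF t order_refl]
      sol_in_ball[OF admissible_picard t order_refl] xball_subset by blast+
  define w where "w = M0 / (1 - q) * (hi - \<alpha>0 - lam * t) powr (- \<gamma>)"
  have "N hi (sol (\<lambda>s. F s (usol s)) t - usol t) \<le> 0 + e" if e: "e > 0" for e
  proof -
    obtain n where n: "2 * w * q * q ^ n < e" using geometric_small[OF e] by blast
    have "N hi (sol (\<lambda>s. F s (usol s)) t - sol (\<lambda>s. F s (sol (picard n) s)) t)
        \<le> q * (M0 / (1 - q) * q ^ n) * (hi - \<alpha>0 - lam * t) powr (- \<gamma>)"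
      using t q M0_nonneg usol_in_ball sol_in_ball[OF admissible_picard] usol_approx(2)
      by (intro contraction admissible_usol admissible_step admissible_picard) auto
    then have "N hi (sol (\<lambda>s. F s (usol s)) t - sol (picard (Suc n)) t) \<le> w * q * q ^ n"
      by (simp add: w_def mult_ac)
    moreover have "N hi (usol t - sol (picard (Suc n)) t) \<le> w * q * q ^ n"
      using usol_approx(2)[OF t order_refl, of "Suc n"] by (simp add: w_def mult_ac del: picard.simps)
    ultimately show ?thesis
      using n H.triangle_diff[OF in_V(1,3,2), of "Suc n"] H.n_commute[OF in_V(2,3), of "Suc n"]
      by (simp del: picard.simps)
  qed
  then have "N hi (sol (\<lambda>s. F s (usol s)) t - usol t) \<le> 0" by (rule field_le_epsilon)
  then show ?thesis
    using H.n_nonneg[OF H.diff_in[OF in_V(1,2)]] H.eq_0_iff[OF H.diff_in[OF in_V(1,2)]] by simp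
qed

section \<open>Verification of the integral equation and of the estimates\<close>

lemma lifetime: "{0..<(\<alpha> - \<alpha>0) / lam} = {s. 0 \<le> s \<and> \<alpha>0 + lam * s < \<alpha>}"
  using lam_pos by (auto simp: field_simps)

lemma is_solution_usol: "is_solution lo hi V N U B r x \<alpha>0 lam usol"
  unfolding is_solution_def lifetime
proof (intro conjI ballI)
  show "usol \<in> {s. 0 \<le> s \<and> \<alpha>0 + lam * s < hi} \<rightarrow> V hi" using usol_approx(1) by auto
next
  fix \<alpha> assume "\<alpha> \<in> {\<alpha>0<..hi}"
  then show "continuous_map (top_of_set {s. 0 \<le> s \<and> \<alpha>0 + lam * s < \<alpha>}) (norm_topology (V \<alpha>) (N \<alpha>)) usol"
    using usol_continuous by simp
next
  fix \<alpha> t assume "\<alpha> \<in> {\<alpha>0<..hi}" "t \<in> {s. 0 \<le> s \<and> \<alpha>0 + lam * s < \<alpha>}"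
  then show "usol t \<in> xball \<alpha>" using usol_in_ball by simp
next
  fix \<alpha> t assume "\<alpha> \<in> {\<alpha>0<..hi}" "t \<in> {s. 0 \<le> s \<and> \<alpha>0 + lam * s < \<alpha>}"
  then have \<alpha>: "\<alpha>0 < \<alpha>" "\<alpha> \<le> hi" and t: "0 \<le> t" "\<alpha>0 + lam * t < \<alpha>" by auto
  have tT: "t < T" using time_le(2)[of t \<alpha>] t \<alpha> by simp
  obtain \<alpha>' where \<alpha>': "\<alpha>0 + lam * t < \<alpha>'" "\<alpha>' < \<alpha>" using dense[OF t(2)] by blast
  obtain \<alpha>'' where \<alpha>'': "\<alpha>' < \<alpha>''" "\<alpha>'' < \<alpha>" using dense[OF \<alpha>'(2)] by blast
  have lo: "\<alpha>0 < \<alpha>'" using level_gt t(1) \<alpha>'(1) by blast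
  have eq: "E t s (F s (usol s)) = U t s \<alpha>'' \<alpha> (B s \<alpha>' \<alpha>'' (usol s))" if s: "s \<in> {0..t}" for s
  proof -
    have "lam * s \<le> lam * t" using s lam_pos by simp
    then have "usol s \<in> xball \<alpha>'" using usol_in_ball[of s \<alpha>'] s \<alpha>' \<alpha> by simp
    then have "B s \<alpha>' \<alpha>'' (usol s) = F s (usol s)" "F s (usol s) \<in> V \<alpha>''"
      using F_eq[of s \<alpha>' \<alpha>''] F_in[of s \<alpha>' \<alpha>''] s tT lo \<alpha>0 \<alpha>'' \<alpha> by auto
    then show ?thesis using E_eq[of s t \<alpha>'' \<alpha> "F s (usol s)"] s tT lo \<alpha>0 \<alpha>'' \<alpha> by simp
  qed
  have "has_riemann_integral_on (V \<alpha>) (N \<alpha>) (\<lambda>s. U t s \<alpha>'' \<alpha> (B s \<alpha>' \<alpha>'' (usol s)))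
      (duh (\<lambda>s. F s (usol s)) t t) 0 t"
    using duh_integral[OF admissible_usol t(1) order_refl tT t(2) \<alpha>(2)] eq
    by (rule has_riemann_integral_on_cong)
  moreover have "usol t = U t 0 lo \<alpha> x + duh (\<lambda>s. F s (usol s)) t t"
    using usol_fixed_point[of t] g_eq[of t \<alpha>] t tT \<alpha> \<alpha>0 by (simp add: sol_def)
  moreover have "t < (\<alpha>' - \<alpha>0) / lam" using \<alpha>' lam_pos by (simp add: field_simps)
  ultimately show "\<exists>\<alpha>' \<alpha>'' I. \<alpha>0 \<le> \<alpha>' \<and> \<alpha>' < \<alpha>'' \<and> \<alpha>'' < \<alpha> \<and> t < (\<alpha>' - \<alpha>0) / lam \<and>
      has_riemann_integral_on (V \<alpha>) (N \<alpha>) (\<lambda>s. U t s \<alpha>'' \<alpha> (B s \<alpha>' \<alpha>'' (usol s))) I 0 t \<and>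
      usol t = U t 0 lo \<alpha> x + I"
    using lo \<alpha>'' by (intro exI[of _ \<alpha>'] exI[of _ \<alpha>''] exI[of _ "duh (\<lambda>s. F s (usol s)) t t"]) simp
qed

text \<open>The limit is compared with the iterate of index 0, which is the free evolution
  \<open>g\<close>; the latter is bounded at all levels by A3 and the norm of
  \<open>x\<close>.\<close>

lemma usol_weighted_bound:
  assumes t: "0 \<le> t" "\<alpha>0 + lam * t < \<alpha>" "\<alpha> \<le> hi"
  shows "(\<alpha> - \<alpha>0 - lam * t) powr \<gamma> * N \<alpha> (usol t)
    \<le> M0 / (1 - q) + (hi - \<alpha>0) powr \<gamma> * (C \<alpha>0 * ((hi - \<alpha>0) / lam) + N lo x)"
proof -
  have \<alpha>: "\<alpha>0 < \<alpha>" using level_gt t by blast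
  have tT: "t < T" using time_le(2)[of t \<alpha>] t by simp
  interpret A: banach_carrier "V \<alpha>" "N \<alpha>" using banach \<alpha> \<alpha>0 t by simp
  define \<rho> where "\<rho> = \<alpha> - \<alpha>0 - lam * t"
  have "0 \<le> lam * t" using lam_pos t by simp
  then have \<rho>: "0 < \<rho>" "\<rho> \<le> hi - \<alpha>0" using t by (auto simp: \<rho>_def)
  have in_V: "g t \<in> V \<alpha>" "x \<in> V \<alpha>" "usol t \<in> V \<alpha>"
    using g_in x_in usol_approx(1) t tT \<alpha> \<alpha>0 by auto
  have "duh (\<lambda>_. 0) t t = 0"
  proof -
    have "N \<alpha> (duh (\<lambda>_. 0) t t) \<le> 0"
      using t tT E_zero by (intro duh_bound[OF admissible_zero, where h = "\<lambda>_. 0"]) (auto simp: A.n_zero)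
    then show ?thesis
      using duh_in[OF admissible_zero, of t t \<alpha>] t tT A.n_nonneg A.eq_0_iff by (metis order_antisym order_refl)
  qed
  then have "N \<alpha> (usol t - g t) \<le> M0 / (1 - q) * \<rho> powr (- \<gamma>)"
    using usol_approx(2)[OF t, of 0] by (simp add: sol_def \<rho>_def)
  then have 1: "\<rho> powr \<gamma> * N \<alpha> (usol t - g t) \<le> \<rho> powr \<gamma> * (M0 / (1 - q) * \<rho> powr (- \<gamma>))"
    by (intro mult_left_mono) auto
  have "\<rho> powr \<gamma> * \<rho> powr (- \<gamma>) = 1" using \<rho> by (simp add: powr_add[symmetric])
  then have 2: "\<rho> powr \<gamma> * (M0 / (1 - q) * \<rho> powr (- \<gamma>)) = M0 / (1 - q)"
    by (simp add: mult.left_commute)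
  have "N \<alpha> (g t - g 0) \<le> C \<alpha>0 * \<bar>t - 0\<bar>" using t \<alpha> by (intro g_lipschitz) auto
  also have "\<dots> \<le> C \<alpha>0 * ((hi - \<alpha>0) / lam)"
    using t constants lam_pos by (intro mult_left_mono) (auto simp: field_simps)
  finally have "N \<alpha> (g t - x) \<le> C \<alpha>0 * ((hi - \<alpha>0) / lam)" by (simp add: g_0)
  moreover have "N \<alpha> x \<le> N lo x" using N_mono[of lo \<alpha> x] x_in_lo \<alpha> \<alpha>0 t by simp
  ultimately have "N \<alpha> (g t) \<le> C \<alpha>0 * ((hi - \<alpha>0) / lam) + N lo x"
    using A.norm_le_diff[OF in_V(1,2)] by linarith
  then have 3: "\<rho> powr \<gamma> * N \<alpha> (g t) \<le> (hi - \<alpha>0) powr \<gamma> * (C \<alpha>0 * ((hi - \<alpha>0) / lam) + N lo x)"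
    using \<rho> constants A.n_nonneg[OF in_V(1)] by (intro mult_mono powr_mono2) auto
  have "\<rho> powr \<gamma> * N \<alpha> (usol t) \<le> \<rho> powr \<gamma> * N \<alpha> (usol t - g t) + \<rho> powr \<gamma> * N \<alpha> (g t)"
    using mult_left_mono[OF A.norm_le_diff[OF in_V(3,1)], of "\<rho> powr \<gamma>"] by (simp add: distrib_left)
  then show ?thesis using 1 2 3 unfolding \<rho>_def[symmetric] by linarith
qed

end

theorem theorem2p5:
  fixes V :: "real \<Rightarrow> 'a::real_vector set"
    and N :: "real \<Rightarrow> 'a \<Rightarrow> real"
    and lo hi T \<beta> C1 C2 C3 \<alpha>0 \<gamma> lam :: real
    and C :: "real \<Rightarrow> real"
    and r :: ereal
    and x :: 'a
    and U :: "real \<Rightarrow> real \<Rightarrow> 'a scale_op"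
    and B :: "real \<Rightarrow> 'a scale_op"
  assumes "banach_scale lo hi V N"
    and "0 < T"
    and "x \<in> V lo"
    and "cond_A1 lo hi V N T U"
    and "cond_A2 lo hi V N T U \<beta> C1"
    and "cond_A3 lo hi V N T U x C"
    and "cond_B1 lo hi V N T B r x"
    and "cond_B2 lo hi V N T B r x \<beta> C2"
    and "cond_B3 lo hi N T B x C3"
    and "(\<beta> = 0 \<and> 0 < r) \<or> (0 < \<beta> \<and> \<beta> < 1/2 \<and> r = \<infinity>)"
    and "lo < \<alpha>0" "\<alpha>0 < hi"
    and "\<beta> < \<gamma>" "\<gamma> < 1 - \<beta>"
    \<comment> \<open>convention on the constants of A3: passing to a weaker norm does not increase them\<close>
    and "\<forall>\<alpha>\<in>{\<alpha>0..hi}. C \<alpha> \<le> C \<alpha>0"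
    and "lambda0 lo hi T \<beta> C1 C2 C3 (C \<alpha>0) (N lo x) \<alpha>0 \<gamma> r < lam"
  shows "\<exists>u. is_solution lo hi V N U B r x \<alpha>0 lam u \<and>
    (SUP \<alpha>\<in>{\<alpha>0<..hi}. SUP t\<in>{0..<(\<alpha> - \<alpha>0) / lam}.
       ereal ((\<alpha> - \<alpha>0 - lam * t) powr \<gamma> * N \<alpha> (u t))) < \<infinity> \<and>
    (\<forall>\<tau>\<in>{0..(hi - \<alpha>0) / lam}. \<forall>\<alpha>\<in>{\<alpha>0<..hi}. \<forall>t\<in>{0..<(\<alpha> - \<alpha>0) / lam}.
       \<forall>\<alpha>'\<in>{\<alpha>0..<\<alpha>}. t < (\<alpha>' - \<alpha>0) / lam \<longrightarrow>
         (\<alpha> - \<alpha>0 - lam * t) powr \<gamma> * N \<alpha> (B \<tau> \<alpha>' \<alpha> (u t))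
           \<le> (C3 / (\<alpha>0 - lo) + C \<alpha>0) * (hi - \<alpha>0) powr \<gamma> * (1 + N lo x))"
proof -
  interpret evolution_problem V N lo hi T \<beta> C1 C2 C3 \<alpha>0 \<gamma> lam C r x U B
    by unfold_locales (use assms in blast)+
  show ?thesis
  proof (intro exI[of _ usol] conjI ballI impI)
    show "is_solution lo hi V N U B r x \<alpha>0 lam usol" by (rule is_solution_usol)
    have "(SUP \<alpha>\<in>{\<alpha>0<..hi}. SUP t\<in>{0..<(\<alpha> - \<alpha>0) / lam}.
        ereal ((\<alpha> - \<alpha>0 - lam * t) powr \<gamma> * N \<alpha> (usol t)))
      \<le> ereal (M0 / (1 - q) + (hi - \<alpha>0) powr \<gamma> * (C \<alpha>0 * ((hi - \<alpha>0) / lam) + N lo x))"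
      unfolding lifetime using usol_weighted_bound by (intro SUP_least) auto
    then show "(SUP \<alpha>\<in>{\<alpha>0<..hi}. SUP t\<in>{0..<(\<alpha> - \<alpha>0) / lam}.
        ereal ((\<alpha> - \<alpha>0 - lam * t) powr \<gamma> * N \<alpha> (usol t))) < \<infinity>"
      by (rule order.strict_trans1) simp
    fix \<tau> \<alpha> t \<alpha>'
    assume \<tau>: "\<tau> \<in> {0..(hi - \<alpha>0) / lam}" and \<alpha>: "\<alpha> \<in> {\<alpha>0<..hi}" and t: "t \<in> {0..<(\<alpha> - \<alpha>0) / lam}"
      and \<alpha>': "\<alpha>' \<in> {\<alpha>0..<\<alpha>}" "t < (\<alpha>' - \<alpha>0) / lam"
    have t': "0 \<le> t" "\<alpha>0 + lam * t < \<alpha>" "\<alpha>0 + lam * t < \<alpha>'"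
      using t \<alpha>' lam_pos by (auto simp: field_simps)
    \<comment> \<open>The right endpoint of the interval for \<open>\<tau>\<close> is included; it
      is still smaller than \<open>T\<close> because \<open>lam\<close> exceeds
      \<open>(hi - lo) / T\<close>.\<close>
    have \<tau>': "0 \<le> \<tau>" "\<tau> < T"
      using \<tau> time_le(2)[of \<tau> hi] lam_pos by (auto simp: field_simps)
    have "B \<tau> \<alpha>' \<alpha> (usol t) = F \<tau> (usol t)"
      using F_eq[OF \<tau>', of \<alpha>' \<alpha>] usol_in_ball[of t \<alpha>'] t' \<alpha> \<alpha>' \<alpha>0 by simp
    moreover have "(\<alpha> - \<alpha>0 - lam * t) powr \<gamma> * N \<alpha> (F \<tau> (usol t))
        \<le> (\<alpha> - \<alpha>0 - lam * t) powr \<gamma> * (K * (\<alpha> - \<alpha>0 - lam * t) powr (- \<gamma>))"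
      using F_usol_bound[of t \<alpha> \<tau>] t' \<alpha> \<tau>' by (intro mult_left_mono) auto
    moreover have "(\<alpha> - \<alpha>0 - lam * t) powr \<gamma> * (\<alpha> - \<alpha>0 - lam * t) powr (- \<gamma>) = 1"
      using t' by (simp add: powr_add[symmetric])
    then have "(\<alpha> - \<alpha>0 - lam * t) powr \<gamma> * (K * (\<alpha> - \<alpha>0 - lam * t) powr (- \<gamma>)) = K"
      by (simp add: mult.left_commute)
    ultimately show "(\<alpha> - \<alpha>0 - lam * t) powr \<gamma> * N \<alpha> (B \<tau> \<alpha>' \<alpha> (usol t))
        \<le> (C3 / (\<alpha>0 - lo) + C \<alpha>0) * (hi - \<alpha>0) powr \<gamma> * (1 + N lo x)"
      unfolding K_def[symmetric] by simp
  qed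
qed

end
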